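(* Let $\pi=(q,T)$ be a fixed open-loop policy of finite window size $W$ such that $\overline q$ has support in one recurrence class of $T$. Then for any $1\le m\le M$, as $\gamma\to\infty$, $$\mathrm{ARL}(\tau_{m,\pi},\pi)\ge M\gamma,\qquad \mathrm{WADD}_m(\tau_{m,\pi},\pi)\le\frac{\log\gamma}{I_{m,\pi}}(1+o(1)),$$ where $o(1)$ denotes a function $g(\gamma)$ with $\lim_{\gamma\to\infty}g(\gamma)=0$.
   Context: Signal model. $p_0,p_1,\dots,p_M$ are distinct pdfs on $\mathbb{R}^N$. The signal $X_1,X_2,\dots$ is a sequence of independent random vectors with $X_t\sim p_0$ for $t<\nu$ and $X_t\sim p_m$ for $t\ge\nu$, where the change point $\nu\ge 0$ and $m\in\{1,\dots,M\}$ are unknown deterministic constants. There is a finite set of actions $\mathcal{A}=\{1,\dots,|\mathcal{A}|\}$. At each time $t$ an action $A_t\in\mathcal{A}$ is chosen and the pair $(A_t,Y_t)$ is observed, where $Y_t=A_t(X_t)$ is a function of $X_t$ determined by the action. $p_m(\cdot\mid a)$ denotes the conditional pdf of $Y_t$ given $A_t=a$ when $X_t\sim p_m$; given $A_t$, $Y_t$ is conditionally independent of $Y_1,\dots,Y_{t-1},A_1,\dots,A_{t-1}$. For each $m\in\{1,\dots,M\}$ there is an action $a$ under which $p_0$ and $p_m$ are distinguishable, i.e. $p_m(\cdot\mid a)\ne p_0(\cdot\mid a)$. $\mathbb{P}_{\nu,m},\mathbb{E}_{\nu,m}$ denote probability and expectation when the change point is $\nu$ and the post-change pdf is $p_m$;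 $\mathbb{E}_\infty$ is expectation when there is no change. $D(\cdot\,\|\,\cdot)$ is the Kullback-Leibler divergence and $a^{k:t}=(a_k,\dots,a_t)$. Open-loop policies. An open-loop policy of window size $W$ chooses $A_{t+1}$, for $t\ge W$, by a fixed (time-independent) randomized function of the past $W$ actions; equivalently, it is a Markov chain of order $W$ on $\mathcal{A}$, written $\pi=(q,T)$, where $q$ is the distribution of $A^{1:W}$ on $\mathcal{A}^W$ and $T$ is the transition matrix of the $\mathcal{A}^W$-valued chain of windows $A^{t-W+1:t}$. For $W=0$ the actions are i.i.d. with pmf $q$ on $\mathcal{A}$; this is represented as a chain on $\mathcal{A}$ with all rows of $T$ equal to $q$ (and in formulas $\mathcal{A}^W$, $\alpha[W]$ are read as $\mathcal{A}$, $\alpha$). For $\alpha\in\mathcal{A}^W$, $\alpha[j]$ is its $j$-th entry. $\overline q(\alpha)=\lim_{t\to\infty}\mathbb{E}\big[\frac1t\sum_{j=1}^t \mathbf 1\{\text{the } j\text{-th state of the window chain equals }\alpha\}\big]$ for $\alpha\in\mathcal{A}^W$; it is a stationary distribution of $T$. $$I_{m,\pi}=\sum_{\alpha\in\mathcal{A}^W}\overline q(\alpha)\,D\big(p_m(\cdot\mid\alpha[W])\,\|\,p_0(\cdot\mid\alpha[W])\big);$$ if $I_{m,\pi}=0$ the bound $\log\gamma/I_{m,\pi}$ is read as $+\infty$. $\mathrm{WADD}_m(\tau,\pi)=\sup_{\nu\ge1}\operatorname{ess\,sup}\mathbb{E}_{\nu,m}[(\tau-\nu+1)^+\mid A^{1:(\nu-1)},Y^{1:(\nu-1)}]$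 and $\mathrm{ARL}(\tau,\pi)=\mathbb{E}_\infty[\tau]$. CuSum stopping time for $p_m$: $S_m(0,\pi)=0$, $S_m(t,\pi)=\big(S_m(t-1,\pi)+\log\frac{p_m(Y_t\mid A_t)}{p_0(Y_t\mid A_t)}\big)^+$, and $\tau_{m,\pi}=\inf\{t:S_m(t,\pi)>\log(M\gamma)\}$.
   Formalization: The WADD bound is stated only when the information rate I_{m,π} is finite; for I_{m,π}=∞ the right-hand side would be 0 while WADD is at least 1, so the claim fails as written. *)

theory Defs
  imports "HOL-Probability.Probability"
begin

section \<open>Signal and observation model\<close>

text \<open>
  The signal takes values in \<^typ>\<open>real ^ 'n\<close>, the finite action set is the type \<^typ>\<open>'a\<close>.
  \<open>obs a\<close> is the function that action \<open>a\<close> applies to the signal, and \<open>pc k a\<close> is the conditional pdf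
  \<open>p\<^sub>k(\<cdot> | a)\<close>, taken with respect to a reference measure \<open>ref a\<close> on the observation space \<open>OS\<close>.
  The reference measure may depend on the action, since different actions may retain
  a different number of coordinates.
\<close>

locale sensing_model =
  fixes M :: nat
    and p :: "nat \<Rightarrow> real ^ 'n::finite \<Rightarrow> real"
    and OS :: "'y measure"
    and ref :: "'a::finite \<Rightarrow> 'y measure"
    and obs :: "'a \<Rightarrow> real ^ 'n \<Rightarrow> 'y"
    and pc :: "nat \<Rightarrow> 'a \<Rightarrow> 'y \<Rightarrow> real"
  assumes pdf_nonneg: "k \<le> M \<Longrightarrow> 0 \<le> p k x"
    and pdf_measurable: "k \<le> M \<Longrightarrow> p k \<in> borel_measurable borel"
    and pdf_prob_space: "k \<le> M \<Longrightarrow> prob_space (density lborel (\<lambda>x. ennreal (p k x)))"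
    and pdf_distinct: "i \<le> M \<Longrightarrow> j \<le> M \<Longrightarrow> i \<noteq> j \<Longrightarrow> \<not> (AE x in lborel. p i x = p j x)"
    and sets_ref: "sets (ref a) = sets OS"
    and sigma_finite_ref: "sigma_finite_measure (ref a)"
    and pc_nonneg: "k \<le> M \<Longrightarrow> 0 \<le> pc k a y"
    and pc_pdf: "k \<le> M \<Longrightarrow>
      distributed (density lborel (\<lambda>x. ennreal (p k x))) (ref a) (obs a) (\<lambda>y. ennreal (pc k a y))"
    and distinguishable: "1 \<le> m \<Longrightarrow> m \<le> M \<Longrightarrow> \<exists>a. \<not> (AE y in ref a. pc m a y = pc 0 a y)"


section \<open>Open-loop policies\<close>

text \<open>For \<open>W = 0\<close> the window chain lives on \<^typ>\<open>'a\<close>, encoded as windows of length 1.\<close>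

definition wlen :: "nat \<Rightarrow> nat" where
  "wlen W = max 1 W"

definition windows :: "nat \<Rightarrow> 'a list set" where
  "windows W = {\<alpha>. length \<alpha> = wlen W}"

text \<open>
  \<open>T \<alpha>\<close> is the row of the transition matrix that belongs to the window \<open>\<alpha>\<close>; a transition drops the
  oldest action and appends the new one.
\<close>

definition open_loop_policy :: "nat \<Rightarrow> 'a list pmf \<Rightarrow> ('a list \<Rightarrow> 'a list pmf) \<Rightarrow> bool" where
  "open_loop_policy W q T \<longleftrightarrow>
     set_pmf q \<subseteq> windows W \<and>
     (\<forall>\<alpha>\<in>windows W. set_pmf (T \<alpha>) \<subseteq> {tl \<alpha> @ [a] | a. True}) \<and>
     (W = 0 \<longrightarrow> (\<forall>\<alpha>\<in>windows W. T \<alpha> = q))"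

text \<open>The joint law of the first \<open>wlen W + n\<close> actions.\<close>

primrec actions_pmf :: "nat \<Rightarrow> 'a list pmf \<Rightarrow> ('a list \<Rightarrow> 'a list pmf) \<Rightarrow> nat \<Rightarrow> 'a list pmf" where
  "actions_pmf W q T 0 = q"
| "actions_pmf W q T (Suc n) =
     bind_pmf (actions_pmf W q T n)
       (\<lambda>as. map_pmf (\<lambda>\<beta>. as @ [last \<beta>]) (T (drop (length as - wlen W) as)))"

text \<open>The expected fraction of time the window chain spends in \<open>\<alpha>\<close>, in the long run.\<close>

definition qbar :: "nat \<Rightarrow> 'a list pmf \<Rightarrow> ('a list \<Rightarrow> 'a list pmf) \<Rightarrow> 'a list \<Rightarrow> real" where
  "qbar W q T \<alpha> =
     lim (\<lambda>t. measure_pmf.expectation (actions_pmf W q T t)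
       (\<lambda>as. 1 / real t * (\<Sum>j<t. of_bool (take (wlen W) (drop j as) = \<alpha>))))"

definition accessible :: "('s \<Rightarrow> 's pmf) \<Rightarrow> 's \<Rightarrow> 's set" where
  "accessible T s = {s'. (s, s') \<in> {(u, v). v \<in> set_pmf (T u)}\<^sup>*}"

text \<open>
  In a finite chain a state is recurrent iff it is accessible from every state accessible from it,
  and its class consists of the states accessible from it.
\<close>

definition recurrence_class :: "nat \<Rightarrow> ('a list \<Rightarrow> 'a list pmf) \<Rightarrow> 'a list set \<Rightarrow> bool" where
  "recurrence_class W T C \<longleftrightarrow>
     (\<exists>\<alpha>\<in>windows W. (\<forall>\<beta>\<in>accessible T \<alpha>. \<alpha> \<in> accessible T \<beta>) \<and> C = accessible T \<alpha>)"


section \<open>The signal sampled under an open-loop policy\<close>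

text \<open>
  \<open>P\<close> is a probability measure under which the signal \<open>X\<^sub>1, X\<^sub>2, \<dots>\<close> is independent with \<open>X\<^sub>t\<close> having
  pdf \<open>f t\<close>, and the actions follow the policy without looking at the signal.
\<close>

locale sampled_signal = prob_space P
  for P :: "'w measure" +
  fixes X :: "nat \<Rightarrow> 'w \<Rightarrow> real ^ 'n::finite"
    and f :: "nat \<Rightarrow> real ^ 'n \<Rightarrow> real"
    and A :: "nat \<Rightarrow> 'w \<Rightarrow> 'a::finite"
    and W :: nat
    and q :: "'a list pmf"
    and T :: "'a list \<Rightarrow> 'a list pmf"
  assumes signal_indep: "indep_vars (\<lambda>_. borel) X {1..}"
    and signal_pdf: "1 \<le> t \<Longrightarrow> distributed P lborel (X t) (\<lambda>x. ennreal (f t x))"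
    and action_measurable: "1 \<le> t \<Longrightarrow> A t \<in> measurable P (count_space UNIV)"
    and action_law:
      "distr P (count_space UNIV) (\<lambda>\<omega>. map (\<lambda>t. A t \<omega>) [1..<Suc (wlen W + n)])
         = measure_pmf (actions_pmf W q T n)"
    and open_loop:
      "indep_set
         (sets (vimage_algebra (space P) (\<lambda>\<omega>. \<lambda>t\<in>{1..}. A t \<omega>) (PiM {1..} (\<lambda>_. count_space UNIV))))
         (sets (vimage_algebra (space P) (\<lambda>\<omega>. \<lambda>t\<in>{1..}. X t \<omega>) (PiM {1..} (\<lambda>_. borel))))"

definition observation ::
  "('a \<Rightarrow> 'x \<Rightarrow> 'y) \<Rightarrow> (nat \<Rightarrow> 'w \<Rightarrow> 'a) \<Rightarrow> (nat \<Rightarrow> 'w \<Rightarrow> 'x) \<Rightarrow> nat \<Rightarrow> 'w \<Rightarrow> 'y" where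
  "observation obs A X t \<omega> = obs (A t \<omega>) (X t \<omega>)"


section \<open>Performance measures\<close>

definition ARL :: "'w measure \<Rightarrow> ('w \<Rightarrow> enat) \<Rightarrow> ennreal" where
  "ARL P \<tau> = (\<integral>\<^sup>+ \<omega>. ennreal_of_enat (\<tau> \<omega>) \<partial>P)"

text \<open>The sigma-algebra generated by \<open>A\<^sub>1, Y\<^sub>1, \<dots>, A\<^sub>n, Y\<^sub>n\<close>.\<close>

definition history ::
  "'w set \<Rightarrow> 'y measure \<Rightarrow> (nat \<Rightarrow> 'w \<Rightarrow> 'a) \<Rightarrow> (nat \<Rightarrow> 'w \<Rightarrow> 'y) \<Rightarrow> nat \<Rightarrow> 'w measure" where
  "history \<Omega> OS A Y n =
     vimage_algebra \<Omega> (\<lambda>\<omega>. \<lambda>s\<in>{1..n}. (A s \<omega>, Y s \<omega>))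
       (PiM {1..n} (\<lambda>_. count_space UNIV \<Otimes>\<^sub>M OS))"

text \<open>
  \<open>P \<nu>\<close> is the measure with change point \<open>\<nu>\<close>. Subtraction on \<^typ>\<open>ennreal\<close> is truncated at 0,
  which accounts for the positive part.
\<close>

definition WADD ::
  "(nat \<Rightarrow> 'w measure) \<Rightarrow> 'y measure \<Rightarrow> (nat \<Rightarrow> 'w \<Rightarrow> 'a) \<Rightarrow> (nat \<Rightarrow> 'w \<Rightarrow> 'y) \<Rightarrow> ('w \<Rightarrow> enat) \<Rightarrow> ennreal"
  where
  "WADD P OS A Y \<tau> =
     (SUP \<nu>\<in>{1..}. esssup (P \<nu>)
        (nn_cond_exp (P \<nu>) (history (space (P \<nu>)) OS A Y (\<nu> - 1))
           (\<lambda>\<omega>. ennreal_of_enat (\<tau> \<omega>) + 1 - of_nat \<nu>)))"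


section \<open>The CuSum test\<close>

definition ext_ln :: "ennreal \<Rightarrow> ereal" where
  "ext_ln x = (if x = 0 then -\<infinity> else if x = \<infinity> then \<infinity> else ereal (ln (enn2real x)))"

text \<open>
  The log-likelihood ratio of one observation. It is \<open>-\<infinity>\<close> where only the numerator vanishes and
  \<open>\<infinity>\<close> where only the denominator vanishes; where both do the value \<open>-\<infinity>\<close> is immaterial.
\<close>

definition log_lr :: "(nat \<Rightarrow> 'a \<Rightarrow> 'y \<Rightarrow> real) \<Rightarrow> nat \<Rightarrow> 'a \<Rightarrow> 'y \<Rightarrow> ereal" where
  "log_lr pc m a y = ext_ln (ennreal (pc m a y) / ennreal (pc 0 a y))"

primrec cusum ::
  "(nat \<Rightarrow> 'a \<Rightarrow> 'y \<Rightarrow> real) \<Rightarrow> nat \<Rightarrow> (nat \<Rightarrow> 'w \<Rightarrow> 'a) \<Rightarrow> (nat \<Rightarrow> 'w \<Rightarrow> 'y) \<Rightarrow> nat \<Rightarrow> 'w \<Rightarrow> ereal" where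
  "cusum pc m A Y 0 \<omega> = 0"
| "cusum pc m A Y (Suc t) \<omega> =
     max 0 (cusum pc m A Y t \<omega> + log_lr pc m (A (Suc t) \<omega>) (Y (Suc t) \<omega>))"

text \<open>The infimum of the empty set is \<open>\<infinity>\<close>.\<close>

definition cusum_time ::
  "nat \<Rightarrow> (nat \<Rightarrow> 'a \<Rightarrow> 'y \<Rightarrow> real) \<Rightarrow> nat \<Rightarrow> (nat \<Rightarrow> 'w \<Rightarrow> 'a) \<Rightarrow> (nat \<Rightarrow> 'w \<Rightarrow> 'y) \<Rightarrow> real \<Rightarrow> 'w \<Rightarrow> enat"
  where
  "cusum_time M pc m A Y \<gamma> \<omega> =
     Inf {enat t | t. 1 \<le> t \<and> cusum pc m A Y t \<omega> > ereal (ln (real M * \<gamma>))}"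


section \<open>Information rate\<close>

text \<open>
  The divergence \<open>D(P || Q)\<close> in nats, with value \<open>\<infinity>\<close> where the library's real-valued
  \<^const>\<open>KL_divergence\<close>, which takes \<open>Q\<close> as its first measure, has no meaningful value.
\<close>

definition kl_div :: "'y measure \<Rightarrow> 'y measure \<Rightarrow> ennreal" where
  "kl_div P Q =
     (if absolutely_continuous Q P \<and> integrable P (entropy_density (exp 1) Q P)
      then ennreal (KL_divergence (exp 1) Q P) else \<infinity>)"

definition info_rate ::
  "('a \<Rightarrow> 'y measure) \<Rightarrow> (nat \<Rightarrow> 'a \<Rightarrow> 'y \<Rightarrow> real) \<Rightarrow> nat \<Rightarrow> nat \<Rightarrow> 'a list pmf
     \<Rightarrow> ('a list \<Rightarrow> 'a list pmf) \<Rightarrow> ennreal" where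
  "info_rate ref pc m W q T =
     (\<Sum>\<alpha>\<in>windows W. ennreal (qbar W q T \<alpha>) *
        kl_div (density (ref (last \<alpha>)) (\<lambda>y. ennreal (pc m (last \<alpha>) y)))
               (density (ref (last \<alpha>)) (\<lambda>y. ennreal (pc 0 (last \<alpha>) y))))"

end

theory Submission
  imports Defs
begin

text \<open>
  False alarms. Without a change the likelihood ratio of the next observation has conditional mean at
  most 1, whatever the policy does. Hence Shiryaev and Roberts' statistic \<open>R\<^sub>t = (1 + R\<^sub>t\<^sub>-\<^sub>1) r\<^sub>t\<close>
  grows by at most 1 per step in expectation. Where CuSum is positive it dominates the exponential of
  CuSum, so it is at least \<open>M \<gamma>\<close> when CuSum stops, and optional stopping gives \<open>M \<gamma> \<le> E \<tau>\<close> (\<open>ARL_ge\<close>).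

  Delay. CuSum is nonnegative and never below the sum of log-likelihood ratios since an arbitrary time
  \<open>s\<close>, so it suffices that this sum passes \<open>c = log (M \<gamma>)\<close> quickly. By Chernoff's bound
  with a small exponent \<open>-\<theta>\<close>, everything depends on the conditional mean of \<open>(p\<^sub>0 / p\<^sub>m)\<^sup>\<theta>\<close>
  under \<open>p\<^sub>m\<close> and a given action. It is at most 1 and equals \<open>1 - \<theta> D + o(\<theta>)\<close> where the divergence
  \<open>D\<close> of the action is finite (\<open>affinity_derivative\<close>). Along a long run of the policy these factors
  multiply to about \<open>exp (- \<theta> n I)\<close>, since the time averages of \<open>D\<close> converge to \<open>I\<close>.

  The last sentence has to hold uniformly over the past. All windows that occur end up in the same
  recurrence class, so the averages converge to the same limit from each of them, and there are
  finitely many. An approximate solution \<open>h\<close> of Poisson's equation (\<open>ergodic_on_reachable\<close>) turns this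
  into a statement about single steps: for each \<open>\<delta> < I\<close> there is \<open>\<theta>\<close> such that the product of the
  tilted ratios, times \<open>exp (\<theta> h)\<close>, shrinks by the factor \<open>exp (- \<theta> \<delta>)\<close> in every step
  (\<open>tilting_constants\<close>). So the conditional probability that CuSum is still running after \<open>n\<close> steps is
  at most a constant times \<open>exp (\<theta> (c - n \<delta>))\<close>. Summing over \<open>n\<close> bounds the conditional
  delay by \<open>c / \<delta>\<close> plus a constant that depends neither on the past nor on the change point
  (\<open>conditional_delay_le\<close>), and \<open>\<delta>\<close> may be taken arbitrarily close to \<open>I\<close>.
\<close>

section \<open>Time averages of finite Markov chains\<close>

locale finite_chain =
  fixes S :: "'s set" and K :: "'s \<Rightarrow> 's \<Rightarrow> real"
  assumes finite_states: "finite S"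
    and kernel_nonneg: "x \<in> S \<Longrightarrow> y \<in> S \<Longrightarrow> 0 \<le> K x y"
    and kernel_sum: "x \<in> S \<Longrightarrow> (\<Sum>y\<in>S. K x y) = 1"
begin

definition step :: "('s \<Rightarrow> real) \<Rightarrow> 's \<Rightarrow> real" where
  "step f x = (\<Sum>y\<in>S. K x y * f y)"

definition cesaro :: "nat \<Rightarrow> ('s \<Rightarrow> real) \<Rightarrow> 's \<Rightarrow> real" where
  "cesaro n f x = (\<Sum>j<n. (step ^^ j) f x) / real n"

definition potential :: "nat \<Rightarrow> ('s \<Rightarrow> real) \<Rightarrow> 's \<Rightarrow> real" where
  "potential n f x = (\<Sum>j<n. \<Sum>i<j. (step ^^ i) f x) / real n"

definition cesaro_lim :: "('s \<Rightarrow> real) \<Rightarrow> 's \<Rightarrow> real" where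
  "cesaro_lim f x = lim (\<lambda>n. cesaro n f x)"

lemma step_cong: "(\<And>y. y \<in> S \<Longrightarrow> f y = g y) \<Longrightarrow> step f = step g"
  by (auto simp: step_def intro!: sum.cong ext)

lemma step_add: "step (\<lambda>x. f x + g x) = (\<lambda>x. step f x + step g x)"
  by (auto simp: step_def fun_eq_iff algebra_simps sum.distrib)

lemma step_diff: "step (\<lambda>x. f x - g x) = (\<lambda>x. step f x - step g x)"
  by (auto simp: step_def fun_eq_iff algebra_simps sum_subtractf)

lemma step_scale: "step (\<lambda>x. c * f x) = (\<lambda>x. c * step f x)"
  by (auto simp: step_def fun_eq_iff sum_distrib_left algebra_simps)

lemma step_sum: "step (\<lambda>x. \<Sum>i\<in>I. f i x) = (\<lambda>x. \<Sum>i\<in>I. step (f i) x)"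
  by (auto simp: step_def fun_eq_iff sum_distrib_left intro: sum.swap)

lemma step_mono: "x \<in> S \<Longrightarrow> (\<And>y. y \<in> S \<Longrightarrow> f y \<le> g y) \<Longrightarrow> step f x \<le> step g x"
  by (auto simp: step_def intro!: sum_mono mult_left_mono kernel_nonneg)

lemma step_const: "x \<in> S \<Longrightarrow> step (\<lambda>_. c) x = c"
  using kernel_sum[of x] by (simp add: step_def sum_distrib_right[symmetric])

lemma step_abs_le: 
  assumes "\<And>y. y \<in> S \<Longrightarrow> \<bar>f y\<bar> \<le> c" "x \<in> S"
  shows "\<bar>step f x\<bar> \<le> c"
proof -
  have "step f x \<le> step (\<lambda>_. c) x" "step (\<lambda>_. - c) x \<le> step f x"
    using assms by (intro step_mono; force simp: abs_le_iff)+
  then show ?thesis using step_const[of x c] step_const[of x "-c"] assms by auto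
qed

lemma funpow_step_abs_le:
  assumes "\<And>y. y \<in> S \<Longrightarrow> \<bar>f y\<bar> \<le> c" "x \<in> S"
  shows "\<bar>(step ^^ n) f x\<bar> \<le> c"
  using assms(2)
proof (induction n arbitrary: x)
  case (Suc n)
  then show ?case by (auto intro!: step_abs_le)
qed (use assms in auto)

lemma funpow_step_cong: "(\<And>y. y \<in> S \<Longrightarrow> f y = g y) \<Longrightarrow> x \<in> S \<Longrightarrow> (step ^^ n) f x = (step ^^ n) g x"
proof (induction n arbitrary: x)
  case (Suc n)
  show ?case using step_cong[of "(step ^^ n) f" "(step ^^ n) g"] Suc by simp
qed auto

lemma funpow_step_add: "(step ^^ n) (\<lambda>x. f x + g x) = (\<lambda>x. (step ^^ n) f x + (step ^^ n) g x)"
  by (induction n) (simp_all add: step_add)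

lemma funpow_step_diff: "(step ^^ n) (\<lambda>x. f x - g x) = (\<lambda>x. (step ^^ n) f x - (step ^^ n) g x)"
  by (induction n) (simp_all add: step_diff)

lemma funpow_step_scale: "(step ^^ n) (\<lambda>x. c * f x) = (\<lambda>x. c * (step ^^ n) f x)"
  by (induction n) (simp_all add: step_scale)

lemma funpow_step_sum: "(step ^^ n) (\<lambda>x. \<Sum>i\<in>I. f i x) = (\<lambda>x. \<Sum>i\<in>I. (step ^^ n) (f i) x)"
  by (induction n) (simp_all add: step_sum)

lemma cesaro_sum: "cesaro n (\<lambda>x. \<Sum>i\<in>I. f i x) x = (\<Sum>i\<in>I. cesaro n (f i) x)"
  unfolding cesaro_def funpow_step_sum by (subst sum.swap) (simp add: sum_divide_distrib)

lemma cesaro_scale: "cesaro n (\<lambda>x. c * f x) x = c * cesaro n f x"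
  by (simp add: cesaro_def funpow_step_scale sum_distrib_left)

lemma cesaro_add: "cesaro n (\<lambda>x. f x + g x) x = cesaro n f x + cesaro n g x"
  by (simp add: cesaro_def funpow_step_add sum.distrib add_divide_distrib)

lemma cesaro_cong: "(\<And>y. y \<in> S \<Longrightarrow> f y = g y) \<Longrightarrow> x \<in> S \<Longrightarrow> cesaro n f x = cesaro n g x"
  using funpow_step_cong[of f g x] by (simp add: cesaro_def)

lemma cesaro_abs_le:
  assumes "\<And>y. y \<in> S \<Longrightarrow> \<bar>f y\<bar> \<le> c" "x \<in> S" "n > 0"
  shows "\<bar>cesaro n f x\<bar> \<le> c"
proof -
  have "\<bar>\<Sum>j<n. (step ^^ j) f x\<bar> \<le> (\<Sum>j<n. c)"
    by (rule order_trans[OF sum_abs sum_mono]) (use funpow_step_abs_le assms in auto)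
  then show ?thesis using assms(3) by (simp add: cesaro_def field_simps)
qed

lemma funpow_step_harmonic:
  assumes "\<And>y. y \<in> S \<Longrightarrow> step f y = f y" "x \<in> S"
  shows "(step ^^ n) f x = f x"
  using assms(2)
proof (induction n arbitrary: x)
  case (Suc n)
  then show ?case using step_cong[of "(step ^^ n) f" f] assms(1) by simp
qed auto

lemma cesaro_harmonic:
  assumes "\<And>y. y \<in> S \<Longrightarrow> step f y = f y" "x \<in> S" "n > 0"
  shows "cesaro n f x = f x"
  using assms by (simp add: cesaro_def funpow_step_harmonic)

lemma cesaro_coboundary: "cesaro n (\<lambda>x. f x - step f x) x = (f x - (step ^^ n) f x) / real n"
proof -
  have "(step ^^ j) (\<lambda>x. f x - step f x) x = (step ^^ j) f x - (step ^^ Suc j) f x" for j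
    by (simp add: funpow_step_diff funpow_swap1)
  then show ?thesis
    by (simp add: cesaro_def sum_lessThan_telescope'[where f="\<lambda>j. (step ^^ j) f x"] del: funpow.simps)
qed

lemma step_cesaro: "step (cesaro n f) x = cesaro n f x + ((step ^^ n) f x - f x) / real n"
proof -
  have "step (cesaro n f) x = (\<Sum>j<n. (step ^^ Suc j) f x) / real n"
    using step_scale[of "1 / real n" "\<lambda>x. \<Sum>j<n. (step ^^ j) f x"] step_sum[of "\<lambda>j. (step ^^ j) f" "{..<n}"]
    by (simp add: cesaro_def[abs_def])
  also have "(\<Sum>j<n. (step ^^ Suc j) f x) = (\<Sum>j<n. (step ^^ j) f x) + ((step ^^ n) f x - f x)"
    using sum.lessThan_Suc_shift[of "\<lambda>j. (step ^^ j) f x" n] by simp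
  finally have "step (cesaro n f) x
      = (\<Sum>j<n. (step ^^ j) f x) / real n + ((step ^^ n) f x - f x) / real n"
    by (simp only: add_divide_distrib)
  then show ?thesis by (simp only: cesaro_def)
qed

text \<open>
  A partial sum of the orbit of \<open>f\<close> minus its image under \<open>step\<close> telescopes to \<open>f\<close> minus an iterate of
  \<open>f\<close>. Averaging the partial sums therefore solves Poisson's equation, with the Cesaro average in place
  of its limit.
\<close>

lemma potential_step:
  assumes "n > 0"
  shows "potential n f x - step (potential n f) x = f x - cesaro n f x"
proof -
  have "step (potential n f) x = (\<Sum>j<n. \<Sum>i<j. (step ^^ Suc i) f x) / real n"
    using step_scale[of "1 / real n" "\<lambda>x. \<Sum>j<n. \<Sum>i<j. (step ^^ i) f x"]
    by (simp add: potential_def[abs_def] step_sum)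
  then have "potential n f x - step (potential n f) x
      = (\<Sum>j<n. (\<Sum>i<j. (step ^^ i) f x) - (\<Sum>i<j. (step ^^ Suc i) f x)) / real n"
    by (simp add: potential_def sum_subtractf diff_divide_distrib)
  also have "\<dots> = (\<Sum>j<n. f x - (step ^^ j) f x) / real n"
  proof -
    have "(\<Sum>i<j. (step ^^ i) f x) - (\<Sum>i<j. (step ^^ Suc i) f x) = f x - (step ^^ j) f x" for j
      using sum.lessThan_Suc_shift[of "\<lambda>i. (step ^^ i) f x" j] by simp
    then show ?thesis by presburger
  qed
  also have "\<dots> = f x - cesaro n f x"
    using assms by (simp add: sum_subtractf cesaro_def field_simps)
  finally show ?thesis .
qed

lemma abs_bound_exists: "\<exists>c\<ge>0. \<forall>x\<in>S. \<bar>f x :: real\<bar> \<le> c"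
proof -
  have "\<forall>x\<in>S. \<bar>f x\<bar> \<le> (\<Sum>y\<in>S. \<bar>f y\<bar>)"
    using member_le_sum[of _ S "\<lambda>y. \<bar>f y\<bar>"] finite_states by auto
  then show ?thesis by (intro exI[of _ "\<Sum>y\<in>S. \<bar>f y\<bar>"]) (auto intro: sum_nonneg)
qed

end

lemma convergent_subsequence_on_finite:
  fixes u :: "nat \<Rightarrow> 's \<Rightarrow> real"
  assumes "finite D" "\<And>n x. x \<in> D \<Longrightarrow> \<bar>u n x\<bar> \<le> c"
  shows "\<exists>r. strict_mono r \<and> (\<forall>x\<in>D. convergent (\<lambda>n. u (r n) x))"
  using assms
proof (induction D)
  case empty
  then show ?case by (auto intro: exI[of _ id] simp: strict_mono_def)
next
  case (insert y D)
  then obtain r where r: "strict_mono r" "\<forall>x\<in>D. convergent (\<lambda>n. u (r n) x)" by auto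
  have "bounded (range (\<lambda>n. u (r n) y))"
    using insert.prems by (auto simp: bounded_iff)
  then obtain l s where s: "strict_mono s" "((\<lambda>n. u (r n) y) \<circ> s) \<longlonglongrightarrow> l"
    using bounded_imp_convergent_subsequence by blast
  have "convergent (\<lambda>n. u (r (s n)) x)" if "x \<in> D" for x
    using r(2) that s(1) convergent_subseq_convergent[of "\<lambda>n. u (r n) x" s] by (simp add: o_def)
  moreover have "convergent (\<lambda>n. u (r (s n)) y)" using s(2) by (auto simp: convergent_def o_def)
  ultimately show ?case using r(1) s(1)
    by (intro exI[of _ "r \<circ> s"]) (auto simp: strict_mono_def)
qed

context finite_chain
begin

lemma step_tendsto:
  assumes "\<And>y. y \<in> S \<Longrightarrow> ((\<lambda>n. u n y) \<longlongrightarrow> k y) F"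
  shows "((\<lambda>n. step (u n) x) \<longlongrightarrow> step k x) F"
  unfolding step_def using assms by (intro tendsto_sum tendsto_mult tendsto_const) auto

lemma funpow_step_over_n:
  assumes "x \<in> S"
  shows "(\<lambda>n. ((step ^^ n) f x - f x) / real n) \<longlonglongrightarrow> 0"
proof -
  obtain c where c: "\<forall>x\<in>S. \<bar>f x\<bar> \<le> c" using abs_bound_exists by blast
  have "\<bar>(step ^^ n) f x - f x\<bar> \<le> 2 * c" for n
    using funpow_step_abs_le[of f c x n] c assms by fastforce
  then have *: "norm (((step ^^ n) f x - f x) / real n) \<le> 2 * c * (1 / real n)" for n
    by (auto simp: divide_right_mono)
  have "(\<lambda>n. 2 * c * (1 / real n)) \<longlonglongrightarrow> 2 * c * 0"
    by (intro tendsto_mult tendsto_const lim_1_over_n)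
  then have "(\<lambda>n. 2 * c * (1 / real n)) \<longlonglongrightarrow> 0" by simp
  then show ?thesis by (rule Lim_null_comparison[rotated]) (use * in \<open>simp add: eventuallyI\<close>)
qed

text \<open>
  Mean ergodic theorem for a finite chain: a subsequence of the averages converges by compactness, its limit \<open>k\<close> is
  harmonic, and one average close to \<open>k\<close> writes \<open>f\<close> as \<open>k\<close> plus a coboundary plus a small error,
  which pins down all later averages.
\<close>

lemma cesaro_converges:
  "\<exists>k. (\<forall>x\<in>S. step k x = k x) \<and> (\<forall>x\<in>S. (\<lambda>n. cesaro n f x) \<longlonglongrightarrow> k x)"
proof -
  obtain c where c: "\<forall>x\<in>S. \<bar>f x\<bar> \<le> c" "c \<ge> 0" using abs_bound_exists by blast
  have bd: "\<bar>cesaro n f x\<bar> \<le> c" if "x \<in> S" for n x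
    using cesaro_abs_le[of f c x n] c that by (cases "n = 0") (auto simp: cesaro_def)
  obtain r where r: "strict_mono r" "\<forall>x\<in>S. convergent (\<lambda>n. cesaro (r n) f x)"
    using convergent_subsequence_on_finite[of S "\<lambda>n. cesaro n f" c, OF finite_states bd] by blast
  then obtain k where k: "\<And>x. x \<in> S \<Longrightarrow> (\<lambda>n. cesaro (r n) f x) \<longlonglongrightarrow> k x"
    unfolding convergent_def by metis
  have harm: "step k x = k x" if x: "x \<in> S" for x
  proof -
    have "(\<lambda>n. step (cesaro (r n) f) x) \<longlonglongrightarrow> step k x" using k by (rule step_tendsto)
    moreover have "(\<lambda>n. cesaro (r n) f x + ((step ^^ r n) f x - f x) / real (r n)) \<longlonglongrightarrow> k x + 0"
      using LIMSEQ_subseq_LIMSEQ[OF funpow_step_over_n[OF x, of f] r(1)]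
      by (intro tendsto_add k x) (simp add: o_def)
    ultimately show ?thesis by (simp add: step_cesaro LIMSEQ_unique)
  qed
  have "(\<lambda>n. cesaro n f x) \<longlonglongrightarrow> k x" if x: "x \<in> S" for x
  proof (rule LIMSEQ_I)
    fix e :: real assume e: "e > 0"
    have "\<forall>\<^sub>F n in sequentially. \<forall>y\<in>S. \<bar>cesaro (r n) f y - k y\<bar> < e / 2"
    proof (intro eventually_ball_finite finite_states ballI)
      fix y assume "y \<in> S"
      from tendstoD[OF k[OF this], of "e / 2"] e
      show "\<forall>\<^sub>F n in sequentially. \<bar>cesaro (r n) f y - k y\<bar> < e / 2" by (simp add: dist_real_def)
    qed
    moreover have "\<forall>\<^sub>F n in sequentially. 0 < r n"
      using eventually_gt_at_top[of "0::nat"]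
      by eventually_elim (use seq_suble[OF r(1)] in \<open>auto intro: less_le_trans\<close>)
    ultimately have "\<forall>\<^sub>F n in sequentially. (\<forall>y\<in>S. \<bar>cesaro (r n) f y - k y\<bar> < e / 2) \<and> 0 < r n"
      by eventually_elim auto
    then obtain m where m: "\<forall>y\<in>S. \<bar>cesaro m f y - k y\<bar> < e / 2" "m > 0"
      by (auto simp: eventually_sequentially)
    define h where "h = potential m f"
    define d where "d y = cesaro m f y - k y" for y
    have split: "cesaro n f x = k x + ((h x - (step ^^ n) h x) / real n + cesaro n d x)" if n: "n > 0" for n
    proof -
      have "f y = k y + ((h y - step h y) + d y)" for y
        using potential_step[OF m(2), of f y] by (simp add: h_def d_def)
      then have "cesaro n f x = cesaro n (\<lambda>y. k y + ((h y - step h y) + d y)) x" by presburger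
      then show ?thesis
        by (simp add: cesaro_add cesaro_coboundary cesaro_harmonic[OF harm x n])
    qed
    have "\<forall>\<^sub>F n in sequentially. \<bar>((step ^^ n) h x - h x) / real n\<bar> < e / 2"
      using funpow_step_over_n[OF x, of h] e by (auto dest!: tendstoD[where e="e/2"] simp: dist_real_def)
    moreover have "\<forall>\<^sub>F n in sequentially. n > (0::nat)" by (rule eventually_gt_at_top)
    ultimately have "\<forall>\<^sub>F n in sequentially. norm (cesaro n f x - k x) < e"
    proof eventually_elim
      case (elim n)
      have "\<bar>cesaro n d x\<bar> \<le> e / 2"
        using m(1) x elim(2) by (intro cesaro_abs_le) (auto simp: d_def less_imp_le)
      moreover have "(h x - (step ^^ n) h x) / real n = - (((step ^^ n) h x - h x) / real n)"
        by (simp add: minus_divide_left)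
      ultimately show ?case using elim(1) split[OF elim(2)] by (simp only: real_norm_def)
    qed
    then show "\<exists>no. \<forall>n\<ge>no. norm (cesaro n f x - k x) < e" by (auto simp: eventually_sequentially)
  qed
  with harm show ?thesis by blast
qed

lemma cesaro_tendsto: "x \<in> S \<Longrightarrow> (\<lambda>n. cesaro n f x) \<longlonglongrightarrow> cesaro_lim f x"
  and step_cesaro_lim: "x \<in> S \<Longrightarrow> step (cesaro_lim f) x = cesaro_lim f x"
proof -
  obtain k where k: "\<forall>x\<in>S. step k x = k x" "\<forall>x\<in>S. (\<lambda>n. cesaro n f x) \<longlonglongrightarrow> k x"
    using cesaro_converges by blast
  have eq: "cesaro_lim f x = k x" if "x \<in> S" for x
    using k(2) that by (simp add: cesaro_lim_def limI)
  show "x \<in> S \<Longrightarrow> (\<lambda>n. cesaro n f x) \<longlonglongrightarrow> cesaro_lim f x" using k eq by simp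
  show "x \<in> S \<Longrightarrow> step (cesaro_lim f) x = cesaro_lim f x"
    using step_cong[of "cesaro_lim f" k] eq k(1) by simp
qed

abbreviation occupation :: "'s \<Rightarrow> 's \<Rightarrow> real" where
  "occupation y \<equiv> cesaro_lim (\<lambda>x. of_bool (x = y))"

lemma cesaro_lim_occupation:
  assumes x: "x \<in> S"
  shows "cesaro_lim f x = (\<Sum>y\<in>S. f y * occupation y x)"
proof -
  have "cesaro n f x = (\<Sum>y\<in>S. f y * cesaro n (\<lambda>x. of_bool (x = y)) x)" for n
  proof -
    have "cesaro n f x = cesaro n (\<lambda>x. \<Sum>y\<in>S. f y * of_bool (x = y)) x"
      using finite_states x by (intro cesaro_cong) (auto simp: of_bool_def if_distrib[where f="(*) _"] cong: if_cong)
    then show ?thesis by (simp add: cesaro_sum cesaro_scale)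
  qed
  then have "(\<lambda>n. cesaro n f x) \<longlonglongrightarrow> (\<Sum>y\<in>S. f y * occupation y x)"
    using cesaro_tendsto[OF x] by (simp, intro tendsto_sum tendsto_mult tendsto_const) auto
  then show ?thesis using cesaro_tendsto[OF x] LIMSEQ_unique by blast
qed

lemma funpow_step_nonneg:
  assumes "\<And>y. y \<in> S \<Longrightarrow> 0 \<le> f y" "x \<in> S"
  shows "0 \<le> (step ^^ n) f x"
  using assms(2)
proof (induction n arbitrary: x)
  case (Suc n)
  then show ?case using step_mono[of x "\<lambda>_. 0" "(step ^^ n) f"] by (simp add: step_const)
qed (use assms in auto)

lemma occupation_nonneg: "x \<in> S \<Longrightarrow> 0 \<le> occupation y x"
  by (rule LIMSEQ_le_const[OF cesaro_tendsto])
     (auto simp: cesaro_def intro!: divide_nonneg_nonneg sum_nonneg funpow_step_nonneg)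

lemma occupation_sum:
  assumes x: "x \<in> S" shows "(\<Sum>y\<in>S. occupation y x) = 1"
proof -
  have "cesaro n (\<lambda>_. 1) x = 1" if "n > 0" for n
    using cesaro_harmonic[of "\<lambda>_. 1" x n] x step_const that by auto
  then have "(\<lambda>n. cesaro n (\<lambda>_. 1) x) \<longlonglongrightarrow> 1"
    by (intro tendsto_eventually) (auto simp: eventually_at_top_dense)
  then have "cesaro_lim (\<lambda>_. 1) x = 1" using cesaro_tendsto[OF x] LIMSEQ_unique by blast
  then show ?thesis using cesaro_lim_occupation[OF x, of "\<lambda>_. 1"] by simp
qed

definition closed_set :: "'s set \<Rightarrow> bool" where
  "closed_set D \<longleftrightarrow> D \<subseteq> S \<and> (\<forall>x\<in>D. \<forall>y\<in>S. 0 < K x y \<longrightarrow> y \<in> D)"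

text \<open>
  Maximum principle: the points where a harmonic function is maximal on a closed class form a closed
  set, so a minimal closed class consists of maximal points only.
\<close>

lemma harmonic_constant:
  assumes C: "closed_set C" and min: "\<And>D. D \<subseteq> C \<Longrightarrow> D \<noteq> {} \<Longrightarrow> closed_set D \<Longrightarrow> D = C"
    and k: "\<And>x. x \<in> S \<Longrightarrow> step k x = k x" and xy: "x \<in> C" "y \<in> C"
  shows "k x = k y"
proof -
  have fin: "finite C" using C finite_states finite_subset by (auto simp: closed_set_def)
  define b where "b = Max (k ` C)"
  define D where "D = {x \<in> C. k x = b}"
  have le: "k x \<le> b" if "x \<in> C" for x using that fin by (simp add: b_def)
  have "b \<in> k ` C" unfolding b_def using xy fin by (intro Max_in) auto
  then have "D \<noteq> {}" by (auto simp: D_def)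
  moreover have "closed_set D"
    unfolding closed_set_def
  proof (intro conjI ballI impI)
    show "D \<subseteq> S" using C by (auto simp: D_def closed_set_def)
    fix x y assume x: "x \<in> D" and y: "y \<in> S" and Kxy: "0 < K x y"
    have xS: "x \<in> S" using x C by (auto simp: D_def closed_set_def)
    have yC: "y \<in> C" using x y Kxy C by (auto simp: D_def closed_set_def)
    have nonneg: "0 \<le> K x z * (b - k z)" if "z \<in> S" for z
    proof (cases "K x z > 0")
      case True
      then have "z \<in> C" using x that C by (auto simp: D_def closed_set_def)
      then show ?thesis using le True by auto
    next
      case False
      then show ?thesis using kernel_nonneg[OF xS that] by auto
    qed
    have "(\<Sum>z\<in>S. K x z * (b - k z)) = b - step k x"
      using kernel_sum[OF xS] by (simp add: step_def algebra_simps sum_subtractf sum_distrib_left[symmetric])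
    also have "\<dots> = 0" using k[OF xS] x by (simp add: D_def)
    finally have "\<forall>z\<in>S. K x z * (b - k z) = 0"
      by (subst (asm) sum_nonneg_eq_0_iff[OF finite_states nonneg])
    then have "K x y * (b - k y) = 0" using y by blast
    then show "y \<in> D" using Kxy yC by (auto simp: D_def)
  qed
  ultimately have "D = C" using min by (auto simp: D_def)
  then have "x \<in> D" "y \<in> D" using xy by auto
  then show ?thesis by (simp add: D_def)
qed

text \<open>
  The states from which the chain spends asymptotically all its time in \<open>C\<close>, be they transient or not.
\<close>

definition absorbed :: "'s set \<Rightarrow> 's set" where
  "absorbed C = {x \<in> S. \<forall>y\<in>S - C. occupation y x = 0}"

lemma closed_absorbed: "closed_set (absorbed C)"
  unfolding closed_set_def
proof (intro conjI ballI impI)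
  show "absorbed C \<subseteq> S" by (auto simp: absorbed_def)
  fix x y assume x: "x \<in> absorbed C" and y: "y \<in> S" and Kxy: "0 < K x y"
  have xS: "x \<in> S" using x by (auto simp: absorbed_def)
  have "occupation z y = 0" if z: "z \<in> S - C" for z
  proof -
    have "(\<Sum>w\<in>S. K x w * occupation z w) = 0"
      using step_cesaro_lim[OF xS, of "\<lambda>x. of_bool (x = z)"] x z by (simp add: step_def absorbed_def)
    moreover have "0 \<le> K x w * occupation z w" if "w \<in> S" for w
      using kernel_nonneg[OF xS that] occupation_nonneg[OF that] by simp
    ultimately have "K x y * occupation z y = 0"
      using sum_nonneg_eq_0_iff[OF finite_states, of "\<lambda>w. K x w * occupation z w"] y by blast
    then show ?thesis using Kxy by auto
  qed
  then show "y \<in> absorbed C" using y by (auto simp: absorbed_def)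
qed

text \<open>From an absorbed state the chain spends its time in \<open>C\<close>, where the (harmonic) limit is constant.\<close>

lemma cesaro_lim_absorbed:
  assumes C: "closed_set C" and min: "\<And>D. D \<subseteq> C \<Longrightarrow> D \<noteq> {} \<Longrightarrow> closed_set D \<Longrightarrow> D = C"
    and x: "x \<in> absorbed C" and z: "z \<in> C"
  shows "cesaro_lim f x = cesaro_lim f z"
proof -
  have xS: "x \<in> S" using x by (auto simp: absorbed_def)
  have "cesaro n (cesaro_lim f) x = cesaro_lim f x" if "n > 0" for n
    using cesaro_harmonic[of "cesaro_lim f" x n] step_cesaro_lim xS that by auto
  then have "(\<lambda>n. cesaro n (cesaro_lim f) x) \<longlonglongrightarrow> cesaro_lim f x"
    by (intro tendsto_eventually) (auto simp: eventually_at_top_dense)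
  then have "cesaro_lim f x = cesaro_lim (cesaro_lim f) x"
    using cesaro_tendsto[OF xS] LIMSEQ_unique by blast
  also have "\<dots> = (\<Sum>y\<in>S. cesaro_lim f y * occupation y x)" by (rule cesaro_lim_occupation[OF xS])
  also have "\<dots> = (\<Sum>y\<in>S. cesaro_lim f z * occupation y x)"
  proof (rule sum.cong)
    fix y assume y: "y \<in> S"
    show "cesaro_lim f y * occupation y x = cesaro_lim f z * occupation y x"
    proof (cases "y \<in> C")
      case True
      then have "cesaro_lim f y = cesaro_lim f z"
        using harmonic_constant[OF C min step_cesaro_lim] z by blast
      then show ?thesis by simp
    qed (use x y in \<open>auto simp: absorbed_def\<close>)
  qed simp
  also have "\<dots> = cesaro_lim f z" using occupation_sum[OF xS] by (simp add: sum_distrib_left[symmetric])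
  finally show ?thesis .
qed

text \<open>
  The weights \<open>\<Sum>z. q z * occupation y z\<close> are the long-run occupation frequencies for the starting
  law \<open>q\<close>, and \<open>null\<close> says that they charge only \<open>C\<close>. Then \<open>q\<close> charges only absorbed states, from
  each of which the averages of \<open>f\<close> have the same limit, and the negative of a potential of high order
  solves Poisson's equation up to \<open>e\<close>. The equation is stated for \<open>step f\<close> because
  the reward of a transition depends on the state that is entered.
\<close>

lemma approximate_Poisson:
  assumes C: "closed_set C" "C \<noteq> {}" and min: "\<And>D. D \<subseteq> C \<Longrightarrow> D \<noteq> {} \<Longrightarrow> closed_set D \<Longrightarrow> D = C"
    and q: "\<And>x. x \<in> S \<Longrightarrow> 0 \<le> q x" "(\<Sum>x\<in>S. q x) = 1"
    and null: "\<And>y. y \<in> S - C \<Longrightarrow> (\<Sum>x\<in>S. q x * occupation y x) = 0"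
    and e: "0 < e"
  shows "\<exists>h. \<forall>x\<in>absorbed C. (\<Sum>y\<in>S. f y * (\<Sum>z\<in>S. q z * occupation y z)) - e \<le> step f x + h x - step h x"
    and "x \<in> S \<Longrightarrow> 0 < q x \<Longrightarrow> x \<in> absorbed C"
proof -
  have supp: "x \<in> absorbed C" if x: "x \<in> S" "0 < q x" for x
    unfolding absorbed_def
  proof (intro CollectI conjI ballI x)
    fix y assume "y \<in> S - C"
    note this[THEN null]
    moreover have "0 \<le> q w * occupation y w" if "w \<in> S" for w
      using q(1)[OF that] occupation_nonneg[OF that] by simp
    ultimately have "q x * occupation y x = 0"
      using sum_nonneg_eq_0_iff[OF finite_states, of "\<lambda>x. q x * occupation y x"] x by blast
    then show "occupation y x = 0" using x by auto
  qed
  then show "x \<in> S \<Longrightarrow> 0 < q x \<Longrightarrow> x \<in> absorbed C" .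
  obtain z where z: "z \<in> C" using C by auto
  define L where "L = cesaro_lim (step f) z"
  have shift: "cesaro_lim (step f) x = cesaro_lim f x" if x: "x \<in> S" for x
  proof -
    have "cesaro n (step f) x = cesaro n f x + ((step ^^ n) f x - f x) / real n" for n
      using cesaro_coboundary[of n f x] cesaro_add[of n "\<lambda>x. f x - step f x" "step f" x]
      by (simp add: diff_divide_distrib)
    moreover have "(\<lambda>n. cesaro n f x + ((step ^^ n) f x - f x) / real n) \<longlonglongrightarrow> cesaro_lim f x + 0"
      by (intro tendsto_add cesaro_tendsto funpow_step_over_n x)
    ultimately show ?thesis using cesaro_tendsto[OF x, of "step f"] LIMSEQ_unique by fastforce
  qed
  have "(\<Sum>y\<in>S. f y * (\<Sum>x\<in>S. q x * occupation y x)) = (\<Sum>x\<in>S. q x * (\<Sum>y\<in>S. f y * occupation y x))"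
    unfolding sum_distrib_left by (subst sum.swap) (simp add: algebra_simps)
  also have "\<dots> = (\<Sum>x\<in>S. q x * L)"
  proof (rule sum.cong)
    fix x assume x: "x \<in> S"
    show "q x * (\<Sum>y\<in>S. f y * occupation y x) = q x * L"
    proof (cases "q x = 0")
      case False
      then have "x \<in> absorbed C" using supp q(1) x by (metis less_eq_real_def)
      from cesaro_lim_absorbed[OF C(1) min this z]
      have "cesaro_lim (step f) x = L" by (simp add: L_def)
      then show ?thesis using x by (simp add: cesaro_lim_occupation[symmetric] shift)
    qed auto
  qed simp
  also have "\<dots> = L" using q(2) by (simp add: sum_distrib_right[symmetric])
  finally have mean: "(\<Sum>y\<in>S. f y * (\<Sum>x\<in>S. q x * occupation y x)) = L" .
  have "\<forall>\<^sub>F n in sequentially. \<forall>x\<in>absorbed C. \<bar>cesaro n (step f) x - L\<bar> < e"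
  proof (rule eventually_ball_finite)
    show "finite (absorbed C)" using finite_states by (auto simp: absorbed_def)
    show "\<forall>x\<in>absorbed C. \<forall>\<^sub>F n in sequentially. \<bar>cesaro n (step f) x - L\<bar> < e"
    proof
      fix x assume x: "x \<in> absorbed C"
      then have "(\<lambda>n. cesaro n (step f) x) \<longlonglongrightarrow> L"
        using cesaro_tendsto[of x "step f"] cesaro_lim_absorbed[OF C(1) min x z]
        by (auto simp: absorbed_def L_def)
      from tendstoD[OF this e] show "\<forall>\<^sub>F n in sequentially. \<bar>cesaro n (step f) x - L\<bar> < e"
        by (simp add: dist_real_def)
    qed
  qed
  then obtain n where n: "n > 0" "\<forall>x\<in>absorbed C. \<bar>cesaro n (step f) x - L\<bar> < e"
    unfolding eventually_sequentially by (meson le_Suc_eq order_refl zero_less_Suc)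
  define h where "h x = - potential n (step f) x" for x
  have sh: "step h x = - step (potential n (step f)) x" for x
    using step_scale[of "-1" "potential n (step f)"] by (simp add: h_def[abs_def] fun_eq_iff)
  have "L - e \<le> step f x + h x - step h x" if "x \<in> absorbed C" for x
    using potential_step[OF n(1), of "step f" x] n(2) that by (auto simp: h_def sh abs_less_iff)
  then show "\<exists>h. \<forall>x\<in>absorbed C. (\<Sum>y\<in>S. f y * (\<Sum>z\<in>S. q z * occupation y z)) - e \<le> step f x + h x - step h x"
    unfolding mean by blast
qed

end

section \<open>The chain of action windows\<close>

lemma wlen_pos: "0 < wlen W" by (simp add: wlen_def)

lemma finite_windows: "finite (windows W :: 'a::finite list set)"
  using finite_lists_length_eq[of "UNIV :: 'a set" "wlen W"] by (simp add: windows_def)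

locale policy =
  fixes W :: nat and q :: "'a::finite list pmf" and T :: "'a list \<Rightarrow> 'a list pmf"
  assumes open_loop_policy: "open_loop_policy W q T"
begin

lemma set_initial: "set_pmf q \<subseteq> windows W"
  using open_loop_policy by (simp add: open_loop_policy_def)

lemma set_transition: "\<alpha> \<in> windows W \<Longrightarrow> \<beta> \<in> set_pmf (T \<alpha>) \<Longrightarrow> \<exists>a. \<beta> = tl \<alpha> @ [a]"
  using open_loop_policy by (auto simp: open_loop_policy_def)

lemma transition_windows: "\<alpha> \<in> windows W \<Longrightarrow> set_pmf (T \<alpha>) \<subseteq> windows W"
  using wlen_pos[of W] set_transition by (fastforce simp: windows_def)

sublocale finite_chain "windows W" "\<lambda>\<alpha> \<beta>. pmf (T \<alpha>) \<beta>"
  by unfold_locales (auto simp: finite_windows sum_pmf_eq_1 transition_windows)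

lemma length_actions: "as \<in> set_pmf (actions_pmf W q T n) \<Longrightarrow> length as = wlen W + n"
  using set_initial by (induction n arbitrary: as) (auto simp: windows_def)

lemma finite_actions: "finite (set_pmf (actions_pmf W q T n))"
  by (rule finite_subset[OF _ finite_lists_length_eq[of UNIV "wlen W + n"]]) (auto dest: length_actions)

definition window_pmf :: "nat \<Rightarrow> 'a list pmf" where
  "window_pmf n = map_pmf (drop n) (actions_pmf W q T n)"

lemma set_window: "set_pmf (window_pmf n) \<subseteq> windows W"
  by (auto simp: window_pmf_def windows_def dest: length_actions)

lemma append_transition:
  assumes "length as = wlen W + n" "\<beta> \<in> set_pmf (T (drop n as))"
  shows "drop (Suc n) (as @ [last \<beta>]) = \<beta>"
proof -
  have "drop n as \<in> windows W" using assms by (simp add: windows_def)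
  then obtain a where "\<beta> = tl (drop n as) @ [a]" using set_transition assms by blast
  then show ?thesis using assms wlen_pos[of W] by (simp add: tl_drop drop_Suc[symmetric] drop_tl)
qed

lemma window_pmf_0: "window_pmf 0 = q"
  by (simp add: window_pmf_def map_pmf_idI)

lemma window_pmf_Suc: "window_pmf (Suc n) = bind_pmf (window_pmf n) T"
proof -
  have "window_pmf (Suc n) = bind_pmf (actions_pmf W q T n)
      (\<lambda>as. map_pmf (\<lambda>\<beta>. drop (Suc n) (as @ [last \<beta>])) (T (drop (length as - wlen W) as)))"
    by (simp add: window_pmf_def map_bind_pmf map_pmf_comp)
  also have "\<dots> = bind_pmf (actions_pmf W q T n) (\<lambda>as. T (drop n as))"
  proof (rule bind_pmf_cong[OF refl])
    fix as assume "as \<in> set_pmf (actions_pmf W q T n)"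
    then have len: "length as = wlen W + n" by (rule length_actions)
    show "map_pmf (\<lambda>\<beta>. drop (Suc n) (as @ [last \<beta>])) (T (drop (length as - wlen W) as)) = T (drop n as)"
      using append_transition[OF len] by (simp add: len map_pmf_idI)
  qed
  finally show ?thesis by (simp add: window_pmf_def bind_map_pmf)
qed

lemma sum_window_pmf:
  "(\<Sum>\<beta>\<in>windows W. pmf (window_pmf n) \<beta> * f \<beta>) = (\<Sum>\<alpha>\<in>windows W. pmf q \<alpha> * (step ^^ n) f \<alpha>)"
proof (induction n arbitrary: f)
  case (Suc n)
  have "pmf (window_pmf (Suc n)) \<beta> = (\<Sum>\<alpha>\<in>windows W. pmf (T \<alpha>) \<beta> * pmf (window_pmf n) \<alpha>)" for \<beta>
    unfolding window_pmf_Suc pmf_bind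
    by (rule integral_measure_pmf_real[OF finite_windows]) (use set_window in blast)
  then have "(\<Sum>\<beta>\<in>windows W. pmf (window_pmf (Suc n)) \<beta> * f \<beta>)
      = (\<Sum>\<beta>\<in>windows W. \<Sum>\<alpha>\<in>windows W. pmf (window_pmf n) \<alpha> * (pmf (T \<alpha>) \<beta> * f \<beta>))"
    by (simp add: sum_distrib_right sum_distrib_left algebra_simps)
  also have "\<dots> = (\<Sum>\<alpha>\<in>windows W. pmf (window_pmf n) \<alpha> * step f \<alpha>)"
    by (subst sum.swap) (simp add: step_def sum_distrib_left)
  also have "\<dots> = (\<Sum>\<alpha>\<in>windows W. pmf q \<alpha> * (step ^^ Suc n) f \<alpha>)"
    by (simp add: Suc.IH funpow_swap1)
  finally show ?case .
qed (simp add: window_pmf_0)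

text \<open>
  Actions taken later do not change the law of an earlier window.
\<close>

lemma nth_window: "j \<le> t \<Longrightarrow> map_pmf (\<lambda>as. take (wlen W) (drop j as)) (actions_pmf W q T t) = window_pmf j"
proof (induction t rule: dec_induct)
  case base
  show ?case unfolding window_pmf_def by (rule map_pmf_cong) (auto dest: length_actions)
next
  case (step t)
  have "map_pmf (\<lambda>as. take (wlen W) (drop j as)) (actions_pmf W q T (Suc t))
      = bind_pmf (actions_pmf W q T t) (\<lambda>as. return_pmf (take (wlen W) (drop j as)))"
    unfolding actions_pmf.simps map_bind_pmf
  proof (rule bind_pmf_cong[OF refl])
    fix as assume "as \<in> set_pmf (actions_pmf W q T t)"
    then have "wlen W + j \<le> length as" using length_actions step by auto
    then show "map_pmf (\<lambda>as. take (wlen W) (drop j as))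
        (map_pmf (\<lambda>\<beta>. as @ [last \<beta>]) (T (drop (length as - wlen W) as)))
      = return_pmf (take (wlen W) (drop j as))"
      by (simp add: map_pmf_comp map_pmf_const)
  qed
  then show ?case using step by (simp add: map_pmf_def[symmetric])
qed

text \<open>
  The limit that defines \<open>qbar\<close> exists because the Cesaro averages of the window chain converge from every start.
\<close>

lemma qbar_eq:
  assumes "\<alpha> \<in> windows W"
  shows "qbar W q T \<alpha> = (\<Sum>x\<in>windows W. pmf q x * occupation \<alpha> x)"
proof -
  have "measure_pmf.expectation (actions_pmf W q T t)
       (\<lambda>as. 1 / real t * (\<Sum>j<t. of_bool (take (wlen W) (drop j as) = \<alpha>)))
     = (\<Sum>x\<in>windows W. pmf q x * cesaro t (\<lambda>x. of_bool (x = \<alpha>)) x)" for t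
  proof -
    have "measure_pmf.expectation (actions_pmf W q T t) (\<lambda>as. of_bool (take (wlen W) (drop j as) = \<alpha>))
        = (\<Sum>x\<in>windows W. pmf q x * (step ^^ j) (\<lambda>x. of_bool (x = \<alpha>)) x)" if "j < t" for j
    proof -
      have "(\<lambda>as. of_bool (take (wlen W) (drop j as) = \<alpha>) :: real)
          = indicator ((\<lambda>as. take (wlen W) (drop j as)) -` {\<alpha>})"
        by (auto simp: fun_eq_iff indicator_def)
      then have "measure_pmf.expectation (actions_pmf W q T t) (\<lambda>as. of_bool (take (wlen W) (drop j as) = \<alpha>))
          = pmf (map_pmf (\<lambda>as. take (wlen W) (drop j as)) (actions_pmf W q T t)) \<alpha>"
        by (simp add: pmf_map)
      also have "\<dots> = pmf (window_pmf j) \<alpha>" using that by (simp add: nth_window)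
      also have "\<dots> = (\<Sum>\<beta>\<in>windows W. pmf (window_pmf j) \<beta> * of_bool (\<beta> = \<alpha>))"
      proof -
        have "(\<Sum>\<beta>\<in>windows W. pmf (window_pmf j) \<beta> * of_bool (\<beta> = \<alpha>))
            = (\<Sum>\<beta>\<in>windows W. if \<beta> = \<alpha> then pmf (window_pmf j) \<beta> else 0)"
          by (intro sum.cong) auto
        then show ?thesis using assms sum.delta[OF finite_windows, where a = \<alpha> and b = "pmf (window_pmf j)"] by simp
      qed
      finally show ?thesis by (simp add: sum_window_pmf)
    qed
    moreover have "measure_pmf.expectation (actions_pmf W q T t)
       (\<lambda>as. 1 / real t * (\<Sum>j<t. of_bool (take (wlen W) (drop j as) = \<alpha>)))
      = 1 / real t * (\<Sum>j<t. measure_pmf.expectation (actions_pmf W q T t)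
          (\<lambda>as. of_bool (take (wlen W) (drop j as) = \<alpha>)))"
      by (subst integral_mult_right_zero, subst Bochner_Integration.integral_sum)
        (auto intro: integrable_measure_pmf_finite finite_actions)
    ultimately have "measure_pmf.expectation (actions_pmf W q T t)
       (\<lambda>as. 1 / real t * (\<Sum>j<t. of_bool (take (wlen W) (drop j as) = \<alpha>)))
      = 1 / real t * (\<Sum>j<t. \<Sum>x\<in>windows W. pmf q x * (step ^^ j) (\<lambda>x. of_bool (x = \<alpha>)) x)"
      by simp
    then show ?thesis
      by (subst (asm) sum.swap) (simp add: cesaro_def sum_distrib_left sum_divide_distrib)
  qed
  moreover have "(\<lambda>t. \<Sum>x\<in>windows W. pmf q x * cesaro t (\<lambda>x. of_bool (x = \<alpha>)) x)
      \<longlonglongrightarrow> (\<Sum>x\<in>windows W. pmf q x * occupation \<alpha> x)"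
    by (intro tendsto_sum tendsto_mult tendsto_const cesaro_tendsto)
  ultimately show ?thesis unfolding qbar_def by (simp only: limI)
qed

lemma qbar_nonneg: "\<alpha> \<in> windows W \<Longrightarrow> 0 \<le> qbar W q T \<alpha>"
  by (auto simp: qbar_eq intro!: sum_nonneg mult_nonneg_nonneg occupation_nonneg)

lemma accessible_closed_set:
  assumes "closed_set D" "x \<in> D"
  shows "accessible T x \<subseteq> D"
proof
  fix y assume "y \<in> accessible T x"
  then have "(x, y) \<in> {(u, v). v \<in> set_pmf (T u)}\<^sup>*" by (simp add: accessible_def)
  then show "y \<in> D"
  proof induction
    case (step y z)
    then have "y \<in> windows W" using assms(1) by (auto simp: closed_set_def)
    then have "z \<in> windows W" using step(2) transition_windows by auto
    then show ?case using step assms(1) by (auto simp: closed_set_def pmf_positive)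
  qed (rule assms)
qed

text \<open>
  A closed set contains all that is accessible from its points, and from a point of a recurrence class that is the whole class.
\<close>

lemma recurrence_class_minimal:
  assumes "recurrence_class W T C"
  shows "closed_set C" "C \<noteq> {}" "D \<subseteq> C \<Longrightarrow> D \<noteq> {} \<Longrightarrow> closed_set D \<Longrightarrow> D = C"
proof -
  obtain \<alpha> where \<alpha>: "\<alpha> \<in> windows W" "\<forall>\<beta>\<in>accessible T \<alpha>. \<alpha> \<in> accessible T \<beta>" "C = accessible T \<alpha>"
    using assms by (auto simp: recurrence_class_def)
  have all: "closed_set (windows W)" by (auto simp: closed_set_def)
  show "closed_set C"
    unfolding closed_set_def
  proof (intro conjI ballI impI)
    show "C \<subseteq> windows W" using accessible_closed_set[OF all \<alpha>(1)] \<alpha>(3) by simp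
    fix x y assume "x \<in> C" "0 < pmf (T x) y"
    then show "y \<in> C"
      unfolding \<alpha>(3) by (auto simp: accessible_def set_pmf_iff intro: rtrancl_into_rtrancl)
  qed
  show "C \<noteq> {}" by (auto simp: \<alpha>(3) accessible_def)
  show "D = C" if D: "D \<subseteq> C" "D \<noteq> {}" "closed_set D"
  proof -
    obtain x where x: "x \<in> D" using D by auto
    then have "\<alpha> \<in> accessible T x" using D \<alpha> by auto
    then have "\<alpha> \<in> D" using accessible_closed_set[OF D(3) x] by auto
    then show ?thesis using accessible_closed_set[OF D(3)] \<alpha>(3) D(1) by blast
  qed
qed

text \<open>
  All that is needed about the policy later: every window that occurs lies in a set \<open>R\<close>, closed
  under transitions, on which Poisson's equation for the stationary average under \<open>qbar\<close> can be
  solved up to any \<open>e\<close>. Only the lower bound matters, since delays are to be bounded from above.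
\<close>

lemma ergodic_on_reachable:
  assumes "recurrence_class W T C" "{\<alpha> \<in> windows W. qbar W q T \<alpha> \<noteq> 0} \<subseteq> C"
  shows "\<exists>R. R \<subseteq> windows W \<and> set_pmf q \<subseteq> R \<and> (\<forall>\<alpha>\<in>R. set_pmf (T \<alpha>) \<subseteq> R) \<and>
    (\<forall>f e. 0 < e \<longrightarrow> (\<exists>h. \<forall>\<alpha>\<in>R.
       (\<Sum>\<beta>\<in>windows W. f \<beta> * qbar W q T \<beta>) - e
         \<le> (\<Sum>\<beta>\<in>windows W. pmf (T \<alpha>) \<beta> * f \<beta>) + h \<alpha> - (\<Sum>\<beta>\<in>windows W. pmf (T \<alpha>) \<beta> * h \<beta>)))"
proof (intro exI[of _ "absorbed C"] conjI ballI allI impI)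
  note C = recurrence_class_minimal[OF assms(1)]
  have null: "(\<Sum>x\<in>windows W. pmf q x * occupation y x) = 0" if "y \<in> windows W - C" for y
    using that assms(2) qbar_eq by auto
  have q1: "(\<Sum>x\<in>windows W. pmf q x) = 1" using finite_windows set_initial by (rule sum_pmf_eq_1)
  show "absorbed C \<subseteq> windows W" by (auto simp: absorbed_def)
  show "set_pmf q \<subseteq> absorbed C"
  proof
    fix \<alpha> assume \<alpha>: "\<alpha> \<in> set_pmf q"
    show "\<alpha> \<in> absorbed C"
      by (rule approximate_Poisson(2)[OF C(1,2) _ _ q1, of 1])
        (use C(3) null \<alpha> set_initial in \<open>auto simp: pmf_positive\<close>)
  qed
  show "set_pmf (T \<alpha>) \<subseteq> absorbed C" if "\<alpha> \<in> absorbed C" for \<alpha>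
  proof
    fix \<beta> assume "\<beta> \<in> set_pmf (T \<alpha>)"
    moreover from this that have "\<beta> \<in> windows W" using transition_windows by (auto simp: absorbed_def)
    ultimately show "\<beta> \<in> absorbed C" using closed_absorbed[of C] that
      by (auto simp: closed_set_def pmf_positive)
  qed
  fix f :: "'a list \<Rightarrow> real" and e :: real assume e: "0 < e"
  have "(\<Sum>\<beta>\<in>windows W. f \<beta> * qbar W q T \<beta>)
      = (\<Sum>\<beta>\<in>windows W. f \<beta> * (\<Sum>x\<in>windows W. pmf q x * occupation \<beta> x))"
    by (simp add: qbar_eq)
  then show "\<exists>h. \<forall>\<alpha>\<in>absorbed C. (\<Sum>\<beta>\<in>windows W. f \<beta> * qbar W q T \<beta>) - e
         \<le> (\<Sum>\<beta>\<in>windows W. pmf (T \<alpha>) \<beta> * f \<beta>) + h \<alpha> - (\<Sum>\<beta>\<in>windows W. pmf (T \<alpha>) \<beta> * h \<beta>)"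
    using approximate_Poisson(1)[OF C(1,2) C(3) _ q1 null e, of f] by (simp add: step_def)
qed

end

section \<open>Tilted likelihood ratios\<close>

text \<open>
  The exponential of \<open>-\<theta>\<close> times the log-likelihood ratio. Where the numerator density \<open>x1\<close>
  vanishes the log-likelihood ratio is \<open>-\<infinity>\<close>, so the value is \<open>\<infinity>\<close>; with this convention bounds
  along a path hold without exceptional null sets.
\<close>

definition tilt :: "real \<Rightarrow> real \<Rightarrow> real \<Rightarrow> ennreal" where
  "tilt \<theta> x0 x1 = (if x1 = 0 then \<infinity> else ennreal ((x0 / x1) powr \<theta>))"

text \<open>
  The Hellinger integral of order \<open>\<theta>\<close>, the mean of the tilt under \<open>f1\<close>. The value \<open>\<infinity>\<close> of the tilt enters with weight 0.
\<close>

definition affinity :: "'y measure \<Rightarrow> ('y \<Rightarrow> real) \<Rightarrow> ('y \<Rightarrow> real) \<Rightarrow> real \<Rightarrow> ennreal" where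
  "affinity N f0 f1 \<theta> = (\<integral>\<^sup>+y. ennreal (f1 y) * tilt \<theta> (f0 y) (f1 y) \<partial>N)"

lemma tilt_measurable [measurable]:
  assumes [measurable]: "f0 \<in> borel_measurable N" "f1 \<in> borel_measurable N"
  shows "(\<lambda>y. tilt \<theta> (f0 y) (f1 y)) \<in> borel_measurable N"
  unfolding tilt_def by measurable

lemma powr_le_affine:
  fixes x :: real
  assumes "0 \<le> x" "0 < \<theta>" "\<theta> \<le> 1"
  shows "x powr \<theta> \<le> 1 - \<theta> + \<theta> * x"
  using Youngs_inequality_0[of "1 - \<theta>" \<theta> 1 x] assms by (cases "x = 0") auto

lemma one_minus_powr_over_bounds:
  fixes x :: real
  assumes "0 < x" "0 < \<theta>" "\<theta> \<le> 1"
  shows "1 - x \<le> (1 - x powr \<theta>) / \<theta>" "(1 - x powr \<theta>) / \<theta> \<le> - ln x"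
proof -
  show "1 - x \<le> (1 - x powr \<theta>) / \<theta>"
    using powr_le_affine[of x \<theta>] assms by (simp add: field_simps)
  have "1 + \<theta> * ln x \<le> x powr \<theta>" using assms exp_ge_add_one_self by (simp add: powr_def)
  then show "(1 - x powr \<theta>) / \<theta> \<le> - ln x" using assms by (simp add: field_simps)
qed

lemma exp_quotient_tendsto:
  "(\<lambda>k. (exp (1 / real (Suc k) * c) - 1) / (1 / real (Suc k))) \<longlonglongrightarrow> c"
proof -
  have "((\<lambda>t. exp (t * c)) has_field_derivative c) (at 0)"
    by (auto intro!: derivative_eq_intros)
  then have "((\<lambda>h. (exp (h * c) - 1) / h) \<longlongrightarrow> c) (at 0)" by (simp add: DERIV_def)
  moreover have "filterlim (\<lambda>k. 1 / real (Suc k)) (at 0) sequentially"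
    by (auto simp: filterlim_at LIMSEQ_Suc[OF lim_1_over_n] simp del: of_nat_Suc)
  ultimately show ?thesis by (rule filterlim_compose)
qed

text \<open>
  Integrate Young's inequality in the form \<open>f1 (f0 / f1)\<^sup>\<theta> \<le> (1 - \<theta>) f1 + \<theta> f0\<close>.
\<close>

lemma affinity_le_1:
  assumes [measurable]: "f0 \<in> borel_measurable N" "f1 \<in> borel_measurable N"
    and nonneg: "\<And>y. 0 \<le> f0 y" "\<And>y. 0 \<le> f1 y"
    and prob: "(\<integral>\<^sup>+y. ennreal (f0 y) \<partial>N) = 1" "(\<integral>\<^sup>+y. ennreal (f1 y) \<partial>N) = 1"
    and \<theta>: "0 < \<theta>" "\<theta> \<le> 1"
  shows "affinity N f0 f1 \<theta> \<le> 1"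
proof -
  have "affinity N f0 f1 \<theta> \<le> (\<integral>\<^sup>+y. ennreal (1 - \<theta>) * ennreal (f1 y) + ennreal \<theta> * ennreal (f0 y) \<partial>N)"
    unfolding affinity_def
  proof (rule nn_integral_mono)
    fix y
    show "ennreal (f1 y) * tilt \<theta> (f0 y) (f1 y) \<le> ennreal (1 - \<theta>) * ennreal (f1 y) + ennreal \<theta> * ennreal (f0 y)"
    proof (cases "f1 y = 0")
      case False
      then have pos: "0 < f1 y" using nonneg(2)[of y] by simp
      have "f1 y * (f0 y / f1 y) powr \<theta> \<le> f1 y * (1 - \<theta> + \<theta> * (f0 y / f1 y))"
        using nonneg[of y] \<theta> pos by (intro mult_left_mono powr_le_affine) auto
      also have "\<dots> = (1 - \<theta>) * f1 y + \<theta> * f0 y" using pos by (simp add: field_simps)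
      finally show ?thesis
        using False nonneg[of y] \<theta>
        by (simp add: tilt_def ennreal_mult[symmetric] ennreal_plus[symmetric] ennreal_leI del: ennreal_plus)
    qed (simp add: tilt_def)
  qed
  also have "\<dots> = ennreal (1 - \<theta>) + ennreal \<theta>"
    by (subst nn_integral_add) (simp_all add: nn_integral_cmult prob)
  also have "\<dots> = 1" using \<theta> by (simp add: ennreal_plus[symmetric] del: ennreal_plus)
  finally show ?thesis .
qed

text \<open>
  The divergence is minus the derivative of the affinity at 0. With \<open>x = f0 / f1\<close> the difference
  quotients \<open>(1 - x\<^sup>\<theta>) / \<theta>\<close> lie between \<open>1 - x\<close> and \<open>- ln x\<close>; the former is
  integrable under \<open>f1\<close> in any case and the latter because the divergence is finite, so dominated
  convergence applies.
\<close>

lemma affinity_derivative: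
  assumes "sigma_finite_measure N"
    and meas [measurable]: "f0 \<in> borel_measurable N" "f1 \<in> borel_measurable N"
    and nonneg: "\<And>y. 0 \<le> f0 y" "\<And>y. 0 \<le> f1 y"
    and prob: "(\<integral>\<^sup>+y. ennreal (f0 y) \<partial>N) = 1" "(\<integral>\<^sup>+y. ennreal (f1 y) \<partial>N) = 1"
    and fin: "kl_div (density N f1) (density N f0) < \<infinity>"
  shows "(\<lambda>k. (1 - enn2real (affinity N f0 f1 (1 / real (Suc k)))) / (1 / real (Suc k)))
    \<longlonglongrightarrow> enn2real (kl_div (density N f1) (density N f0))"
proof -
  let ?P = "density N f1" and ?Q = "density N f0"
  let ?\<theta> = "\<lambda>k. 1 / real (Suc k)"
  interpret N: sigma_finite_measure N by fact
  interpret Q: sigma_finite_measure ?Q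
    by (subst N.sigma_finite_iff_density_finite) auto
  interpret P: prob_space ?P
    by (rule prob_spaceI) (simp add: emeasure_density prob cong: nn_integral_cong)
  have ac: "absolutely_continuous ?Q ?P" and int: "integrable ?P (entropy_density (exp 1) ?Q ?P)"
    and kl: "kl_div ?P ?Q = ennreal (KL_divergence (exp 1) ?Q ?P)"
    using fin by (auto simp: kl_div_def split: if_splits)
  have AE_f1: "AE y in ?P. 0 < f1 y" by (auto simp: AE_density)
  have "{y \<in> space N. f0 y = 0} \<in> null_sets ?Q"
    by (auto simp: null_sets_density_iff nonneg)
  then have "{y \<in> space N. f0 y = 0} \<in> null_sets ?P" using ac by (auto simp: absolutely_continuous_def)
  then have AE_imp: "AE y in N. f0 y = 0 \<longrightarrow> f1 y = 0"
    by (auto simp: null_sets_density_iff nonneg ennreal_eq_0_iff elim!: eventually_mono intro: antisym)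
  have AE_f0: "AE y in ?P. 0 < f0 y"
    using AE_imp by (auto simp: AE_density nonneg less_le)
  have dens: "density ?Q (\<lambda>y. ennreal (f1 y / f0 y)) = ?P"
    using AE_imp nonneg by (intro density_density_divide) auto
  have "AE y in ?Q. ennreal (f1 y / f0 y) = RN_deriv ?Q ?P y"
    by (rule Q.RN_deriv_unique) (auto simp: dens)
  then have "AE y in ?P. ennreal (f1 y / f0 y) = RN_deriv ?Q ?P y"
    using absolutely_continuous_AE[OF _ ac] by simp
  then have L: "AE y in ?P. entropy_density (exp 1) ?Q ?P y = - ln (f0 y / f1 y)"
    using AE_f0 AE_f1
  proof eventually_elim
    case (elim y)
    then have "enn2real (RN_deriv ?Q ?P y) = f1 y / f0 y" by (metis enn2real_ennreal divide_nonneg_pos less_imp_le)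
    then show ?case using elim(2,3) by (simp add: entropy_density_def log_def ln_div)
  qed
  have [measurable]: "entropy_density (exp 1) ?Q ?P \<in> borel_measurable ?P"
    using int by auto
  have intL: "integrable ?P (\<lambda>y. - ln (f0 y / f1 y))"
    using int by (rule integrable_cong_AE_imp) (use L in auto)
  have KL: "KL_divergence (exp 1) ?Q ?P = (\<integral>y. - ln (f0 y / f1 y) \<partial>?P)"
    unfolding KL_divergence_def by (rule integral_cong_AE) (use L in auto)
  have int_ratio: "integrable ?P (\<lambda>y. f0 y / f1 y)"
  proof (rule integrableI_nonneg)
    have "(\<integral>\<^sup>+y. ennreal (f0 y / f1 y) \<partial>?P) = (\<integral>\<^sup>+y. ennreal (f1 y) * ennreal (f0 y / f1 y) \<partial>N)"
      by (subst nn_integral_density) auto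
    also have "\<dots> \<le> (\<integral>\<^sup>+y. ennreal (f0 y) \<partial>N)"
      using nonneg by (intro nn_integral_mono) (auto simp: ennreal_mult[symmetric] intro!: ennreal_leI)
    finally show "(\<integral>\<^sup>+y. ennreal (f0 y / f1 y) \<partial>?P) < \<infinity>" using prob by (auto intro: le_less_trans)
  qed (use nonneg in auto)
  have dom: "integrable ?P (\<lambda>y. \<bar>- ln (f0 y / f1 y)\<bar> + (1 + f0 y / f1 y))"
    using intL int_ratio by (intro Bochner_Integration.integrable_add integrable_abs) auto
  have bound: "AE y in ?P. norm ((1 - (f0 y / f1 y) powr ?\<theta> k) / ?\<theta> k) \<le> \<bar>- ln (f0 y / f1 y)\<bar> + (1 + f0 y / f1 y)" for k
    using AE_f0 AE_f1
  proof eventually_elim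
    case (elim y)
    then have "0 < f0 y / f1 y" by simp
    from one_minus_powr_over_bounds[OF this, of "?\<theta> k"] this show ?case
      unfolding real_norm_def by (auto simp: abs_le_iff simp del: of_nat_Suc) 
  qed
  have lim: "AE y in ?P. (\<lambda>k. (1 - (f0 y / f1 y) powr ?\<theta> k) / ?\<theta> k) \<longlonglongrightarrow> - ln (f0 y / f1 y)"
    using AE_f0 AE_f1
  proof eventually_elim
    case (elim y)
    then have pos: "0 < f0 y / f1 y" by simp
    have "(1 - (f0 y / f1 y) powr ?\<theta> k) / ?\<theta> k = - ((exp (?\<theta> k * ln (f0 y / f1 y)) - 1) / ?\<theta> k)" for k
      using elim by (simp add: powr_def field_simps)
    then show ?case using tendsto_minus[OF exp_quotient_tendsto[of "ln (f0 y / f1 y)"]] by presburger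
  qed
  have conv: "(\<lambda>k. \<integral>y. (1 - (f0 y / f1 y) powr ?\<theta> k) / ?\<theta> k \<partial>?P) \<longlonglongrightarrow> (\<integral>y. - ln (f0 y / f1 y) \<partial>?P)"
    by (rule integral_dominated_convergence[OF _ _ dom lim bound]) auto
  have eq: "(\<integral>y. (1 - (f0 y / f1 y) powr ?\<theta> k) / ?\<theta> k \<partial>?P) = (1 - enn2real (affinity N f0 f1 (?\<theta> k))) / ?\<theta> k" for k
  proof -
    have aff: "affinity N f0 f1 (?\<theta> k) = (\<integral>\<^sup>+y. ennreal ((f0 y / f1 y) powr ?\<theta> k) \<partial>?P)"
      unfolding affinity_def by (subst nn_integral_density) (auto simp: tilt_def intro!: nn_integral_cong)
    have le: "affinity N f0 f1 (?\<theta> k) \<le> 1" using nonneg prob by (intro affinity_le_1) auto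
    have int: "integrable ?P (\<lambda>y. (f0 y / f1 y) powr ?\<theta> k)"
      using le unfolding aff by (intro integrableI_nonneg) (auto intro: le_less_trans)
    have "enn2real (affinity N f0 f1 (?\<theta> k)) = (\<integral>y. (f0 y / f1 y) powr ?\<theta> k \<partial>?P)"
      unfolding aff by (subst integral_eq_nn_integral) auto
    then show ?thesis using int P.prob_space by (simp del: of_nat_Suc)
  qed
  have le: "enn2real (affinity N f0 f1 (?\<theta> k)) \<le> 1" for k
    using enn2real_mono[OF affinity_le_1[OF meas nonneg prob, of "?\<theta> k"]] by simp
  have "0 \<le> (\<integral>y. (1 - (f0 y / f1 y) powr ?\<theta> k) / ?\<theta> k \<partial>?P)" for k
    unfolding eq using le[of k] by (intro divide_nonneg_nonneg) auto
  then have "0 \<le> (\<integral>y. - ln (f0 y / f1 y) \<partial>?P)"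
    by (intro LIMSEQ_le_const[OF conv]) blast
  then show ?thesis using conv unfolding eq kl KL by simp
qed

text \<open>
  Dividing by \<open>exp (\<theta> h \<alpha>)\<close>, the left-hand side is \<open>1 - \<theta> (step f \<alpha> + h \<alpha> - step h \<alpha>) + o(\<theta>)\<close>, and
  Poisson's equation bounds the bracket from below by \<open>I - e > \<delta>\<close>. One \<open>\<theta>\<close> serves all
  windows because there are finitely many.
\<close>

lemma (in policy) exponential_drift:
  assumes R: "R \<subseteq> windows W"
    and h: "\<forall>\<alpha>\<in>R. I - e \<le> step f \<alpha> + h \<alpha> - step h \<alpha>"
    and \<delta>: "\<delta> < I - e"
    and \<rho>: "\<And>\<beta>. \<beta> \<in> windows W \<Longrightarrow> (\<lambda>k. (1 - \<rho> k \<beta>) / (1 / real (Suc k))) \<longlonglongrightarrow> f \<beta>"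
  shows "\<exists>k. \<forall>\<alpha>\<in>R. (\<Sum>\<beta>\<in>windows W. pmf (T \<alpha>) \<beta> * (\<rho> k \<beta> * exp (1 / real (Suc k) * h \<beta>)))
            \<le> exp (- (1 / real (Suc k) * \<delta>)) * exp (1 / real (Suc k) * h \<alpha>)"
proof -
  let ?\<theta> = "\<lambda>k. 1 / real (Suc k)"
  define G where "G k \<alpha> = (\<Sum>\<beta>\<in>windows W. pmf (T \<alpha>) \<beta> * (\<rho> k \<beta> * exp (?\<theta> k * (h \<beta> - h \<alpha>))))" for k \<alpha>
  have ev: "\<forall>\<^sub>F k in sequentially. (G k \<alpha> - 1) / ?\<theta> k < - \<delta>" if \<alpha>: "\<alpha> \<in> R" for \<alpha>
  proof -
    have \<alpha>S: "\<alpha> \<in> windows W" using \<alpha> R by auto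
    have quot: "(\<lambda>k. (\<rho> k \<beta> * exp (?\<theta> k * d) - 1) / ?\<theta> k) \<longlonglongrightarrow> d - f \<beta>" if \<beta>: "\<beta> \<in> windows W" for \<beta> d
    proof -
      have "(\<lambda>k. 1 - ?\<theta> k * ((1 - \<rho> k \<beta>) / ?\<theta> k)) \<longlonglongrightarrow> 1 - 0 * f \<beta>"
        by (intro tendsto_diff tendsto_const tendsto_mult LIMSEQ_Suc[OF lim_1_over_n] \<rho>[OF \<beta>])
      then have "(\<lambda>k. \<rho> k \<beta>) \<longlonglongrightarrow> 1" by simp
      then have "(\<lambda>k. \<rho> k \<beta> * ((exp (?\<theta> k * d) - 1) / ?\<theta> k) - (1 - \<rho> k \<beta>) / ?\<theta> k) \<longlonglongrightarrow> 1 * d - f \<beta>"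
        by (intro tendsto_diff tendsto_mult exp_quotient_tendsto \<rho>[OF \<beta>])
      moreover have "\<rho> k \<beta> * ((exp (?\<theta> k * d) - 1) / ?\<theta> k) - (1 - \<rho> k \<beta>) / ?\<theta> k
          = (\<rho> k \<beta> * exp (?\<theta> k * d) - 1) / ?\<theta> k" for k
        by (simp add: field_simps)
      ultimately show ?thesis by simp
    qed
    have "(G k \<alpha> - 1) / ?\<theta> k = (\<Sum>\<beta>\<in>windows W. pmf (T \<alpha>) \<beta> * ((\<rho> k \<beta> * exp (?\<theta> k * (h \<beta> - h \<alpha>)) - 1) / ?\<theta> k))" for k
    proof -
      have "G k \<alpha> - 1 = (\<Sum>\<beta>\<in>windows W. pmf (T \<alpha>) \<beta> * (\<rho> k \<beta> * exp (?\<theta> k * (h \<beta> - h \<alpha>)) - 1))"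
        using kernel_sum[OF \<alpha>S] by (simp add: G_def right_diff_distrib sum_subtractf)
      then show ?thesis by (simp only: sum_divide_distrib times_divide_eq_right)
    qed
    moreover have "(\<lambda>k. \<Sum>\<beta>\<in>windows W. pmf (T \<alpha>) \<beta> * ((\<rho> k \<beta> * exp (?\<theta> k * (h \<beta> - h \<alpha>)) - 1) / ?\<theta> k))
        \<longlonglongrightarrow> (\<Sum>\<beta>\<in>windows W. pmf (T \<alpha>) \<beta> * ((h \<beta> - h \<alpha>) - f \<beta>))"
      by (intro tendsto_sum tendsto_mult tendsto_const quot)
    moreover have "(\<Sum>\<beta>\<in>windows W. pmf (T \<alpha>) \<beta> * ((h \<beta> - h \<alpha>) - f \<beta>)) = step h \<alpha> - h \<alpha> - step f \<alpha>"
      using kernel_sum[OF \<alpha>S]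
      by (simp add: step_def right_diff_distrib sum_subtractf sum_distrib_right[symmetric])
    ultimately have "(\<lambda>k. (G k \<alpha> - 1) / ?\<theta> k) \<longlonglongrightarrow> step h \<alpha> - h \<alpha> - step f \<alpha>" by (simp only:)
    moreover have "step h \<alpha> - h \<alpha> - step f \<alpha> < - \<delta>" using h \<alpha> \<delta> by fastforce
    ultimately show ?thesis by (rule order_tendstoD(2))
  qed
  have "\<forall>\<^sub>F k in sequentially. \<forall>\<alpha>\<in>R. (G k \<alpha> - 1) / ?\<theta> k < - \<delta>"
    using ev by (intro eventually_ball_finite finite_subset[OF R finite_windows]) auto
  then obtain k where k: "\<forall>\<alpha>\<in>R. (G k \<alpha> - 1) / ?\<theta> k < - \<delta>" by (auto simp: eventually_sequentially)
  show ?thesis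
  proof (intro exI ballI)
    fix \<alpha> assume \<alpha>: "\<alpha> \<in> R"
    have "(G k \<alpha> - 1) / ?\<theta> k < - \<delta>" using k \<alpha> by blast
    then have "G k \<alpha> < 1 + - (?\<theta> k * \<delta>)" by (simp add: field_simps)
    also have "\<dots> \<le> exp (- (?\<theta> k * \<delta>))" by (rule exp_ge_add_one_self)
    finally have "G k \<alpha> * exp (?\<theta> k * h \<alpha>) \<le> exp (- (?\<theta> k * \<delta>)) * exp (?\<theta> k * h \<alpha>)"
      by (intro mult_right_mono) auto
    moreover have "G k \<alpha> * exp (?\<theta> k * h \<alpha>)
        = (\<Sum>\<beta>\<in>windows W. pmf (T \<alpha>) \<beta> * (\<rho> k \<beta> * exp (?\<theta> k * h \<beta>)))"
      unfolding G_def sum_distrib_right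
      by (intro sum.cong) (simp_all add: mult.assoc exp_add[symmetric] right_diff_distrib)
    ultimately show "(\<Sum>\<beta>\<in>windows W. pmf (T \<alpha>) \<beta> * (\<rho> k \<beta> * exp (?\<theta> k * h \<beta>)))
            \<le> exp (- (?\<theta> k * \<delta>)) * exp (?\<theta> k * h \<alpha>)" by (simp only:)
  qed
qed

section \<open>One step of the sampled signal\<close>

text \<open>
  Fubini's theorem for two independent variables. Independence is spelled out because \<^const>\<open>prob_space.indep_var\<close>
  ties both variables to the same type of values, and actions and signals have different types.
\<close>

lemma (in prob_space) nn_integral_indep_pair:
  assumes V: "V \<in> measurable M S" and U: "U \<in> measurable M N"
    and indep: "\<And>a b. a \<in> sets S \<Longrightarrow> b \<in> sets N \<Longrightarrow>
      prob ((\<lambda>\<omega>. (V \<omega>, U \<omega>)) -` (a \<times> b) \<inter> space M) = prob (V -` a \<inter> space M) * prob (U -` b \<inter> space M)"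
    and F: "case_prod F \<in> borel_measurable (S \<Otimes>\<^sub>M N)"
  shows "(\<integral>\<^sup>+\<omega>. F (V \<omega>) (U \<omega>) \<partial>M) = (\<integral>\<^sup>+\<omega>'. \<integral>\<^sup>+\<omega>. F (V \<omega>') (U \<omega>) \<partial>M \<partial>M)"
proof -
  interpret V: prob_space "distr M S V" using V by (rule prob_space_distr)
  interpret U: prob_space "distr M N U" using U by (rule prob_space_distr)
  have eq: "distr M (S \<Otimes>\<^sub>M N) (\<lambda>\<omega>. (V \<omega>, U \<omega>)) = distr M S V \<Otimes>\<^sub>M distr M N U"
    by (rule pair_measure_eqI[symmetric])
       (use V U indep in \<open>auto simp: emeasure_distr emeasure_eq_measure ennreal_mult[symmetric]
          V.sigma_finite_measure_axioms U.sigma_finite_measure_axioms\<close>)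
  have "(\<integral>\<^sup>+\<omega>. F (V \<omega>) (U \<omega>) \<partial>M) = (\<integral>\<^sup>+z. case_prod F z \<partial>distr M (S \<Otimes>\<^sub>M N) (\<lambda>x. (V x, U x)))"
    using F V U by (subst nn_integral_distr) auto
  also have "\<dots> = (\<integral>\<^sup>+v. \<integral>\<^sup>+u. F v u \<partial>distr M N U \<partial>distr M S V)"
    unfolding eq using F by (subst U.nn_integral_fst[symmetric]) auto
  also have "\<dots> = (\<integral>\<^sup>+v. \<integral>\<^sup>+\<omega>. F v (U \<omega>) \<partial>M \<partial>distr M S V)"
  proof (rule nn_integral_cong)
    fix v assume "v \<in> space (distr M S V)"
    then have "(\<lambda>u. F v u) \<in> borel_measurable N" using measurable_Pair2[OF F, of v] by simp
    then show "(\<integral>\<^sup>+u. F v u \<partial>distr M N U) = (\<integral>\<^sup>+\<omega>. F v (U \<omega>) \<partial>M)"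
      using U by (subst nn_integral_distr) auto
  qed
  also have "\<dots> = (\<integral>\<^sup>+\<omega>'. \<integral>\<^sup>+\<omega>. F (V \<omega>') (U \<omega>) \<partial>M \<partial>M)"
  proof (rule nn_integral_distr[OF V])
    have [measurable]: "case_prod F \<in> borel_measurable (S \<Otimes>\<^sub>M N)" "U \<in> measurable M N" by fact+
    show "(\<lambda>v. \<integral>\<^sup>+\<omega>. F v (U \<omega>) \<partial>M) \<in> borel_measurable (distr M S V)" by measurable
  qed
  finally show ?thesis .
qed

text \<open>
  An identity between integrals over the events of \<open>F\<close> extends to all \<open>F\<close>-measurable weights, since it
  says that two densities define the same measure on \<open>F\<close>. So identities given the history have to be
  proved for its events only.
\<close>

lemma nn_integral_weight_cong:
  assumes sub: "subalgebra M F" and [measurable]: "\<phi> \<in> borel_measurable M" "\<psi> \<in> borel_measurable M"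
    and eq: "\<And>B. B \<in> sets F \<Longrightarrow> (\<integral>\<^sup>+x. indicator B x * \<phi> x \<partial>M) = (\<integral>\<^sup>+x. indicator B x * \<psi> x \<partial>M)"
    and G: "G \<in> borel_measurable F"
  shows "(\<integral>\<^sup>+x. G x * \<phi> x \<partial>M) = (\<integral>\<^sup>+x. G x * \<psi> x \<partial>M)"
proof -
  have GM [measurable]: "G \<in> borel_measurable M" using sub G by (rule measurable_from_subalg)
  have sub': "subalgebra (density M \<xi>) F" for \<xi> using sub by (simp add: subalgebra_def)
  have restr: "(\<integral>\<^sup>+x. G x * \<xi> x \<partial>M) = (\<integral>\<^sup>+x. G x \<partial>restr_to_subalg (density M \<xi>) F)"
    if [measurable]: "\<xi> \<in> borel_measurable M" for \<xi>
    by (simp add: nn_integral_subalgebra2[OF sub' G] nn_integral_density mult.commute)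
  have "restr_to_subalg (density M \<phi>) F = restr_to_subalg (density M \<psi>) F"
  proof (rule measure_eqI)
    fix B assume "B \<in> sets (restr_to_subalg (density M \<phi>) F)"
    then have B: "B \<in> sets F" by (simp add: sets_restr_to_subalg[OF sub'])
    then have [measurable]: "B \<in> sets M" using sub by (auto simp: subalgebra_def)
    show "emeasure (restr_to_subalg (density M \<phi>) F) B = emeasure (restr_to_subalg (density M \<psi>) F) B"
      using eq[OF B] by (simp add: emeasure_restr_to_subalg[OF sub' B] emeasure_density mult.commute)
  qed (simp add: sets_restr_to_subalg[OF sub'])
  then show ?thesis by (simp add: restr)
qed

locale sensed_signal = sampled_signal P X f A W q T + policy W q T
  for P :: "'w measure" and X :: "nat \<Rightarrow> 'w \<Rightarrow> real ^ 'n::finite" and f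
    and A :: "nat \<Rightarrow> 'w \<Rightarrow> 'a::finite" and W q T +
  fixes OS :: "'y measure" and obs :: "'a \<Rightarrow> real ^ 'n \<Rightarrow> 'y"
  assumes obs_measurable [measurable]: "obs a \<in> measurable borel OS"
begin

abbreviation "Y \<equiv> observation obs A X"
abbreviation "H \<equiv> history (space P) OS A Y"

definition actions :: "nat \<Rightarrow> 'w \<Rightarrow> 'a list" where
  "actions t \<omega> = map (\<lambda>t. A t \<omega>) [1..<Suc t]"

definition window :: "nat \<Rightarrow> 'w \<Rightarrow> 'a list" where
  "window t \<omega> = drop (t - wlen W) (actions t \<omega>)"

definition \<A> :: "'w measure" where
  "\<A> = vimage_algebra (space P) (\<lambda>\<omega>. \<lambda>t\<in>{1..}. A t \<omega>) (PiM {1..} (\<lambda>_. count_space UNIV))"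

definition \<X> :: "'w measure" where
  "\<X> = vimage_algebra (space P) (\<lambda>\<omega>. \<lambda>t\<in>{1..}. X t \<omega>) (PiM {1..} (\<lambda>_. borel))"

lemma space_\<A>: "space \<A> = space P" and space_\<X>: "space \<X> = space P"
  by (simp_all add: \<A>_def \<X>_def)

definition obs_record :: "nat \<Rightarrow> 'w \<Rightarrow> nat \<Rightarrow> 'a \<times> 'y" where
  "obs_record n \<omega> = (\<lambda>s\<in>{1..n}. (A s \<omega>, Y s \<omega>))"

lemma X_measurable: "1 \<le> t \<Longrightarrow> X t \<in> borel_measurable P"
  using signal_pdf[of t] by (auto simp: distributed_def)

lemma Y_measurable: "1 \<le> t \<Longrightarrow> Y t \<in> measurable P OS"
  unfolding observation_def[abs_def]
  by (rule measurable_compose_countable[OF _ action_measurable])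
     (use X_measurable in measurable)

lemma record_measurable: "obs_record n \<in> measurable P (PiM {1..n} (\<lambda>_. count_space UNIV \<Otimes>\<^sub>M OS))"
  unfolding obs_record_def[abs_def]
  by (intro measurable_restrict measurable_Pair) (auto intro: action_measurable Y_measurable)

lemma record_space: "obs_record n \<in> space P \<rightarrow> space (PiM {1..n} (\<lambda>_. count_space UNIV \<Otimes>\<^sub>M OS))"
  using record_measurable by (rule measurable_space[THEN funcsetI])

lemma history_eq: "H n = vimage_algebra (space P) (obs_record n) (PiM {1..n} (\<lambda>_. count_space UNIV \<Otimes>\<^sub>M OS))"
  by (simp add: history_def obs_record_def[abs_def])

lemma space_history [simp]: "space (H n) = space P"
  by (simp add: history_eq)

lemma subalgebra_history: "subalgebra P (H n)"
  unfolding subalgebra_def history_eq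
  using sets_image_in_sets[OF refl record_measurable] by simp

lemma record_measurable_history:
  "obs_record n \<in> measurable (H n) (PiM {1..n} (\<lambda>_. count_space UNIV \<Otimes>\<^sub>M OS))"
  unfolding history_eq using record_space by (rule measurable_vimage_algebra1)

lemma pair_measurable_history:
  assumes "1 \<le> s" "s \<le> n"
  shows "(\<lambda>\<omega>. (A s \<omega>, Y s \<omega>)) \<in> measurable (H n) (count_space UNIV \<Otimes>\<^sub>M OS)"
proof -
  have "(\<lambda>\<omega>. obs_record n \<omega> s) \<in> measurable (H n) (count_space UNIV \<Otimes>\<^sub>M OS)"
    by (rule measurable_compose[OF record_measurable_history measurable_component_singleton]) (use assms in auto)
  then show ?thesis using assms by (simp add: obs_record_def)
qed

lemma action_measurable_history: "1 \<le> s \<Longrightarrow> s \<le> n \<Longrightarrow> A s \<in> measurable (H n) (count_space UNIV)"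
  using measurable_compose[OF pair_measurable_history measurable_fst] by simp

lemma Y_measurable_history: "1 \<le> s \<Longrightarrow> s \<le> n \<Longrightarrow> Y s \<in> measurable (H n) OS"
  using measurable_compose[OF pair_measurable_history measurable_snd] by simp

lemma observed_measurable_history:
  assumes "\<And>a. \<phi> a \<in> measurable OS N" "1 \<le> s" "s \<le> n"
  shows "(\<lambda>\<omega>. \<phi> (A s \<omega>) (Y s \<omega>)) \<in> measurable (H n) N"
  by (rule measurable_compose_countable[OF _ action_measurable_history])
     (use assms in \<open>auto intro: measurable_compose[OF Y_measurable_history]\<close>)

lemma subalgebra_history_mono:
  assumes "n \<le> n'" shows "subalgebra (H n') (H n)"
proof -
  have "obs_record n \<in> measurable (H n') (PiM {1..n} (\<lambda>_. count_space UNIV \<Otimes>\<^sub>M OS))"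
    unfolding obs_record_def[abs_def]
    by (intro measurable_restrict) (use assms in \<open>auto intro: pair_measurable_history\<close>)
  from sets_image_in_sets[OF space_history this] show ?thesis
    by (simp add: subalgebra_def history_eq)
qed

lemma actions_Suc: "actions (Suc t) \<omega> = actions t \<omega> @ [A (Suc t) \<omega>]"
  by (simp add: actions_def)

lemma length_actions_process [simp]: "length (actions t \<omega>) = t"
  by (simp add: actions_def)

lemma actions_nth: "1 \<le> s \<Longrightarrow> s \<le> t \<Longrightarrow> actions t \<omega> ! (s - 1) = A s \<omega>"
  using nth_upt[of 1 "s - 1" "Suc t"] by (simp add: actions_def del: upt_Suc)

lemma actions_measurableI:
  assumes "\<And>s. 1 \<le> s \<Longrightarrow> s \<le> t \<Longrightarrow> A s \<in> measurable N (count_space UNIV)"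
  shows "actions t \<in> measurable N (count_space UNIV)"
  using assms
proof (induction t)
  case (Suc t)
  have "(\<lambda>\<omega>. actions t \<omega> @ [A (Suc t) \<omega>]) \<in> measurable N (count_space UNIV)"
    by (rule measurable_compose_countable[of "\<lambda>as \<omega>. as @ [A (Suc t) \<omega>]"])
       (use Suc in \<open>auto intro: measurable_compose[where f = "A (Suc t)" and N = "count_space UNIV"]\<close>)
  then show ?case by (simp add: actions_Suc[abs_def])
qed (simp add: actions_def[abs_def])

lemma actions_measurable_history: "t \<le> n \<Longrightarrow> actions t \<in> measurable (H n) (count_space UNIV)"
  by (rule actions_measurableI) (auto intro: action_measurable_history)

lemma window_measurable_history: "t \<le> n \<Longrightarrow> window t \<in> measurable (H n) (count_space UNIV)"
  unfolding window_def[abs_def] by (rule measurable_compose[OF actions_measurable_history]) auto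

lemma actions_measurable: "actions t \<in> measurable P (count_space UNIV)"
  by (rule actions_measurableI) (rule action_measurable)

lemma component_measurable_\<A>: "1 \<le> s \<Longrightarrow> A s \<in> measurable \<A> (count_space UNIV)"
proof -
  assume s: "1 \<le> s"
  have "(\<lambda>\<omega>. \<lambda>t\<in>{1..}. A t \<omega>) \<in> measurable \<A> (PiM {1..} (\<lambda>_. count_space UNIV))"
    unfolding \<A>_def by (rule measurable_vimage_algebra1) (auto simp: space_PiM)
  from measurable_compose[OF this measurable_component_singleton, of s] show ?thesis using s by simp
qed

lemma component_measurable_\<X>: "1 \<le> s \<Longrightarrow> X s \<in> borel_measurable \<X>"
proof -
  assume s: "1 \<le> s"
  have "(\<lambda>\<omega>. \<lambda>t\<in>{1..}. X t \<omega>) \<in> measurable \<X> (PiM {1..} (\<lambda>_. borel))"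
    unfolding \<X>_def by (rule measurable_vimage_algebra1) (auto simp: space_PiM)
  from measurable_compose[OF this measurable_component_singleton, of s] show ?thesis using s by simp
qed

lemma measurable_\<X>_imp: "g \<in> measurable \<X> N \<Longrightarrow> g \<in> measurable P N"
proof (rule measurable_from_subalg)
  show "subalgebra P \<X>"
    using indep_setD_ev2[OF open_loop] by (simp add: subalgebra_def \<X>_def)
qed

text \<open>
  Since the policy does not look at the signal, actions and signal may be drawn on separate copies of
  the probability space.
\<close>

lemma decouple_actions:
  assumes "\<And>c. F c \<in> borel_measurable \<X>"
  shows "(\<integral>\<^sup>+\<omega>. F (actions t \<omega>) \<omega> \<partial>P) = (\<integral>\<^sup>+\<omega>'. \<integral>\<^sup>+\<omega>. F (actions t \<omega>') \<omega> \<partial>P \<partial>P)"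
proof -
  have V: "actions t \<in> measurable \<A> (count_space UNIV)"
    by (intro actions_measurableI component_measurable_\<A>)
  have "prob ((\<lambda>\<omega>. (actions t \<omega>, \<omega>)) -` (a \<times> b) \<inter> space P)
      = prob (actions t -` a \<inter> space P) * prob ((\<lambda>\<omega>. \<omega>) -` b \<inter> space P)"
    if "a \<in> sets (count_space UNIV)" "b \<in> sets \<X>" for a b
  proof -
    have a: "actions t -` a \<inter> space P \<in> sets \<A>" using measurable_sets[OF V that(1)] by (simp add: space_\<A>)
    have b: "b \<subseteq> space P" using sets.sets_into_space[OF that(2)] by (simp add: space_\<X>)
    then have "(\<lambda>\<omega>. (actions t \<omega>, \<omega>)) -` (a \<times> b) \<inter> space P = (actions t -` a \<inter> space P) \<inter> b"
      "(\<lambda>\<omega>. \<omega>) -` b \<inter> space P = b" by auto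
    then show ?thesis using indep_setD[OF open_loop[folded \<A>_def \<X>_def] a that(2)] by simp
  qed
  moreover have "case_prod F \<in> borel_measurable (count_space UNIV \<Otimes>\<^sub>M \<X>)"
    by (rule measurable_pair_measure_countable1) (use assms in auto)
  ultimately show ?thesis
    using nn_integral_indep_pair[of "actions t" "count_space UNIV" "\<lambda>\<omega>. \<omega>" \<X> F]
      actions_measurable measurable_\<X>_imp[OF measurable_ident] by (simp add: id_def)
qed

text \<open>
  An event of the history, read as an event of the signal when the actions are frozen to \<open>c\<close>.
\<close>

definition frozen :: "nat \<Rightarrow> (nat \<Rightarrow> 'a \<times> 'y) set \<Rightarrow> 'a list \<Rightarrow> 'w \<Rightarrow> ennreal" where
  "frozen t B c \<omega> = indicator B (\<lambda>s\<in>{1..t}. (c ! (s - 1), obs (c ! (s - 1)) (X s \<omega>)))"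

lemma frozen_map_measurable:
  "(\<lambda>v. \<lambda>s\<in>{1..t}. (c ! (s - 1), obs (c ! (s - 1)) (v s)))
     \<in> measurable (PiM {1..t} (\<lambda>_. borel)) (PiM {1..t} (\<lambda>_. count_space UNIV \<Otimes>\<^sub>M OS))"
proof (intro measurable_restrict measurable_Pair measurable_const)
  fix s assume "s \<in> {1..t}"
  then have "(\<lambda>v. v s) \<in> measurable (PiM {1..t} (\<lambda>_. borel)) borel" by (rule measurable_component_singleton)
  then show "(\<lambda>v. obs (c ! (s - 1)) (v s)) \<in> measurable (PiM {1..t} (\<lambda>_. borel)) OS"
    by (rule measurable_compose) (rule obs_measurable)
qed simp

lemma frozen_measurable_\<X>:
  assumes "B \<in> sets (PiM {1..t} (\<lambda>_. count_space UNIV \<Otimes>\<^sub>M OS))"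
  shows "frozen t B c \<in> borel_measurable \<X>"
proof -
  have "(\<lambda>\<omega>. \<lambda>s\<in>{1..t}. (c ! (s - 1), obs (c ! (s - 1)) (X s \<omega>)))
      \<in> measurable \<X> (PiM {1..t} (\<lambda>_. count_space UNIV \<Otimes>\<^sub>M OS))"
    by (intro measurable_restrict measurable_Pair measurable_const
        measurable_compose[OF component_measurable_\<X> obs_measurable]) auto
  from measurable_compose[OF this borel_measurable_indicator[OF assms]] show ?thesis
    by (simp add: frozen_def[abs_def])
qed

lemma indicator_history_eq_frozen:
  assumes "\<omega> \<in> space P" "t \<le> t'"
  shows "indicator (obs_record t -` B \<inter> space P) \<omega> = frozen t B (actions t' \<omega>) \<omega>"
proof -
  have "obs_record t \<omega> = (\<lambda>s\<in>{1..t}. (actions t' \<omega> ! (s - 1), obs (actions t' \<omega> ! (s - 1)) (X s \<omega>)))"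
    unfolding obs_record_def observation_def
  proof (rule restrict_ext)
    fix s assume "s \<in> {1..t}"
    then have "actions t' \<omega> ! (s - 1) = A s \<omega>" using assms(2) by (intro actions_nth) auto
    then show "(A s \<omega>, obs (A s \<omega>) (X s \<omega>)) = (actions t' \<omega> ! (s - 1), obs (actions t' \<omega> ! (s - 1)) (X s \<omega>))"
      by simp
  qed
  then have "frozen t B (actions t' \<omega>) \<omega> = indicator B (obs_record t \<omega>)" by (simp only: frozen_def)
  then show ?thesis using assms(1) by (simp add: indicator_def)
qed

lemma history_setE:
  assumes "B \<in> sets (H t)"
  obtains B' where "B' \<in> sets (PiM {1..t} (\<lambda>_. count_space UNIV \<Otimes>\<^sub>M OS))" "B = obs_record t -` B' \<inter> space P"
  using assms unfolding history_eq sets_vimage_algebra2[OF record_space] by auto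

text \<open>
  For frozen actions, an event of the first \<open>t\<close> observations depends on \<open>X\<^sub>1, \<dots>, X\<^sub>t\<close> only, which are independent of the next signal.
\<close>

lemma frozen_next_observation:
  assumes B: "B \<in> sets (PiM {1..t} (\<lambda>_. count_space UNIV \<Otimes>\<^sub>M OS))" and \<phi>: "\<phi> \<in> borel_measurable OS"
  shows "(\<integral>\<^sup>+\<omega>. frozen t B c \<omega> * \<phi> (obs a (X (Suc t) \<omega>)) \<partial>P)
    = (\<integral>\<^sup>+\<omega>. frozen t B c \<omega> \<partial>P) * (\<integral>\<^sup>+\<omega>. \<phi> (obs a (X (Suc t) \<omega>)) \<partial>P)"
proof -
  note [measurable] = X_measurable
  have ind: "indep_var (PiM {1..t} (\<lambda>_. borel)) (\<lambda>\<omega>. \<lambda>s\<in>{1..t}. X s \<omega>)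
      (PiM {Suc t} (\<lambda>_. borel)) (\<lambda>\<omega>. \<lambda>s\<in>{Suc t}. X s \<omega>)"
    by (rule indep_var_restrict[OF signal_indep]) auto
  define e where "e v = (indicator B (\<lambda>s\<in>{1..t}. (c ! (s - 1), obs (c ! (s - 1)) (v s))) :: ennreal)" for v
  have e_meas: "e \<in> borel_measurable (PiM {1..t} (\<lambda>_. borel))"
    unfolding e_def by (rule measurable_compose[OF frozen_map_measurable borel_measurable_indicator[OF B]])
  have \<phi>_meas: "(\<lambda>u. \<phi> (obs a (u (Suc t)))) \<in> borel_measurable (PiM {Suc t} (\<lambda>_. borel))"
    by (rule measurable_compose[OF measurable_compose[OF measurable_component_singleton[of "Suc t"] obs_measurable] \<phi>]) auto
  have e: "frozen t B c \<omega> = e (\<lambda>s\<in>{1..t}. X s \<omega>)" for \<omega>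
    by (auto simp: frozen_def e_def intro!: arg_cong[where f = "indicator B"])
  have "(\<integral>\<^sup>+\<omega>. frozen t B c \<omega> * \<phi> (obs a (X (Suc t) \<omega>)) \<partial>P)
    = (\<integral>\<^sup>+\<omega>'. \<integral>\<^sup>+\<omega>. frozen t B c \<omega>' * \<phi> (obs a (X (Suc t) \<omega>)) \<partial>P \<partial>P)"
  proof -
    have "(\<integral>\<^sup>+\<omega>. (\<lambda>v u. e v * \<phi> (obs a (u (Suc t)))) (\<lambda>s\<in>{1..t}. X s \<omega>) (\<lambda>s\<in>{Suc t}. X s \<omega>) \<partial>P)
      = (\<integral>\<^sup>+\<omega>'. \<integral>\<^sup>+\<omega>. (\<lambda>v u. e v * \<phi> (obs a (u (Suc t)))) (\<lambda>s\<in>{1..t}. X s \<omega>') (\<lambda>s\<in>{Suc t}. X s \<omega>) \<partial>P \<partial>P)"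
      by (rule nn_integral_indep_pair[OF indep_var_rv1[OF ind] indep_var_rv2[OF ind] indep_varD[OF ind]])
         (assumption, assumption, unfold split_beta', intro borel_measurable_times_ennreal
           measurable_compose[OF measurable_fst e_meas] measurable_compose[OF measurable_snd \<phi>_meas])
    then show ?thesis by (simp only: e restrict_apply singletonI if_True)
  qed
  also have "\<dots> = (\<integral>\<^sup>+\<omega>. frozen t B c \<omega> \<partial>P) * (\<integral>\<^sup>+\<omega>. \<phi> (obs a (X (Suc t) \<omega>)) \<partial>P)"
  proof -
    have "(\<lambda>\<omega>. \<phi> (obs a (X (Suc t) \<omega>))) \<in> borel_measurable P"
      by (rule measurable_compose[OF measurable_compose[OF X_measurable obs_measurable] \<phi>]) auto
    then show ?thesis
      using measurable_\<X>_imp[OF frozen_measurable_\<X>[OF B]] by (simp add: nn_integral_cmult nn_integral_multc)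
  qed
  finally show ?thesis .
qed

definition mean_obs :: "nat \<Rightarrow> ('a \<Rightarrow> 'y \<Rightarrow> ennreal) \<Rightarrow> 'a \<Rightarrow> ennreal" where
  "mean_obs t \<phi> a = (\<integral>\<^sup>+\<omega>. \<phi> a (obs a (X t \<omega>)) \<partial>P)"

lemma observed_measurable:
  assumes "\<And>a. \<phi> a \<in> measurable OS N" "1 \<le> s"
  shows "(\<lambda>\<omega>. \<phi> (A s \<omega>) (Y s \<omega>)) \<in> measurable P N"
  using measurable_from_subalg[OF subalgebra_history observed_measurable_history] assms by blast

lemma countable_fun_measurable: "g \<in> measurable N (count_space UNIV) \<Longrightarrow> (\<lambda>\<omega>. h (g \<omega>) :: ennreal) \<in> borel_measurable N"
  by (rule measurable_compose) auto

text \<open>The observation at time \<open>t + 1\<close> may be averaged out, given the history and the action taken.\<close>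

lemma average_observation:
  assumes \<phi>: "\<And>a. \<phi> a \<in> borel_measurable OS" and G: "G \<in> borel_measurable (H t)"
  shows "(\<integral>\<^sup>+\<omega>. G \<omega> * (\<phi> (A (Suc t) \<omega>) (Y (Suc t) \<omega>) * w (actions (Suc t) \<omega>)) \<partial>P)
    = (\<integral>\<^sup>+\<omega>. G \<omega> * (mean_obs (Suc t) \<phi> (A (Suc t) \<omega>) * w (actions (Suc t) \<omega>)) \<partial>P)"
proof (rule nn_integral_weight_cong[OF subalgebra_history _ _ _ G])
  have A: "A (Suc t) \<in> measurable P (count_space UNIV)" by (rule action_measurable) simp
  show "(\<lambda>\<omega>. \<phi> (A (Suc t) \<omega>) (Y (Suc t) \<omega>) * w (actions (Suc t) \<omega>)) \<in> borel_measurable P"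
    by (intro borel_measurable_times_ennreal observed_measurable \<phi> countable_fun_measurable actions_measurable) simp
  show "(\<lambda>\<omega>. mean_obs (Suc t) \<phi> (A (Suc t) \<omega>) * w (actions (Suc t) \<omega>)) \<in> borel_measurable P"
    by (intro borel_measurable_times_ennreal countable_fun_measurable actions_measurable A)
  fix B assume "B \<in> sets (H t)"
  then obtain B' where B': "B' \<in> sets (PiM {1..t} (\<lambda>_. count_space UNIV \<Otimes>\<^sub>M OS))" "B = obs_record t -` B' \<inter> space P"
    by (rule history_setE)
  note fr = frozen_measurable_\<X>[OF B'(1)]
  have ind: "indicator B \<omega> = frozen t B' (actions (Suc t) \<omega>) \<omega>" if "\<omega> \<in> space P" for \<omega>
    unfolding B'(2) using that by (rule indicator_history_eq_frozen) simp
  have last: "A (Suc t) \<omega> = last (actions (Suc t) \<omega>)" for \<omega> by (simp add: actions_Suc)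
  have obsX: "(\<lambda>\<omega>. \<phi> a (obs a (X (Suc t) \<omega>))) \<in> borel_measurable \<X>" for a
    by (rule measurable_compose[OF measurable_compose[OF component_measurable_\<X> obs_measurable] \<phi>]) simp
  have "(\<integral>\<^sup>+\<omega>. indicator B \<omega> * (\<phi> (A (Suc t) \<omega>) (Y (Suc t) \<omega>) * w (actions (Suc t) \<omega>)) \<partial>P)
      = (\<integral>\<^sup>+\<omega>. (\<lambda>c \<omega>. frozen t B' c \<omega> * \<phi> (last c) (obs (last c) (X (Suc t) \<omega>)) * w c) (actions (Suc t) \<omega>) \<omega> \<partial>P)"
    by (intro nn_integral_cong) (simp add: ind last[symmetric] observation_def mult.assoc)
  also have "\<dots> = (\<integral>\<^sup>+\<omega>'. \<integral>\<^sup>+\<omega>. (\<lambda>c \<omega>. frozen t B' c \<omega> * \<phi> (last c) (obs (last c) (X (Suc t) \<omega>)) * w c)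
        (actions (Suc t) \<omega>') \<omega> \<partial>P \<partial>P)"
    by (rule decouple_actions) (use fr obsX in measurable)
  also have "\<dots> = (\<integral>\<^sup>+\<omega>'. \<integral>\<^sup>+\<omega>. (\<lambda>c \<omega>. frozen t B' c \<omega> * (mean_obs (Suc t) \<phi> (last c) * w c))
        (actions (Suc t) \<omega>') \<omega> \<partial>P \<partial>P)"
  proof (rule nn_integral_cong)
    fix \<omega>'
    let ?c = "actions (Suc t) \<omega>'"
    note frP = measurable_\<X>_imp[OF fr, of ?c] and oP = measurable_\<X>_imp[OF obsX, of "last ?c"]
    have "(\<integral>\<^sup>+\<omega>. frozen t B' ?c \<omega> * \<phi> (last ?c) (obs (last ?c) (X (Suc t) \<omega>)) * w ?c \<partial>P)
        = (\<integral>\<^sup>+\<omega>. frozen t B' ?c \<omega> * \<phi> (last ?c) (obs (last ?c) (X (Suc t) \<omega>)) \<partial>P) * w ?c"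
      by (rule nn_integral_multc) (use frP oP in measurable)
    also have "\<dots> = (\<integral>\<^sup>+\<omega>. frozen t B' ?c \<omega> \<partial>P) * (mean_obs (Suc t) \<phi> (last ?c) * w ?c)"
      by (subst frozen_next_observation[OF B'(1) \<phi>]) (simp add: mean_obs_def mult.assoc)
    also have "\<dots> = (\<integral>\<^sup>+\<omega>. frozen t B' ?c \<omega> * (mean_obs (Suc t) \<phi> (last ?c) * w ?c) \<partial>P)"
      by (rule nn_integral_multc[symmetric]) (rule frP)
    finally show "(\<integral>\<^sup>+\<omega>. (\<lambda>c \<omega>. frozen t B' c \<omega> * \<phi> (last c) (obs (last c) (X (Suc t) \<omega>)) * w c) ?c \<omega> \<partial>P)
      = (\<integral>\<^sup>+\<omega>. (\<lambda>c \<omega>. frozen t B' c \<omega> * (mean_obs (Suc t) \<phi> (last c) * w c)) ?c \<omega> \<partial>P)" .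
  qed
  also have "\<dots> = (\<integral>\<^sup>+\<omega>. (\<lambda>c \<omega>. frozen t B' c \<omega> * (mean_obs (Suc t) \<phi> (last c) * w c)) (actions (Suc t) \<omega>) \<omega> \<partial>P)"
    by (rule decouple_actions[symmetric]) (use fr in measurable)
  also have "\<dots> = (\<integral>\<^sup>+\<omega>. indicator B \<omega> * (mean_obs (Suc t) \<phi> (A (Suc t) \<omega>) * w (actions (Suc t) \<omega>)) \<partial>P)"
    by (intro nn_integral_cong) (simp add: ind last[symmetric])
  finally show "(\<integral>\<^sup>+\<omega>. indicator B \<omega> * (\<phi> (A (Suc t) \<omega>) (Y (Suc t) \<omega>) * w (actions (Suc t) \<omega>)) \<partial>P)
    = (\<integral>\<^sup>+\<omega>. indicator B \<omega> * (mean_obs (Suc t) \<phi> (A (Suc t) \<omega>) * w (actions (Suc t) \<omega>)) \<partial>P)" .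
qed

lemma nn_integral_actions:
  "(\<integral>\<^sup>+\<omega>. g (actions (wlen W + n) \<omega>) \<partial>P) = (\<integral>\<^sup>+as. g as \<partial>measure_pmf (actions_pmf W q T n))"
  unfolding action_law[of n, symmetric] actions_def[symmetric]
  by (rule nn_integral_distr[symmetric]) (auto intro: actions_measurable)

lemma AE_window:
  assumes "set_pmf q \<subseteq> R" "\<And>\<alpha>. \<alpha> \<in> R \<Longrightarrow> set_pmf (T \<alpha>) \<subseteq> R"
  shows "AE \<omega> in P. window (wlen W + n) \<omega> \<in> R"
proof -
  have "set_pmf (window_pmf n) \<subseteq> R"
    by (induction n) (use assms in \<open>force simp: window_pmf_0 window_pmf_Suc\<close>)+
  then have "AE as in measure_pmf (actions_pmf W q T n). drop n as \<in> R"
    by (auto simp: AE_measure_pmf_iff window_pmf_def)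
  then have "AE \<omega> in P. drop n (actions (wlen W + n) \<omega>) \<in> R"
    unfolding action_law[of n, symmetric] actions_def[symmetric]
    by (subst (asm) AE_distr_iff) (auto intro: actions_measurable)
  then show ?thesis by (simp add: window_def)
qed

text \<open>The next window may be averaged out, given the history: it is drawn from the row of the present one.\<close>

lemma average_window:
  assumes G: "G \<in> borel_measurable (H (wlen W + n))"
  shows "(\<integral>\<^sup>+\<omega>. G \<omega> * v (window (Suc (wlen W + n)) \<omega>) \<partial>P)
    = (\<integral>\<^sup>+\<omega>. G \<omega> * (\<integral>\<^sup>+\<beta>. v \<beta> \<partial>measure_pmf (T (window (wlen W + n) \<omega>))) \<partial>P)"
    (is "_ = (\<integral>\<^sup>+\<omega>. G \<omega> * ?Tv (window ?t \<omega>) \<partial>P)")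
proof (rule nn_integral_weight_cong[OF subalgebra_history _ _ _ G])
  have win: "window s \<in> measurable P (count_space UNIV)" for s
    unfolding window_def[abs_def] by (rule measurable_compose[OF actions_measurable]) auto
  show "(\<lambda>\<omega>. v (window (Suc ?t) \<omega>)) \<in> borel_measurable P" "(\<lambda>\<omega>. ?Tv (window ?t \<omega>)) \<in> borel_measurable P"
    by (intro countable_fun_measurable win)+
  fix B assume "B \<in> sets (H ?t)"
  then obtain B' where B': "B' \<in> sets (PiM {1..?t} (\<lambda>_. count_space UNIV \<Otimes>\<^sub>M OS))" "B = obs_record ?t -` B' \<inter> space P"
    by (rule history_setE)
  note fr = frozen_measurable_\<X>[OF B'(1)]
  define g where "g c = (\<integral>\<^sup>+\<omega>. frozen ?t B' c \<omega> \<partial>P)" for c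
  have g: "g (as @ [a]) = g as" if "length as = ?t" for as a
    using that unfolding g_def frozen_def
    by (intro nn_integral_cong arg_cong[where f = "indicator B'"]) (auto simp: restrict_def nth_append fun_eq_iff)
  have decoupled: "(\<integral>\<^sup>+\<omega>. indicator B \<omega> * w (actions t' \<omega>) \<partial>P) = (\<integral>\<^sup>+\<omega>. g (actions t' \<omega>) * w (actions t' \<omega>) \<partial>P)"
    if "?t \<le> t'" for t' w
  proof -
    have "(\<integral>\<^sup>+\<omega>. indicator B \<omega> * w (actions t' \<omega>) \<partial>P)
        = (\<integral>\<^sup>+\<omega>. (\<lambda>c \<omega>. frozen ?t B' c \<omega> * w c) (actions t' \<omega>) \<omega> \<partial>P)"
      by (intro nn_integral_cong) (simp add: B'(2) indicator_history_eq_frozen[OF _ that])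
    also have "\<dots> = (\<integral>\<^sup>+\<omega>'. \<integral>\<^sup>+\<omega>. (\<lambda>c \<omega>. frozen ?t B' c \<omega> * w c) (actions t' \<omega>') \<omega> \<partial>P \<partial>P)"
      by (rule decouple_actions) (use fr in measurable)
    also have "\<dots> = (\<integral>\<^sup>+\<omega>. g (actions t' \<omega>) * w (actions t' \<omega>) \<partial>P)"
      unfolding g_def by (intro nn_integral_cong nn_integral_multc measurable_\<X>_imp fr)
    finally show ?thesis .
  qed
  have "(\<integral>\<^sup>+\<omega>. indicator B \<omega> * v (window (Suc ?t) \<omega>) \<partial>P)
      = (\<integral>\<^sup>+\<omega>. g (actions (Suc ?t) \<omega>) * v (drop (Suc n) (actions (Suc ?t) \<omega>)) \<partial>P)"
    unfolding window_def using decoupled[of "Suc ?t" "\<lambda>c. v (drop (Suc n) c)"] by simp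
  also have "\<dots> = (\<integral>\<^sup>+as. g as * v (drop (Suc n) as) \<partial>measure_pmf (actions_pmf W q T (Suc n)))"
    using nn_integral_actions[of "\<lambda>as. g as * v (drop (Suc n) as)" "Suc n"] by simp
  also have "\<dots> = (\<integral>\<^sup>+as. (\<integral>\<^sup>+\<beta>. g (as @ [last \<beta>]) * v (drop (Suc n) (as @ [last \<beta>]))
        \<partial>measure_pmf (T (drop (length as - wlen W) as))) \<partial>measure_pmf (actions_pmf W q T n))"
    by (simp del: drop_append)
  also have "\<dots> = (\<integral>\<^sup>+as. g as * ?Tv (drop n as) \<partial>measure_pmf (actions_pmf W q T n))"
  proof (rule nn_integral_cong_AE, unfold AE_measure_pmf_iff, rule ballI)
    fix as assume "as \<in> set_pmf (actions_pmf W q T n)"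
    then have len: "length as = ?t" by (rule length_actions)
    have "(\<integral>\<^sup>+\<beta>. g (as @ [last \<beta>]) * v (drop (Suc n) (as @ [last \<beta>])) \<partial>measure_pmf (T (drop n as)))
        = (\<integral>\<^sup>+\<beta>. g as * v \<beta> \<partial>measure_pmf (T (drop n as)))"
      by (rule nn_integral_cong_AE) (use append_transition[OF len] g[OF len] in \<open>simp add: AE_measure_pmf_iff del: drop_append\<close>)
    also have "\<dots> = g as * ?Tv (drop n as)" by (simp add: nn_integral_cmult)
    finally show "(\<integral>\<^sup>+\<beta>. g (as @ [last \<beta>]) * v (drop (Suc n) (as @ [last \<beta>]))
        \<partial>measure_pmf (T (drop (length as - wlen W) as))) = g as * ?Tv (drop n as)" by (simp add: len)
  qed
  also have "\<dots> = (\<integral>\<^sup>+\<omega>. g (actions ?t \<omega>) * ?Tv (drop n (actions ?t \<omega>)) \<partial>P)"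
    by (rule nn_integral_actions[symmetric])
  also have "\<dots> = (\<integral>\<^sup>+\<omega>. indicator B \<omega> * ?Tv (window ?t \<omega>) \<partial>P)"
    unfolding window_def using decoupled[of ?t "\<lambda>c. ?Tv (drop n c)"] by simp
  finally show "(\<integral>\<^sup>+\<omega>. indicator B \<omega> * v (window (Suc ?t) \<omega>) \<partial>P) = (\<integral>\<^sup>+\<omega>. indicator B \<omega> * ?Tv (window ?t \<omega>) \<partial>P)" .
qed

lemma average_step:
  assumes \<phi>: "\<And>a. \<phi> a \<in> borel_measurable OS" and G: "G \<in> borel_measurable (H (wlen W + n))"
  shows "(\<integral>\<^sup>+\<omega>. G \<omega> * (\<phi> (A (Suc (wlen W + n)) \<omega>) (Y (Suc (wlen W + n)) \<omega>) * v (window (Suc (wlen W + n)) \<omega>)) \<partial>P)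
    = (\<integral>\<^sup>+\<omega>. G \<omega> * (\<integral>\<^sup>+\<beta>. mean_obs (Suc (wlen W + n)) \<phi> (last \<beta>) * v \<beta> \<partial>measure_pmf (T (window (wlen W + n) \<omega>))) \<partial>P)"
proof -
  let ?t = "wlen W + n"
  have last: "A (Suc ?t) \<omega> = last (window (Suc ?t) \<omega>)" for \<omega>
    using wlen_pos[of W] by (simp add: window_def actions_Suc)
  show ?thesis
    using average_observation[where \<phi> = \<phi>, OF \<phi> G, where w = "\<lambda>c. v (drop (Suc n) c)"]
      average_window[OF G, where v = "\<lambda>\<beta>. mean_obs (Suc ?t) \<phi> (last \<beta>) * v \<beta>"]
    by (simp add: last[symmetric]) (simp add: window_def)
qed

end

section \<open>The CuSum statistic\<close>

lemma ext_ln_measurable [measurable]: "ext_ln \<in> borel_measurable borel"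
  unfolding ext_ln_def[abs_def] by measurable

lemma emeasure_eq_nn_integral_of_bool:
  assumes [measurable]: "Measurable.pred N Q"
  shows "emeasure N {x\<in>space N. Q x} = (\<integral>\<^sup>+x. of_bool (Q x) \<partial>N)"
proof -
  have "(\<integral>\<^sup>+x. of_bool (Q x) \<partial>N) = (\<integral>\<^sup>+x. indicator {x\<in>space N. Q x} x \<partial>N)"
    by (rule nn_integral_cong) (simp add: indicator_def)
  then show ?thesis by simp
qed

lemma cusum_nonneg: "0 \<le> cusum pc m A Y t \<omega>"
  by (cases t) auto

definition alive ::
  "(nat \<Rightarrow> 'a \<Rightarrow> 'y \<Rightarrow> real) \<Rightarrow> nat \<Rightarrow> (nat \<Rightarrow> 'w \<Rightarrow> 'a) \<Rightarrow> (nat \<Rightarrow> 'w \<Rightarrow> 'y) \<Rightarrow> real \<Rightarrow> nat \<Rightarrow> 'w \<Rightarrow> bool"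
  where "alive pc m A Y c t \<omega> \<longleftrightarrow> (\<forall>s\<in>{1..t}. cusum pc m A Y s \<omega> \<le> ereal c)"

lemma alive_Suc:
  "alive pc m A Y c (Suc t) \<omega> \<longleftrightarrow> alive pc m A Y c t \<omega> \<and> cusum pc m A Y (Suc t) \<omega> \<le> ereal c"
  by (auto simp: alive_def atLeastAtMostSuc_conv simp del: cusum.simps)

lemma alive_mono: "alive pc m A Y c t \<omega> \<Longrightarrow> s \<le> t \<Longrightarrow> alive pc m A Y c s \<omega>"
  by (auto simp: alive_def)

lemma cusum_real:
  assumes "alive pc m A Y c t \<omega>" "0 \<le> c"
  obtains u where "cusum pc m A Y t \<omega> = ereal u" "0 \<le> u" "u \<le> c"
proof -
  have "cusum pc m A Y t \<omega> \<le> ereal c" using assms by (cases t) (simp_all add: alive_Suc del: cusum.simps(2))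
  with cusum_nonneg[of pc m A Y t \<omega>] that show ?thesis
    by (cases "cusum pc m A Y t \<omega>") auto
qed

lemma less_cusum_time_iff:
  "enat t < cusum_time M pc m A Y \<gamma> \<omega> \<longleftrightarrow> alive pc m A Y (ln (real M * \<gamma>)) t \<omega>"
proof -
  let ?S = "{enat s | s. 1 \<le> s \<and> cusum pc m A Y s \<omega> > ereal (ln (real M * \<gamma>))}"
  have "enat t < Inf ?S \<longleftrightarrow> (\<forall>x\<in>?S. enat t < x)"
    using le_Inf_iff[of "enat (Suc t)" ?S] by (simp only: Suc_ile_eq)
  also have "\<dots> \<longleftrightarrow> alive pc m A Y (ln (real M * \<gamma>)) t \<omega>"
  proof -
    have "(\<forall>x\<in>?S. enat t < x)
        \<longleftrightarrow> (\<forall>s. 1 \<le> s \<longrightarrow> ereal (ln (real M * \<gamma>)) < cusum pc m A Y s \<omega> \<longrightarrow> t < s)"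
      by auto
    then show ?thesis unfolding alive_def by (meson atLeastAtMost_iff not_le)
  qed
  finally show ?thesis by (simp add: cusum_time_def)
qed

lemma sum_le_cusum_time:
  "(\<Sum>t<n. of_bool (alive pc m A Y (ln (real M * \<gamma>)) t \<omega>)) \<le> ennreal_of_enat (cusum_time M pc m A Y \<gamma> \<omega>)"
proof (cases "cusum_time M pc m A Y \<gamma> \<omega>")
  case (enat k)
  have "(\<Sum>t<n. of_bool (alive pc m A Y (ln (real M * \<gamma>)) t \<omega>) :: ennreal) = (\<Sum>t<n. of_bool (t < k))"
    by (simp add: less_cusum_time_iff[symmetric] enat)
  also have "\<dots> = of_nat (card {t. t < n \<and> t < k})"
    by (simp add: Collect_conj_eq lessThan_def)
  also have "\<dots> \<le> of_nat k"
    using card_mono[of "{..<k}" "{t. t < n \<and> t < k}"] by (intro of_nat_mono) auto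
  finally show ?thesis by (simp add: enat)
qed simp

lemma cusum_time_le_suminf:
  "ennreal_of_enat (cusum_time M pc m A Y \<gamma> \<omega>)
     \<le> of_nat s + (\<Sum>n. of_bool (alive pc m A Y (ln (real M * \<gamma>)) (s + n) \<omega>))"
proof (cases "cusum_time M pc m A Y \<gamma> \<omega>")
  case (enat k)
  show ?thesis
  proof (cases "k \<le> s")
    case True
    then have "(of_nat k :: ennreal) \<le> of_nat s" by (rule of_nat_mono)
    then show ?thesis by (simp add: enat add_increasing2)
  next
    case False
    then obtain j where j: "k = s + j" by (metis le_iff_add linear)
    have "of_nat j = (\<Sum>n<j. of_bool (alive pc m A Y (ln (real M * \<gamma>)) (s + n) \<omega>) :: ennreal)"
      by (simp add: less_cusum_time_iff[symmetric] enat j)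
    also have "\<dots> \<le> (\<Sum>n. of_bool (alive pc m A Y (ln (real M * \<gamma>)) (s + n) \<omega>))"
      by (rule sum_le_suminf) auto
    finally show ?thesis by (simp add: enat j)
  qed
next
  case infinity
  have "of_nat j \<le> (\<Sum>n. of_bool (alive pc m A Y (ln (real M * \<gamma>)) (s + n) \<omega>) :: ennreal)" for j
  proof -
    have "of_nat j = (\<Sum>n<j. of_bool (alive pc m A Y (ln (real M * \<gamma>)) (s + n) \<omega>) :: ennreal)"
      by (simp add: less_cusum_time_iff[symmetric] infinity)
    also have "\<dots> \<le> (\<Sum>n. of_bool (alive pc m A Y (ln (real M * \<gamma>)) (s + n) \<omega>))"
      by (rule sum_le_suminf) auto
    finally show ?thesis .
  qed
  then have "(\<Sum>n. of_bool (alive pc m A Y (ln (real M * \<gamma>)) (s + n) \<omega>) :: ennreal) = \<infinity>"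
    using ennreal_Ex_less_of_nat by (metis infinity_ennreal_def leD top.not_eq_extremum)
  then show ?thesis by (simp add: infinity)
qed

text \<open>
  Up to and including the time at which CuSum stops, this statistic dominates the exponential of CuSum
  wherever CuSum is positive.
\<close>

primrec shiryaev_roberts ::
  "(nat \<Rightarrow> 'a \<Rightarrow> 'y \<Rightarrow> real) \<Rightarrow> nat \<Rightarrow> (nat \<Rightarrow> 'w \<Rightarrow> 'a) \<Rightarrow> (nat \<Rightarrow> 'w \<Rightarrow> 'y) \<Rightarrow> nat \<Rightarrow> 'w \<Rightarrow> ennreal" where
  "shiryaev_roberts pc m A Y 0 \<omega> = 0"
| "shiryaev_roberts pc m A Y (Suc t) \<omega> = (1 + shiryaev_roberts pc m A Y t \<omega>) *
     (ennreal (pc m (A (Suc t) \<omega>) (Y (Suc t) \<omega>)) / ennreal (pc 0 (A (Suc t) \<omega>) (Y (Suc t) \<omega>)))"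

text \<open>
  One step of the comparison of CuSum with Shiryaev and Roberts' statistic: \<open>u\<close> and \<open>s\<close> are their present
  values and \<open>r\<close> is the next likelihood ratio, which may be \<open>0\<close> or \<open>\<infinity>\<close>.
\<close>

lemma exp_add_ext_ln_le:
  assumes u: "ennreal (exp u) \<le> max 1 s" and x: "ereal x \<le> ereal u + ext_ln r"
  shows "ennreal (exp x) \<le> (1 + s) * r"
proof -
  have le: "max 1 s \<le> 1 + s" by (auto simp: max_def add_increasing2 add_increasing)
  consider "r = 0" | "r = \<infinity>" | "r \<noteq> 0" "r \<noteq> \<infinity>" by auto
  then show ?thesis
  proof cases
    case 1
    then show ?thesis using x by (simp add: ext_ln_def)
  next
    case 2
    then show ?thesis by (simp add: ennreal_mult_top)
  next
    case 3
    define b where "b = enn2real r"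
    have b: "r = ennreal b" "0 < b" using 3 by (auto simp: b_def ennreal_enn2real_if enn2real_positive_iff zero_less_iff_neq_zero less_top)
    then have "x \<le> u + ln b" using x 3 by (simp add: ext_ln_def)
    then have "exp x \<le> exp u * b" using b(2) by (metis exp_add exp_le_cancel_iff exp_ln)
    then have "ennreal (exp x) \<le> ennreal (exp u) * r" unfolding b(1) using b(2)
      by (simp add: ennreal_mult[symmetric] ennreal_leI)
    also have "\<dots> \<le> (1 + s) * r" by (rule mult_right_mono[OF order_trans[OF u le]]) simp
    finally show ?thesis .
  qed
qed

lemma exp_cusum_le_shiryaev_roberts:
  assumes "alive pc m A Y c t \<omega>" "0 \<le> c" "cusum pc m A Y t \<omega> = ereal u"
  shows "ennreal (exp u) \<le> max 1 (shiryaev_roberts pc m A Y t \<omega>)"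
  using assms(1,3)
proof (induction t arbitrary: u)
  case (Suc t)
  have alive: "alive pc m A Y c t \<omega>" using Suc.prems(1) by (simp add: alive_Suc)
  then obtain v where v: "cusum pc m A Y t \<omega> = ereal v" using assms(2) by (rule cusum_real)
  show ?case
  proof (cases "u = 0")
    case False
    then have "ereal u \<le> ereal v + ext_ln (ennreal (pc m (A (Suc t) \<omega>) (Y (Suc t) \<omega>)) / ennreal (pc 0 (A (Suc t) \<omega>) (Y (Suc t) \<omega>)))"
      using Suc.prems(2) v by (auto simp: log_lr_def max_def split: if_splits)
    from exp_add_ext_ln_le[OF Suc.IH[OF alive v] this] show ?thesis by (simp add: le_max_iff_disj)
  qed simp
qed simp

lemma shiryaev_roberts_at_stop:
  assumes alive: "alive pc m A Y c t \<omega>" and c: "0 \<le> c" and stop: "ereal c < cusum pc m A Y (Suc t) \<omega>"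
  shows "ennreal (exp c) \<le> shiryaev_roberts pc m A Y (Suc t) \<omega>"
proof -
  obtain v where v: "cusum pc m A Y t \<omega> = ereal v" using alive c by (rule cusum_real)
  have "ereal c \<le> ereal v + ext_ln (ennreal (pc m (A (Suc t) \<omega>) (Y (Suc t) \<omega>)) / ennreal (pc 0 (A (Suc t) \<omega>) (Y (Suc t) \<omega>)))"
    using stop c v by (auto simp: log_lr_def max_def split: if_splits)
  from exp_add_ext_ln_le[OF exp_cusum_le_shiryaev_roberts[OF alive c v] this] show ?thesis by simp
qed

text \<open>
  CuSum never falls below the sum of log-likelihood ratios since a time \<open>s\<close>; so as long as it has not
  stopped, the product of the tilted ratios stays away from 0. Both degenerate ratios are harmless: the
  tilt is \<open>\<infinity>\<close> where the numerator vanishes, and where only the denominator does CuSum stops.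
\<close>

lemma tilt_product_ge:
  assumes alive: "alive pc m A Y c (s + n) \<omega>" and c: "0 \<le> c" and \<theta>: "0 \<le> \<theta>"
    and nonneg: "\<And>a y. 0 \<le> pc 0 a y" "\<And>a y. 0 \<le> pc m a y"
  shows "ennreal (exp (- \<theta> * c)) \<le> (\<Prod>j<n. tilt \<theta> (pc 0 (A (Suc (s + j)) \<omega>) (Y (Suc (s + j)) \<omega>))
            (pc m (A (Suc (s + j)) \<omega>) (Y (Suc (s + j)) \<omega>)))"
proof -
  let ?t = "\<lambda>j. tilt \<theta> (pc 0 (A (Suc (s + j)) \<omega>) (Y (Suc (s + j)) \<omega>)) (pc m (A (Suc (s + j)) \<omega>) (Y (Suc (s + j)) \<omega>))"
  have main: "\<forall>u. cusum pc m A Y (s + j) \<omega> = ereal u \<longrightarrow> ennreal (exp (- \<theta> * u)) \<le> (\<Prod>i<j. ?t i)" if "j \<le> n" for j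
    using that
  proof (induction j)
    case 0
    then show ?case using \<theta> cusum_nonneg[of pc m A Y s \<omega>] by (auto simp: ennreal_le_1)
  next
    case (Suc j)
    let ?x0 = "pc 0 (A (Suc (s + j)) \<omega>) (Y (Suc (s + j)) \<omega>)" and ?x1 = "pc m (A (Suc (s + j)) \<omega>) (Y (Suc (s + j)) \<omega>)"
    have "alive pc m A Y c (s + j) \<omega>" using Suc.prems by (intro alive_mono[OF alive]) auto
    then obtain v where v: "cusum pc m A Y (s + j) \<omega> = ereal v" using c by (rule cusum_real)
    with Suc have IH: "ennreal (exp (- \<theta> * v)) \<le> (\<Prod>i<j. ?t i)" by auto
    show ?case
    proof (intro allI impI)
      fix u assume "cusum pc m A Y (s + Suc j) \<omega> = ereal u"
      moreover have "ereal v + ext_ln (ennreal ?x1 / ennreal ?x0) \<le> cusum pc m A Y (s + Suc j) \<omega>"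
        by (simp add: v log_lr_def)
      ultimately have le: "ereal v + ext_ln (ennreal ?x1 / ennreal ?x0) \<le> ereal u" by simp
      show "ennreal (exp (- \<theta> * u)) \<le> (\<Prod>i<Suc j. ?t i)"
      proof (cases "?x1 = 0")
        case True
        have "0 < ennreal (exp (- \<theta> * v))" by simp
        from less_le_trans[OF this IH] have "(\<Prod>i<j. ?t i) \<noteq> 0" by (metis less_irrefl)
        then show ?thesis using True by (simp add: tilt_def ennreal_mult_top)
      next
        case False
        then have x1: "0 < ?x1" using nonneg(2) by (simp add: less_le)
        have x0: "0 < ?x0"
        proof (rule ccontr)
          assume "\<not> 0 < ?x0"
          then have "?x0 = 0" using nonneg(1)[of "A (Suc (s + j)) \<omega>" "Y (Suc (s + j)) \<omega>"] by simp
          then have "ext_ln (ennreal ?x1 / ennreal ?x0) = \<infinity>"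
            using x1 by (simp add: ext_ln_def ennreal_divide_zero)
          then show False using le by simp
        qed
        have "ext_ln (ennreal ?x1 / ennreal ?x0) = ereal (ln (?x1 / ?x0))"
          using x0 x1 by (simp add: ext_ln_def divide_ennreal)
        then have "v + ln (?x1 / ?x0) \<le> u" using le by simp
        then have "- \<theta> * u \<le> - \<theta> * v + \<theta> * ln (?x0 / ?x1)"
          using \<theta> x0 x1 mult_left_mono[of "v + ln (?x1 / ?x0)" u \<theta>] by (simp add: ln_div algebra_simps)
        then have "exp (- \<theta> * u) \<le> exp (- \<theta> * v) * (?x0 / ?x1) powr \<theta>"
          using x0 x1 by (simp add: powr_def exp_add[symmetric])
        then have "ennreal (exp (- \<theta> * u)) \<le> ennreal (exp (- \<theta> * v)) * ?t j"
          using False by (simp add: tilt_def ennreal_mult[symmetric] ennreal_leI)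
        also have "\<dots> \<le> (\<Prod>i<j. ?t i) * ?t j" by (rule mult_right_mono[OF IH]) simp
        finally show ?thesis by simp
      qed
    qed
  qed
  obtain u where u: "cusum pc m A Y (s + n) \<omega> = ereal u" "u \<le> c" using alive c by (rule cusum_real)
  have "ennreal (exp (- \<theta> * c)) \<le> ennreal (exp (- \<theta> * u))"
    using u(2) \<theta> by (auto intro!: ennreal_leI mult_left_mono)
  also have "\<dots> \<le> (\<Prod>j<n. ?t j)" using main[of n] u(1) by auto
  finally show ?thesis .
qed

section \<open>Average run length\<close>

context sensing_model
begin

lemma obs_borel: "obs a \<in> measurable borel OS"
proof -
  have "obs a \<in> measurable (density lborel (\<lambda>x. ennreal (p 0 x))) (ref a)"
    using pc_pdf[of 0 a] by (simp add: distributed_def)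
  then show ?thesis by (simp add: measurable_cong_sets[OF refl sets_ref] cong: measurable_cong_sets)
qed

lemma pc_measurable: "k \<le> M \<Longrightarrow> pc k a \<in> borel_measurable OS"
proof -
  assume k: "k \<le> M"
  then have "(\<lambda>y. ennreal (pc k a y)) \<in> borel_measurable (ref a)"
    using pc_pdf[of k a] by (simp add: distributed_def)
  then have "(\<lambda>y. enn2real (ennreal (pc k a y))) \<in> borel_measurable (ref a)" by measurable
  then show ?thesis using k by (simp add: pc_nonneg measurable_cong_sets[OF sets_ref refl])
qed

lemma nn_integral_pc:
  assumes "distributed P lborel U (\<lambda>x. ennreal (p k x))" "k \<le> M" and g: "g \<in> borel_measurable OS"
  shows "(\<integral>\<^sup>+\<omega>. g (obs a (U \<omega>)) \<partial>P) = (\<integral>\<^sup>+y. ennreal (pc k a y) * g y \<partial>ref a)"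
proof -
  have U: "U \<in> borel_measurable P" "distr P lborel U = density lborel (\<lambda>x. ennreal (p k x))"
    using assms(1) by (auto simp: distributed_def)
  have D: "distr (density lborel (\<lambda>x. ennreal (p k x))) (ref a) (obs a) = density (ref a) (\<lambda>y. ennreal (pc k a y))"
    "(\<lambda>y. ennreal (pc k a y)) \<in> borel_measurable (ref a)"
    using pc_pdf[OF assms(2), of a] by (auto simp: distributed_def)
  have g': "g \<in> borel_measurable (ref a)" using g by (simp add: measurable_cong_sets[OF sets_ref refl])
  have o: "obs a \<in> measurable borel (ref a)" using obs_borel by (simp add: measurable_cong_sets[OF refl sets_ref])
  have "(\<integral>\<^sup>+\<omega>. g (obs a (U \<omega>)) \<partial>P) = (\<integral>\<^sup>+x. g (obs a x) \<partial>distr P lborel U)"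
    using U(1) measurable_compose[OF o g'] by (subst nn_integral_distr) auto
  also have "\<dots> = (\<integral>\<^sup>+y. g y \<partial>distr (density lborel (\<lambda>x. ennreal (p k x))) (ref a) (obs a))"
    unfolding U(2) using o g' by (subst nn_integral_distr) auto
  also have "\<dots> = (\<integral>\<^sup>+y. ennreal (pc k a y) * g y \<partial>ref a)"
    unfolding D(1) using D(2) g' by (rule nn_integral_density)
  finally show ?thesis .
qed

lemma nn_integral_pc_1:
  assumes "k \<le> M" shows "(\<integral>\<^sup>+y. ennreal (pc k a y) \<partial>ref a) = 1"
proof -
  interpret D: prob_space "density lborel (\<lambda>x. ennreal (p k x))" using assms by (rule pdf_prob_space)
  have "distributed (density lborel (\<lambda>x. ennreal (p k x))) lborel (\<lambda>x. x) (\<lambda>x. ennreal (p k x))"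
    using pdf_measurable[OF assms] by (auto simp: distributed_def distr_id2)
  from nn_integral_pc[OF this assms, of "\<lambda>_. 1" a] show ?thesis using D.emeasure_space_1 by simp
qed

end

locale cusum_test = sensed_signal P X f A W q T OS obs + sensing_model M p OS ref obs pc
  for P :: "'w measure" and X :: "nat \<Rightarrow> 'w \<Rightarrow> real ^ 'n::finite" and f
    and A :: "nat \<Rightarrow> 'w \<Rightarrow> 'a::finite" and W q T and OS :: "'y measure" and obs and M p ref pc +
  fixes m :: nat
  assumes m: "m \<le> M"
begin

lemma log_lr_measurable: "log_lr pc m a \<in> borel_measurable OS"
proof -
  have [measurable]: "pc m a \<in> borel_measurable OS" "pc 0 a \<in> borel_measurable OS"
    using pc_measurable m by auto
  show ?thesis unfolding log_lr_def[abs_def] by measurable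
qed

lemma cusum_measurable: "t \<le> n \<Longrightarrow> cusum pc m A Y t \<in> borel_measurable (H n)"
proof (induction t)
  case (Suc t)
  then have [measurable]: "cusum pc m A Y t \<in> borel_measurable (H n)" by simp
  have [measurable]: "(\<lambda>\<omega>. log_lr pc m (A (Suc t) \<omega>) (Y (Suc t) \<omega>)) \<in> borel_measurable (H n)"
    using Suc.prems by (intro observed_measurable_history log_lr_measurable) auto
  have "cusum pc m A Y (Suc t) = (\<lambda>\<omega>. max 0 (cusum pc m A Y t \<omega> + log_lr pc m (A (Suc t) \<omega>) (Y (Suc t) \<omega>)))"
    by (simp add: fun_eq_iff)
  then show ?case by simp
next
  case 0
  have "cusum pc m A Y 0 = (\<lambda>_. 0)" by (simp add: fun_eq_iff)
  then show ?case by simp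
qed

lemma alive_measurable: "t \<le> n \<Longrightarrow> Measurable.pred (H n) (alive pc m A Y c t)"
  unfolding alive_def[abs_def]
proof (rule pred_intros_finite)
  fix s assume "t \<le> n" "s \<in> {1..t}"
  then have [measurable]: "cusum pc m A Y s \<in> borel_measurable (H n)" by (intro cusum_measurable) simp
  show "Measurable.pred (H n) (\<lambda>\<omega>. cusum pc m A Y s \<omega> \<le> ereal c)" by measurable
qed simp

lemma lr_measurable: "(\<lambda>y. ennreal (pc m a y) / ennreal (pc 0 a y)) \<in> borel_measurable OS"
proof -
  have [measurable]: "pc m a \<in> borel_measurable OS" "pc 0 a \<in> borel_measurable OS"
    using pc_measurable m by auto
  show ?thesis by measurable
qed

lemma shiryaev_roberts_measurable: "t \<le> n \<Longrightarrow> shiryaev_roberts pc m A Y t \<in> borel_measurable (H n)"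
proof (induction t)
  case (Suc t)
  then have [measurable]: "shiryaev_roberts pc m A Y t \<in> borel_measurable (H n)" by simp
  have [measurable]: "(\<lambda>\<omega>. ennreal (pc m (A (Suc t) \<omega>) (Y (Suc t) \<omega>)) / ennreal (pc 0 (A (Suc t) \<omega>) (Y (Suc t) \<omega>))) \<in> borel_measurable (H n)"
    using Suc.prems
    by (intro observed_measurable_history[of "\<lambda>a y. ennreal (pc m a y) / ennreal (pc 0 a y)"] lr_measurable) auto
  have "shiryaev_roberts pc m A Y (Suc t) = (\<lambda>\<omega>. (1 + shiryaev_roberts pc m A Y t \<omega>) *
     (ennreal (pc m (A (Suc t) \<omega>) (Y (Suc t) \<omega>)) / ennreal (pc 0 (A (Suc t) \<omega>) (Y (Suc t) \<omega>))))"
    by (simp add: fun_eq_iff)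
  then show ?case by simp
next
  case 0
  have "shiryaev_roberts pc m A Y 0 = (\<lambda>_. 0)" by (simp add: fun_eq_iff)
  then show ?case by simp
qed

text \<open>The mean is the mass of \<open>pc m a\<close> where \<open>pc 0 a\<close> is positive, which may be less than 1.\<close>

lemma mean_lr_le_1:
  assumes "1 \<le> t" "f t = p 0"
  shows "mean_obs t (\<lambda>a y. ennreal (pc m a y) / ennreal (pc 0 a y)) a \<le> 1"
proof -
  have "mean_obs t (\<lambda>a y. ennreal (pc m a y) / ennreal (pc 0 a y)) a
      = (\<integral>\<^sup>+y. ennreal (pc 0 a y) * (ennreal (pc m a y) / ennreal (pc 0 a y)) \<partial>ref a)"
    unfolding mean_obs_def using signal_pdf[OF assms(1)] assms(2)
    by (intro nn_integral_pc lr_measurable) auto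
  also have "\<dots> \<le> (\<integral>\<^sup>+y. ennreal (pc m a y) \<partial>ref a)"
  proof (rule nn_integral_mono)
    fix y
    show "ennreal (pc 0 a y) * (ennreal (pc m a y) / ennreal (pc 0 a y)) \<le> ennreal (pc m a y)"
    proof (cases "pc 0 a y = 0")
      case False
      then have "0 < pc 0 a y" using pc_nonneg[of 0 a y] by simp
      then show ?thesis using pc_nonneg[OF m, of a y] by (simp add: divide_ennreal ennreal_mult[symmetric])
    qed simp
  qed
  also have "\<dots> = 1" using m by (rule nn_integral_pc_1)
  finally show ?thesis .
qed

text \<open>Optional stopping: without a change, Shiryaev and Roberts' statistic grows by at most 1 per step in expectation.\<close>

lemma stopped_shiryaev_roberts:
  assumes no_change: "\<And>t. f t = p 0" and c: "0 \<le> c"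
  shows "ennreal (exp c) * emeasure P {\<omega>\<in>space P. \<not> alive pc m A Y c n \<omega>}
      + (\<integral>\<^sup>+\<omega>. shiryaev_roberts pc m A Y n \<omega> * of_bool (alive pc m A Y c n \<omega>) \<partial>P)
    \<le> (\<Sum>t<n. emeasure P {\<omega>\<in>space P. alive pc m A Y c t \<omega>})"
proof (induction n)
  case 0
  show ?case by (simp add: alive_def)
next
  case (Suc n)
  let ?al = "alive pc m A Y c" and ?R = "shiryaev_roberts pc m A Y" and ?b = "ennreal (exp c)"
  let ?lr = "\<lambda>a y. ennreal (pc m a y) / ennreal (pc 0 a y)"
  have alP [measurable]: "Measurable.pred P (?al t)" for t
    using measurable_from_subalg[OF subalgebra_history alive_measurable[OF order_refl]] .
  have RP [measurable]: "?R t \<in> borel_measurable P" for t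
    using measurable_from_subalg[OF subalgebra_history shiryaev_roberts_measurable[OF order_refl]] .
  define G where "G \<omega> = (1 + ?R n \<omega>) * of_bool (?al n \<omega>)" for \<omega>
  have G: "G \<in> borel_measurable (H n)"
  proof -
    have [measurable]: "?R n \<in> borel_measurable (H n)" "Measurable.pred (H n) (?al n)"
      by (auto intro: shiryaev_roberts_measurable alive_measurable)
    show ?thesis unfolding G_def[abs_def] of_bool_def by measurable
  qed
  have split: "?b * of_bool (?al n \<omega> \<and> \<not> ?al (Suc n) \<omega>) + ?R (Suc n) \<omega> * of_bool (?al (Suc n) \<omega>)
      \<le> G \<omega> * ?lr (A (Suc n) \<omega>) (Y (Suc n) \<omega>)" for \<omega>
  proof (cases "?al n \<omega>")
    case True
    show ?thesis
    proof (cases "?al (Suc n) \<omega>")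
      case False
      then have "ereal c < cusum pc m A Y (Suc n) \<omega>" using True by (simp add: alive_Suc not_le del: cusum.simps)
      from shiryaev_roberts_at_stop[OF True c this] show ?thesis using True False by (simp add: G_def)
    qed (simp add: G_def True)
  qed (auto simp: alive_Suc)
  have "?b * emeasure P {\<omega>\<in>space P. ?al n \<omega> \<and> \<not> ?al (Suc n) \<omega>} + (\<integral>\<^sup>+\<omega>. ?R (Suc n) \<omega> * of_bool (?al (Suc n) \<omega>) \<partial>P)
      = (\<integral>\<^sup>+\<omega>. ?b * of_bool (?al n \<omega> \<and> \<not> ?al (Suc n) \<omega>) + ?R (Suc n) \<omega> * of_bool (?al (Suc n) \<omega>) \<partial>P)"
  proof -
    have "emeasure P {\<omega>\<in>space P. ?al n \<omega> \<and> \<not> ?al (Suc n) \<omega>} = (\<integral>\<^sup>+\<omega>. of_bool (?al n \<omega> \<and> \<not> ?al (Suc n) \<omega>) \<partial>P)"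
      by (rule emeasure_eq_nn_integral_of_bool) measurable
    then show ?thesis
      unfolding of_bool_def by (subst nn_integral_add) (simp_all add: nn_integral_cmult del: shiryaev_roberts.simps)
  qed
  also have "\<dots> \<le> (\<integral>\<^sup>+\<omega>. G \<omega> * ?lr (A (Suc n) \<omega>) (Y (Suc n) \<omega>) \<partial>P)"
    by (rule nn_integral_mono) (rule split)
  also have "\<dots> = (\<integral>\<^sup>+\<omega>. G \<omega> * mean_obs (Suc n) ?lr (A (Suc n) \<omega>) \<partial>P)"
    using average_observation[where \<phi> = ?lr, OF lr_measurable G, where w = "\<lambda>_. 1"] by simp
  also have "\<dots> \<le> (\<integral>\<^sup>+\<omega>. G \<omega> \<partial>P)"
  proof (rule nn_integral_mono)
    fix \<omega>
    have "mean_obs (Suc n) ?lr (A (Suc n) \<omega>) \<le> 1" by (rule mean_lr_le_1) (simp_all add: no_change)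
    from mult_left_mono[OF this, of "G \<omega>"]
    show "G \<omega> * mean_obs (Suc n) ?lr (A (Suc n) \<omega>) \<le> G \<omega>" by simp
  qed
  also have "\<dots> = emeasure P {\<omega>\<in>space P. ?al n \<omega>} + (\<integral>\<^sup>+\<omega>. ?R n \<omega> * of_bool (?al n \<omega>) \<partial>P)"
  proof -
    have "emeasure P {\<omega>\<in>space P. ?al n \<omega>} = (\<integral>\<^sup>+\<omega>. of_bool (?al n \<omega>) \<partial>P)"
      by (rule emeasure_eq_nn_integral_of_bool) measurable
    then show ?thesis
      unfolding G_def distrib_right of_bool_def by (subst nn_integral_add) simp_all
  qed
  finally have step: "?b * emeasure P {\<omega>\<in>space P. ?al n \<omega> \<and> \<not> ?al (Suc n) \<omega>}
      + (\<integral>\<^sup>+\<omega>. ?R (Suc n) \<omega> * of_bool (?al (Suc n) \<omega>) \<partial>P)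
    \<le> emeasure P {\<omega>\<in>space P. ?al n \<omega>} + (\<integral>\<^sup>+\<omega>. ?R n \<omega> * of_bool (?al n \<omega>) \<partial>P)" .
  have "{\<omega>\<in>space P. \<not> ?al (Suc n) \<omega>} = {\<omega>\<in>space P. \<not> ?al n \<omega>} \<union> {\<omega>\<in>space P. ?al n \<omega> \<and> \<not> ?al (Suc n) \<omega>}"
    by (auto simp: alive_Suc)
  then have "emeasure P {\<omega>\<in>space P. \<not> ?al (Suc n) \<omega>}
      = emeasure P {\<omega>\<in>space P. \<not> ?al n \<omega>} + emeasure P {\<omega>\<in>space P. ?al n \<omega> \<and> \<not> ?al (Suc n) \<omega>}"
    by (simp, subst plus_emeasure) auto
  then have "?b * emeasure P {\<omega>\<in>space P. \<not> ?al (Suc n) \<omega>} + (\<integral>\<^sup>+\<omega>. ?R (Suc n) \<omega> * of_bool (?al (Suc n) \<omega>) \<partial>P)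
    = ?b * emeasure P {\<omega>\<in>space P. \<not> ?al n \<omega>} + (?b * emeasure P {\<omega>\<in>space P. ?al n \<omega> \<and> \<not> ?al (Suc n) \<omega>}
      + (\<integral>\<^sup>+\<omega>. ?R (Suc n) \<omega> * of_bool (?al (Suc n) \<omega>) \<partial>P))"
    by (simp only: distrib_left add.assoc)
  also have "\<dots> \<le> ?b * emeasure P {\<omega>\<in>space P. \<not> ?al n \<omega>} + (emeasure P {\<omega>\<in>space P. ?al n \<omega>}
      + (\<integral>\<^sup>+\<omega>. ?R n \<omega> * of_bool (?al n \<omega>) \<partial>P))"
    by (rule add_left_mono[OF step])
  also have "\<dots> \<le> (\<Sum>t<n. emeasure P {\<omega>\<in>space P. ?al t \<omega>}) + emeasure P {\<omega>\<in>space P. ?al n \<omega>}"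
    using add_right_mono[OF Suc.IH, of "emeasure P {\<omega>\<in>space P. ?al n \<omega>}"] by (simp only: ac_simps)
  finally show ?case by (simp del: shiryaev_roberts.simps)
qed

text \<open>
  Let \<open>b = M \<gamma>\<close> and let \<open>a n\<close> be the probability that CuSum is running after \<open>n\<close> steps. Optional
  stopping gives \<open>b (1 - a n) \<le> \<Sum>t<n. a t \<le> ARL\<close>, and monotonicity of \<open>a\<close> gives \<open>n (a n) \<le> ARL\<close>, so
  \<open>a n\<close> may be dropped in the limit if the run length has finite mean.
\<close>

lemma ARL_ge:
  assumes no_change: "\<And>t. f t = p 0" and \<gamma>: "0 < \<gamma>" and M: "1 \<le> M"
  shows "ennreal (real M * \<gamma>) \<le> ARL P (cusum_time M pc m A Y \<gamma>)"
proof -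
  define b where "b = real M * \<gamma>"
  have b: "0 < b" using \<gamma> M by (simp add: b_def)
  let ?al = "alive pc m A Y (ln b)"
  have [measurable]: "Measurable.pred P (?al t)" for t
    using measurable_from_subalg[OF subalgebra_history alive_measurable[OF order_refl]] .
  have sum_le: "(\<Sum>t<n. emeasure P {\<omega>\<in>space P. ?al t \<omega>}) \<le> ARL P (cusum_time M pc m A Y \<gamma>)" for n
  proof -
    have "(\<Sum>t<n. emeasure P {\<omega>\<in>space P. ?al t \<omega>}) = (\<Sum>t<n. \<integral>\<^sup>+\<omega>. of_bool (?al t \<omega>) \<partial>P)"
      by (simp add: emeasure_eq_nn_integral_of_bool)
    also have "\<dots> = (\<integral>\<^sup>+\<omega>. (\<Sum>t<n. of_bool (?al t \<omega>)) \<partial>P)"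
      by (subst nn_integral_sum) (auto simp: of_bool_def)
    also have "\<dots> \<le> ARL P (cusum_time M pc m A Y \<gamma>)"
      unfolding ARL_def b_def by (intro nn_integral_mono sum_le_cusum_time)
    finally show ?thesis .
  qed
  show ?thesis
  proof (cases "1 \<le> b")
    case False
    \<comment> \<open>the threshold is negative and CuSum stops at time 1, but a run length of 1 exceeds \<open>b\<close>\<close>
    have "{\<omega> \<in> space P. ?al 0 \<omega>} = space P" by (auto simp: alive_def)
    then have "1 \<le> ARL P (cusum_time M pc m A Y \<gamma>)" using sum_le[of 1] by (simp add: emeasure_space_1)
    moreover have "ennreal b \<le> 1" using False by (simp add: ennreal_le_1)
    ultimately show ?thesis unfolding b_def by (rule order_trans[rotated])
  next
    case True
    then have c: "0 \<le> ln b" by simp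
    show ?thesis
    proof (cases "ARL P (cusum_time M pc m A Y \<gamma>) = \<infinity>")
      case False
      define e where "e = enn2real (ARL P (cusum_time M pc m A Y \<gamma>))"
      have e: "ARL P (cusum_time M pc m A Y \<gamma>) = ennreal e" "0 \<le> e"
        using False by (auto simp: e_def less_top)
      define a where "a t = prob {\<omega>\<in>space P. ?al t \<omega>}" for t
      have a: "emeasure P {\<omega>\<in>space P. ?al t \<omega>} = ennreal (a t)" for t by (simp add: a_def emeasure_eq_measure)
      have neg: "emeasure P {\<omega>\<in>space P. \<not> ?al t \<omega>} = ennreal (1 - a t)" for t
        by (simp add: a_def emeasure_eq_measure prob_neg)
      have sum_e: "(\<Sum>t<n. a t) \<le> e" for n
        using sum_le[of n] e by (simp add: a sum_ennreal a_def)
      have a_dec: "a n \<le> a t" if "t \<le> n" for t n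
        unfolding a_def using that by (intro finite_measure_mono) (auto intro: alive_mono)
      have bound: "b * (1 - a n) \<le> e" for n
      proof -
        have "ennreal (b * (1 - a n)) \<le> ennreal (\<Sum>t<n. a t)"
          using order_trans[OF _ stopped_shiryaev_roberts[OF no_change c, of n], of "ennreal (b * (1 - a n))"] b
          by (simp add: neg a sum_ennreal a_def ennreal_mult)
        moreover have "0 \<le> (\<Sum>t<n. a t)" by (auto simp: a_def intro!: sum_nonneg)
        ultimately show ?thesis using sum_e[of n] by (simp add: ennreal_le_iff)
      qed
      have "b \<le> e + b * e * (1 / real (Suc n))" for n
      proof -
        have "real (Suc n) * a (Suc n) \<le> (\<Sum>t<Suc n. a t)"
          using sum_mono[of "{..<Suc n}" "\<lambda>_. a (Suc n)" a] a_dec by simp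
        then have "a (Suc n) \<le> e * (1 / real (Suc n))"
          using sum_e[of "Suc n"] by (simp add: field_simps del: of_nat_Suc sum.lessThan_Suc)
        then have "b * a (Suc n) \<le> b * (e * (1 / real (Suc n)))" using b by (intro mult_left_mono) auto
        then show ?thesis using bound[of "Suc n"] by (simp add: algebra_simps)
      qed
      moreover have "(\<lambda>n. e + b * e * (1 / real (Suc n))) \<longlonglongrightarrow> e + b * e * 0"
        by (intro tendsto_intros LIMSEQ_Suc[OF lim_1_over_n])
      ultimately have "b \<le> e" using LIMSEQ_le_const[of _ "e + b * e * 0" b] by auto
      then show ?thesis using e by (simp add: b_def ennreal_leI)
    qed simp
  qed
qed

end

section \<open>Worst-case average detection delay\<close>

text \<open>
  The event that the conditional expectation exceeds \<open>K\<close> belongs to \<open>F\<close>, and the inequality for this event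
  makes it a null set. Where \<open>g\<close> is not measurable the conditional expectation is 0 by convention.
\<close>

lemma esssup_nn_cond_exp_le:
  assumes "prob_space P" and sub: "subalgebra P F"
    and le: "\<And>B. B \<in> sets F \<Longrightarrow> (\<integral>\<^sup>+\<omega>. indicator B \<omega> * g \<omega> \<partial>P) \<le> ennreal K * emeasure P B"
  shows "esssup P (nn_cond_exp P F g) \<le> ennreal K"
proof (rule esssup_I)
  interpret prob_space P by fact
  interpret finite_measure_subalgebra P F
    using sub by unfold_locales
  show "nn_cond_exp P F g \<in> borel_measurable P" by (rule borel_measurable_nn_cond_exp2)
  show "AE \<omega> in P. nn_cond_exp P F g \<omega> \<le> ennreal K"
  proof (cases "g \<in> borel_measurable P")
    case [measurable]: True
    let ?g = "nn_cond_exp P F g"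
    have [measurable]: "?g \<in> borel_measurable F" "?g \<in> borel_measurable P" by simp_all
    define B where "B = {\<omega> \<in> space F. ennreal K < ?g \<omega>}"
    have BF [measurable]: "B \<in> sets F" unfolding B_def by measurable
    then have BP [measurable]: "B \<in> sets P" using sub by (auto simp: subalgebra_def)
    have eq: "indicator B \<omega> * ?g \<omega> = ennreal K * indicator B \<omega> + indicator B \<omega> * (?g \<omega> - ennreal K)" for \<omega>
      by (auto simp: B_def indicator_def less_imp_le add_diff_inverse_ennreal)
    have "(\<integral>\<^sup>+\<omega>. indicator B \<omega> * ?g \<omega> \<partial>P)
        = ennreal K * emeasure P B + (\<integral>\<^sup>+\<omega>. indicator B \<omega> * (?g \<omega> - ennreal K) \<partial>P)"
      unfolding eq by (subst nn_integral_add) (simp_all add: nn_integral_cmult)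
    moreover have "(\<integral>\<^sup>+\<omega>. indicator B \<omega> * ?g \<omega> \<partial>P) = (\<integral>\<^sup>+\<omega>. indicator B \<omega> * g \<omega> \<partial>P)"
      by (rule nn_cond_exp_intg) measurable
    ultimately have "ennreal K * emeasure P B + (\<integral>\<^sup>+\<omega>. indicator B \<omega> * (?g \<omega> - ennreal K) \<partial>P)
        \<le> ennreal K * emeasure P B + 0" using le[OF BF] by simp
    moreover have "ennreal K * emeasure P B \<noteq> \<infinity>" by (simp add: ennreal_mult_eq_top_iff)
    ultimately have "(\<integral>\<^sup>+\<omega>. indicator B \<omega> * (?g \<omega> - ennreal K) \<partial>P) = 0"
      using ennreal_add_left_cancel_le by fastforce
    then have "AE \<omega> in P. indicator B \<omega> * (?g \<omega> - ennreal K) = 0"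
      by (subst (asm) nn_integral_0_iff_AE) measurable
    moreover have "AE \<omega> in P. \<omega> \<in> space F" using sub by (simp add: subalgebra_def)
    ultimately show ?thesis
      by eventually_elim (auto simp: B_def indicator_def diff_eq_0_iff_ennreal not_less split: if_splits)
  qed (simp add: nn_cond_exp_def)
qed

text \<open>
  The constants of the Chernoff bound: for any \<open>\<delta>\<close> below the information rate some exponent \<open>\<theta>\<close> and
  some function \<open>h\<close> of the window make the tilted likelihood ratios, corrected by \<open>exp (\<theta> h)\<close>,
  decay at the rate \<open>exp (- \<theta> \<delta>)\<close> per step.
\<close>

lemma (in policy) tilting_constants:
  fixes pc :: "nat \<Rightarrow> 'a \<Rightarrow> 'y \<Rightarrow> real" and p :: "nat \<Rightarrow> real ^ 'n::finite \<Rightarrow> real"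
  assumes "sensing_model M p OS ref obs pc" and m: "m \<le> M"
    and R: "R \<subseteq> windows W" "\<And>\<alpha>. \<alpha> \<in> R \<Longrightarrow> set_pmf (T \<alpha>) \<subseteq> R"
    and Poisson: "\<And>f e. 0 < e \<Longrightarrow> \<exists>h. \<forall>\<alpha>\<in>R.
       (\<Sum>\<beta>\<in>windows W. f \<beta> * qbar W q T \<beta>) - e
         \<le> (\<Sum>\<beta>\<in>windows W. pmf (T \<alpha>) \<beta> * f \<beta>) + h \<alpha> - (\<Sum>\<beta>\<in>windows W. pmf (T \<alpha>) \<beta> * h \<beta>)"
    and fin: "info_rate ref pc m W q T < \<infinity>" and \<delta>: "\<delta> < enn2real (info_rate ref pc m W q T)"
  shows "\<exists>\<theta> h. 0 < \<theta> \<and> \<theta> \<le> 1 \<and> (\<forall>\<alpha>\<in>R.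
    (\<integral>\<^sup>+\<beta>. affinity (ref (last \<beta>)) (pc 0 (last \<beta>)) (pc m (last \<beta>)) \<theta> * ennreal (exp (\<theta> * h \<beta>)) \<partial>measure_pmf (T \<alpha>))
      \<le> ennreal (exp (- (\<theta> * \<delta>))) * ennreal (exp (\<theta> * h \<alpha>)))"
proof -
  interpret sensing_model M p OS ref obs pc by fact
  define kl where "kl \<beta> = kl_div (density (ref (last \<beta>)) (\<lambda>y. ennreal (pc m (last \<beta>) y)))
               (density (ref (last \<beta>)) (\<lambda>y. ennreal (pc 0 (last \<beta>) y)))" for \<beta>
  \<comment> \<open>windows with infinite divergence have \<open>qbar\<close> 0, so they may count as uninformative; their affinity is at most 1\<close>
  define f where "f \<beta> = (if kl \<beta> < \<infinity> then enn2real (kl \<beta>) else 0)" for \<beta>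
  define I where "I = enn2real (info_rate ref pc m W q T)"
  define aff where "aff \<theta> \<beta> = affinity (ref (last \<beta>)) (pc 0 (last \<beta>)) (pc m (last \<beta>)) \<theta>" for \<theta> \<beta>
  have weight: "ennreal (qbar W q T \<beta>) * kl \<beta> = ennreal (f \<beta> * qbar W q T \<beta>)" if \<beta>: "\<beta> \<in> windows W" for \<beta>
  proof (cases "kl \<beta> < \<infinity>")
    case True
    then show ?thesis using qbar_nonneg[OF \<beta>] by (simp add: f_def ennreal_mult ennreal_enn2real mult.commute)
  next
    case False
    have "ennreal (qbar W q T \<beta>) * kl \<beta> \<le> info_rate ref pc m W q T"
      unfolding info_rate_def kl_def[symmetric] using \<beta> finite_windows by (intro member_le_sum) auto
    then have "ennreal (qbar W q T \<beta>) * kl \<beta> < \<infinity>" using fin by (rule le_less_trans)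
    then have "qbar W q T \<beta> = 0" using False qbar_nonneg[OF \<beta>]
      by (auto simp: ennreal_mult_less_top not_less top_unique ennreal_eq_0_iff)
    then show ?thesis by simp
  qed
  have f_nonneg: "0 \<le> f \<beta>" for \<beta> by (simp add: f_def)
  have "info_rate ref pc m W q T = ennreal (\<Sum>\<beta>\<in>windows W. f \<beta> * qbar W q T \<beta>)"
    unfolding info_rate_def kl_def[symmetric]
    using qbar_nonneg f_nonneg by (simp add: weight sum_ennreal)
  then have I: "I = (\<Sum>\<beta>\<in>windows W. f \<beta> * qbar W q T \<beta>)"
    using qbar_nonneg f_nonneg by (simp add: I_def sum_nonneg)
  define e where "e = (I - \<delta>) / 2"
  have e: "0 < e" "\<delta> < I - e" using \<delta> by (auto simp: e_def I_def field_simps)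
  obtain h where h: "\<forall>\<alpha>\<in>R. I - e \<le> step f \<alpha> + h \<alpha> - step h \<alpha>"
    using Poisson[OF e(1), of f] unfolding I step_def by blast
  define \<rho> where "\<rho> k \<beta> = (if kl \<beta> < \<infinity> then enn2real (aff (1 / real (Suc k)) \<beta>) else 1)" for k \<beta>
  have [measurable]: "pc k a \<in> borel_measurable (ref a)" if "k \<le> M" for k a
    using pc_measurable[OF that] by (simp add: measurable_cong_sets[OF sets_ref refl])
  have "(\<lambda>k. (1 - \<rho> k \<beta>) / (1 / real (Suc k))) \<longlonglongrightarrow> f \<beta>" for \<beta>
  proof (cases "kl \<beta> < \<infinity>")
    case True
    have "(\<lambda>k. (1 - enn2real (aff (1 / real (Suc k)) \<beta>)) / (1 / real (Suc k))) \<longlonglongrightarrow> enn2real (kl \<beta>)"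
      unfolding aff_def kl_def
      by (rule affinity_derivative[OF sigma_finite_ref])
         (use m True in \<open>auto simp: pc_nonneg nn_integral_pc_1 kl_def\<close>)
    then show ?thesis using True by (simp add: \<rho>_def f_def)
  qed (simp add: \<rho>_def f_def)
  from exponential_drift[OF R(1) h e(2) this] obtain k where
    k: "\<forall>\<alpha>\<in>R. (\<Sum>\<beta>\<in>windows W. pmf (T \<alpha>) \<beta> * (\<rho> k \<beta> * exp (1 / real (Suc k) * h \<beta>)))
            \<le> exp (- (1 / real (Suc k) * \<delta>)) * exp (1 / real (Suc k) * h \<alpha>)" by blast
  define \<theta> where "\<theta> = 1 / real (Suc k)"
  have \<theta>: "0 < \<theta>" "\<theta> \<le> 1" by (auto simp: \<theta>_def)
  have aff_1: "aff \<theta> \<beta> \<le> 1" for \<beta>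
    unfolding aff_def using m \<theta> by (intro affinity_le_1) (auto simp: pc_nonneg nn_integral_pc_1)
  have aff_\<rho>: "aff \<theta> \<beta> \<le> ennreal (\<rho> k \<beta>)" for \<beta>
  proof -
    have "\<rho> k \<beta> = (if kl \<beta> < \<infinity> then enn2real (aff \<theta> \<beta>) else 1)" by (simp add: \<rho>_def \<theta>_def)
    moreover have "aff \<theta> \<beta> < \<top>" using aff_1[of \<beta>] by (rule le_less_trans) simp
    ultimately show ?thesis using aff_1[of \<beta>] by simp
  qed
  have \<rho>_nonneg: "0 \<le> \<rho> k \<beta>" for \<beta> by (simp add: \<rho>_def)
  have "(\<integral>\<^sup>+\<beta>. aff \<theta> \<beta> * ennreal (exp (\<theta> * h \<beta>)) \<partial>measure_pmf (T \<alpha>))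
      \<le> ennreal (exp (- (\<theta> * \<delta>))) * ennreal (exp (\<theta> * h \<alpha>))" if \<alpha>: "\<alpha> \<in> R" for \<alpha>
  proof -
    have "(\<integral>\<^sup>+\<beta>. aff \<theta> \<beta> * ennreal (exp (\<theta> * h \<beta>)) \<partial>measure_pmf (T \<alpha>))
        \<le> (\<integral>\<^sup>+\<beta>. ennreal (\<rho> k \<beta> * exp (\<theta> * h \<beta>)) \<partial>measure_pmf (T \<alpha>))"
      using \<rho>_nonneg by (intro nn_integral_mono) (auto simp: ennreal_mult intro!: mult_right_mono aff_\<rho>)
    also have "\<dots> = (\<Sum>\<beta>\<in>windows W. ennreal (\<rho> k \<beta> * exp (\<theta> * h \<beta>)) * ennreal (pmf (T \<alpha>) \<beta>))"
      by (intro nn_integral_measure_pmf_support finite_windows) (use R(2)[OF \<alpha>] R(1) in auto)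
    also have "\<dots> = ennreal (\<Sum>\<beta>\<in>windows W. pmf (T \<alpha>) \<beta> * (\<rho> k \<beta> * exp (\<theta> * h \<beta>)))"
      using \<rho>_nonneg by (simp add: sum_ennreal ennreal_mult[symmetric] mult.commute)
    also have "\<dots> \<le> ennreal (exp (- (\<theta> * \<delta>)) * exp (\<theta> * h \<alpha>))"
      using k \<alpha> unfolding \<theta>_def by (intro ennreal_leI) blast
    finally show ?thesis by (simp add: ennreal_mult)
  qed
  then show ?thesis using \<theta> unfolding aff_def by blast
qed

lemma sum_truncated_geometric:
  fixes \<epsilon> C :: real
  assumes "\<epsilon> \<noteq> 1"
  shows "(\<Sum>n<l. if n < N then 1 else C * \<epsilon> ^ (n - N)) = real (min l N) + C * (1 - \<epsilon> ^ (l - N)) / (1 - \<epsilon>)"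
proof (induction l)
  case (Suc l)
  show ?case
  proof (cases "l < N")
    case False
    then have "Suc l - N = Suc (l - N)" by (simp add: Suc_diff_le)
    then show ?thesis using Suc False assms by (simp add: field_simps)
  qed (use Suc in simp)
qed simp

context cusum_test
begin

abbreviation tilt_at :: "real \<Rightarrow> nat \<Rightarrow> 'w \<Rightarrow> ennreal" where
  "tilt_at \<theta> t \<omega> \<equiv> tilt \<theta> (pc 0 (A t \<omega>) (Y t \<omega>)) (pc m (A t \<omega>) (Y t \<omega>))"

lemma tilt_obs_measurable: "(\<lambda>y. tilt \<theta> (pc 0 a y) (pc m a y)) \<in> borel_measurable OS"
  using pc_measurable m by (intro tilt_measurable) auto

lemma tilt_at_measurable: "1 \<le> t \<Longrightarrow> t \<le> n \<Longrightarrow> tilt_at \<theta> t \<in> borel_measurable (H n)"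
  by (rule observed_measurable_history[of "\<lambda>a y. tilt \<theta> (pc 0 a y) (pc m a y)"]) (rule tilt_obs_measurable)

lemma mean_tilt:
  assumes "1 \<le> t" "f t = p m"
  shows "mean_obs t (\<lambda>a y. tilt \<theta> (pc 0 a y) (pc m a y)) a = affinity (ref a) (pc 0 a) (pc m a) \<theta>"
  unfolding mean_obs_def affinity_def using signal_pdf[OF assms(1)] assms(2) m
  by (intro nn_integral_pc tilt_obs_measurable) auto

text \<open>
  The inequality \<open>drift\<close> makes the tilted product, corrected by \<open>v\<close> at the present window and divided by
  \<open>\<epsilon> ^ n\<close>, a supermartingale given the history at the time where the product starts.
\<close>

lemma tilted_supermartingale:
  assumes post: "\<And>t. wlen W + n0 < t \<Longrightarrow> f t = p m"
    and R: "set_pmf q \<subseteq> R" "\<And>\<alpha>. \<alpha> \<in> R \<Longrightarrow> set_pmf (T \<alpha>) \<subseteq> R"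
    and drift: "\<And>\<alpha>. \<alpha> \<in> R \<Longrightarrow>
      (\<integral>\<^sup>+\<beta>. affinity (ref (last \<beta>)) (pc 0 (last \<beta>)) (pc m (last \<beta>)) \<theta> * v \<beta> \<partial>measure_pmf (T \<alpha>)) \<le> \<epsilon> * v \<alpha>"
    and B: "B \<in> sets (H (wlen W + n0))"
  shows "(\<integral>\<^sup>+\<omega>. indicator B \<omega> * (\<Prod>j<n. tilt_at \<theta> (Suc (wlen W + n0 + j)) \<omega>) * v (window (wlen W + n0 + n) \<omega>) \<partial>P)
    \<le> \<epsilon> ^ n * (\<integral>\<^sup>+\<omega>. indicator B \<omega> * v (window (wlen W + n0) \<omega>) \<partial>P)"
proof (induction n)
  case (Suc n)
  let ?s = "wlen W + n0"
  define Z where "Z \<omega> = indicator B \<omega> * (\<Prod>j<n. tilt_at \<theta> (Suc (?s + j)) \<omega>)" for \<omega>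
  have t: "wlen W + (n0 + n) = ?s + n" by simp
  have [measurable]: "B \<in> sets (H (?s + n))"
    using subalgebra_history_mono[of ?s "?s + n"] B by (auto simp: subalgebra_def)
  have "Z \<in> borel_measurable (H (?s + n))"
    unfolding Z_def
    by (intro borel_measurable_times_ennreal borel_measurable_indicator borel_measurable_prod_ennreal tilt_at_measurable) auto
  note avg = average_step[of "\<lambda>a y. tilt \<theta> (pc 0 a y) (pc m a y)" Z "n0 + n" v, unfolded t, OF tilt_obs_measurable this]
  have "(\<integral>\<^sup>+\<omega>. indicator B \<omega> * (\<Prod>j<Suc n. tilt_at \<theta> (Suc (?s + j)) \<omega>) * v (window (?s + Suc n) \<omega>) \<partial>P)
      = (\<integral>\<^sup>+\<omega>. Z \<omega> * (tilt_at \<theta> (Suc (?s + n)) \<omega> * v (window (Suc (?s + n)) \<omega>)) \<partial>P)"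
    by (intro nn_integral_cong) (simp add: Z_def mult.assoc)
  also have "\<dots> = (\<integral>\<^sup>+\<omega>. Z \<omega> * (\<integral>\<^sup>+\<beta>. affinity (ref (last \<beta>)) (pc 0 (last \<beta>)) (pc m (last \<beta>)) \<theta> * v \<beta>
        \<partial>measure_pmf (T (window (?s + n) \<omega>))) \<partial>P)"
    unfolding avg by (subst mean_tilt) (auto simp: post)
  also have "\<dots> \<le> (\<integral>\<^sup>+\<omega>. \<epsilon> * (Z \<omega> * v (window (?s + n) \<omega>)) \<partial>P)"
  proof (rule nn_integral_mono_AE)
    show "AE \<omega> in P. Z \<omega> * (\<integral>\<^sup>+\<beta>. affinity (ref (last \<beta>)) (pc 0 (last \<beta>)) (pc m (last \<beta>)) \<theta> * v \<beta>
        \<partial>measure_pmf (T (window (?s + n) \<omega>))) \<le> \<epsilon> * (Z \<omega> * v (window (?s + n) \<omega>))"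
    proof -
      have "AE \<omega> in P. window (wlen W + (n0 + n)) \<omega> \<in> R" by (rule AE_window) (use R in auto)
      then show ?thesis unfolding t
      proof eventually_elim
        case (elim \<omega>)
        from mult_left_mono[OF drift[OF this], of "Z \<omega>"] show ?case by (simp add: ac_simps)
      qed
    qed
  qed
  also have "\<dots> = \<epsilon> * (\<integral>\<^sup>+\<omega>. Z \<omega> * v (window (?s + n) \<omega>) \<partial>P)"
  proof (rule nn_integral_cmult)
    have Z: "Z \<in> borel_measurable P" and win: "window (?s + n) \<in> measurable P (count_space UNIV)"
      using \<open>Z \<in> borel_measurable (H (?s + n))\<close> window_measurable_history[OF order_refl]
      by (auto intro: measurable_from_subalg[OF subalgebra_history])
    show "(\<lambda>\<omega>. Z \<omega> * v (window (?s + n) \<omega>)) \<in> borel_measurable P"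
      by (rule borel_measurable_times_ennreal[OF Z countable_fun_measurable[OF win]])
  qed
  also have "\<dots> \<le> \<epsilon> * (\<epsilon> ^ n * (\<integral>\<^sup>+\<omega>. indicator B \<omega> * v (window ?s \<omega>) \<partial>P))"
    using Suc.IH unfolding Z_def by (rule mult_left_mono) simp
  finally show ?case by (simp add: mult.assoc)
qed simp

text \<open>
  Chernoff's bound: while CuSum is running the tilted product is at least \<open>exp (- \<theta> c)\<close>, and replacing
  the correction \<open>exp (\<theta> h)\<close> by constants costs the factor \<open>exp (2 \<theta> b)\<close>.
\<close>

lemma alive_tail:
  assumes post: "\<And>t. wlen W + n0 < t \<Longrightarrow> f t = p m"
    and R: "R \<subseteq> windows W" "set_pmf q \<subseteq> R" "\<And>\<alpha>. \<alpha> \<in> R \<Longrightarrow> set_pmf (T \<alpha>) \<subseteq> R"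
    and \<theta>: "0 < \<theta>" and c: "0 \<le> c"
    and drift: "\<And>\<alpha>. \<alpha> \<in> R \<Longrightarrow>
      (\<integral>\<^sup>+\<beta>. affinity (ref (last \<beta>)) (pc 0 (last \<beta>)) (pc m (last \<beta>)) \<theta> * ennreal (exp (\<theta> * h \<beta>)) \<partial>measure_pmf (T \<alpha>))
        \<le> ennreal (exp (- (\<theta> * \<delta>))) * ennreal (exp (\<theta> * h \<alpha>))"
    and h: "\<And>\<alpha>. \<alpha> \<in> windows W \<Longrightarrow> \<bar>h \<alpha>\<bar> \<le> b"
    and B: "B \<in> sets (H (wlen W + n0))"
  shows "(\<integral>\<^sup>+\<omega>. indicator B \<omega> * of_bool (alive pc m A Y c (wlen W + n0 + n) \<omega>) \<partial>P)
    \<le> ennreal (exp (2 * \<theta> * b) * exp (\<theta> * (c - real n * \<delta>))) * emeasure P B"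
proof -
  let ?s = "wlen W + n0"
  let ?Z = "\<lambda>\<omega>. indicator B \<omega> * (\<Prod>j<n. tilt_at \<theta> (Suc (?s + j)) \<omega>)"
  have BP: "B \<in> sets P" using subalgebra_history[of ?s] B by (auto simp: subalgebra_def)
  have win: "window (?s + k) \<omega> \<in> windows W" for k \<omega>
    by (simp add: window_def windows_def)
  have "(\<integral>\<^sup>+\<omega>. indicator B \<omega> * of_bool (alive pc m A Y c (?s + n) \<omega>) \<partial>P)
      \<le> (\<integral>\<^sup>+\<omega>. ennreal (exp (\<theta> * c) * exp (\<theta> * b)) * (?Z \<omega> * ennreal (exp (\<theta> * h (window (?s + n) \<omega>)))) \<partial>P)"
  proof (rule nn_integral_mono)
    fix \<omega>
    show "indicator B \<omega> * of_bool (alive pc m A Y c (?s + n) \<omega>)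
      \<le> ennreal (exp (\<theta> * c) * exp (\<theta> * b)) * (?Z \<omega> * ennreal (exp (\<theta> * h (window (?s + n) \<omega>))))"
    proof (cases "\<omega> \<in> B \<and> alive pc m A Y c (?s + n) \<omega>")
      case True
      have "- b \<le> h (window (?s + n) \<omega>)" using h[OF win] by (simp add: abs_le_iff minus_le_iff)
      then have hb: "exp (\<theta> * (- b)) \<le> exp (\<theta> * h (window (?s + n) \<omega>))"
        using \<theta> mult_left_mono[of "- b" _ \<theta>] by simp
      have "(1 :: ennreal) = ennreal (exp (\<theta> * c) * exp (\<theta> * b)) * (ennreal (exp (- \<theta> * c)) * ennreal (exp (\<theta> * (- b))))"
        by (simp add: ennreal_mult[symmetric] exp_add[symmetric])
      also have "\<dots> \<le> ennreal (exp (\<theta> * c) * exp (\<theta> * b)) *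
          ((\<Prod>j<n. tilt_at \<theta> (Suc (?s + j)) \<omega>) * ennreal (exp (\<theta> * h (window (?s + n) \<omega>))))"
        using tilt_product_ge[of pc m A Y c ?s n \<omega> \<theta>] True c \<theta> m
        by (intro mult_left_mono mult_mono ennreal_leI hb) (auto simp: pc_nonneg)
      finally show ?thesis using True by simp
    qed auto
  qed
  also have "\<dots> = ennreal (exp (\<theta> * c) * exp (\<theta> * b)) * (\<integral>\<^sup>+\<omega>. ?Z \<omega> * ennreal (exp (\<theta> * h (window (?s + n) \<omega>))) \<partial>P)"
  proof (rule nn_integral_cmult)
    have tilts: "tilt_at \<theta> (Suc (?s + j)) \<in> borel_measurable P"
      and wins: "window (?s + n) \<in> measurable P (count_space UNIV)" for j
      using tilt_at_measurable[of "Suc (?s + j)" "Suc (?s + j)"] window_measurable_history[OF order_refl]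
      by (auto intro: measurable_from_subalg[OF subalgebra_history])
    show "(\<lambda>\<omega>. ?Z \<omega> * ennreal (exp (\<theta> * h (window (?s + n) \<omega>)))) \<in> borel_measurable P"
      by (intro borel_measurable_times_ennreal borel_measurable_indicator BP borel_measurable_prod_ennreal
          tilts countable_fun_measurable[OF wins])
  qed
  also have "\<dots> \<le> ennreal (exp (\<theta> * c) * exp (\<theta> * b)) *
      (ennreal (exp (- (\<theta> * \<delta>))) ^ n * (\<integral>\<^sup>+\<omega>. indicator B \<omega> * ennreal (exp (\<theta> * h (window ?s \<omega>))) \<partial>P))"
    by (rule mult_left_mono[OF tilted_supermartingale[OF post R(2,3) drift B]]) auto
  also have "\<dots> \<le> ennreal (exp (\<theta> * c) * exp (\<theta> * b)) *
      (ennreal (exp (- (\<theta> * \<delta>))) ^ n * (ennreal (exp (\<theta> * b)) * emeasure P B))"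
  proof -
    have "(\<integral>\<^sup>+\<omega>. indicator B \<omega> * ennreal (exp (\<theta> * h (window ?s \<omega>))) \<partial>P)
        \<le> (\<integral>\<^sup>+\<omega>. ennreal (exp (\<theta> * b)) * indicator B \<omega> \<partial>P)"
    proof (rule nn_integral_mono)
      fix \<omega>
      have "h (window ?s \<omega>) \<le> b" using h[OF win[of 0]] by (simp add: abs_le_iff)
      then have "ennreal (exp (\<theta> * h (window ?s \<omega>))) \<le> ennreal (exp (\<theta> * b))"
        using \<theta> by (intro ennreal_leI) simp
      then show "indicator B \<omega> * ennreal (exp (\<theta> * h (window ?s \<omega>))) \<le> ennreal (exp (\<theta> * b)) * indicator B \<omega>"
        by (simp add: indicator_def)
    qed
    also have "\<dots> = ennreal (exp (\<theta> * b)) * emeasure P B" using BP by (simp add: nn_integral_cmult)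
    finally show ?thesis by (intro mult_left_mono) auto
  qed
  also have "\<dots> = ennreal (exp (2 * \<theta> * b) * exp (\<theta> * (c - real n * \<delta>))) * emeasure P B"
  proof -
    have "exp (\<theta> * c) * exp (\<theta> * b) * (exp (- (\<theta> * \<delta>)) ^ n * exp (\<theta> * b))
        = exp (2 * \<theta> * b) * exp (\<theta> * (c - real n * \<delta>))"
      by (simp add: exp_of_nat_mult[symmetric] exp_add[symmetric] algebra_simps)
    then show ?thesis by (simp add: ennreal_power ennreal_mult[symmetric] mult.assoc[symmetric])
  qed
  finally show ?thesis .
qed

text \<open>
  Counting starts at \<open>s\<close>, the larger of \<open>\<nu> - 1\<close> and \<open>wlen W\<close>, when the first window is complete; this costs
  at most \<open>wlen W\<close> steps and keeps the conditioning event in the history. The probabilities to be still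
  running after \<open>s + n\<close> steps are bounded by 1 for the first \<open>N\<close> (about \<open>c / \<delta>\<close>) values of \<open>n\<close> and by a
  geometric sequence afterwards.
\<close>

lemma conditional_delay_le:
  assumes \<nu>: "1 \<le> \<nu>" and post: "\<And>t. \<nu> \<le> t \<Longrightarrow> f t = p m"
    and R: "R \<subseteq> windows W" "set_pmf q \<subseteq> R" "\<And>\<alpha>. \<alpha> \<in> R \<Longrightarrow> set_pmf (T \<alpha>) \<subseteq> R"
    and \<theta>: "0 < \<theta>" and \<delta>: "0 < \<delta>" and c: "0 \<le> ln (real M * \<gamma>)"
    and drift: "\<And>\<alpha>. \<alpha> \<in> R \<Longrightarrow>
      (\<integral>\<^sup>+\<beta>. affinity (ref (last \<beta>)) (pc 0 (last \<beta>)) (pc m (last \<beta>)) \<theta> * ennreal (exp (\<theta> * h \<beta>)) \<partial>measure_pmf (T \<alpha>))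
        \<le> ennreal (exp (- (\<theta> * \<delta>))) * ennreal (exp (\<theta> * h \<alpha>))"
    and h: "\<And>\<alpha>. \<alpha> \<in> windows W \<Longrightarrow> \<bar>h \<alpha>\<bar> \<le> b"
  shows "esssup P (nn_cond_exp P (H (\<nu> - 1)) (\<lambda>\<omega>. ennreal_of_enat (cusum_time M pc m A Y \<gamma> \<omega>) + 1 - of_nat \<nu>))
    \<le> ennreal (ln (real M * \<gamma>) / \<delta> + (real (wlen W) + 1 + exp (2 * \<theta> * b) / (1 - exp (- (\<theta> * \<delta>)))))"
proof (rule esssup_nn_cond_exp_le[OF prob_space_axioms subalgebra_history])
  fix B assume B: "B \<in> sets (H (\<nu> - 1))"
  define n0 where "n0 = \<nu> - 1 - wlen W"
  define s where "s = wlen W + n0"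
  define c where "c = ln (real M * \<gamma>)"
  define \<epsilon> where "\<epsilon> = exp (- (\<theta> * \<delta>))"
  define C where "C = exp (2 * \<theta> * b)"
  define N where "N = nat \<lceil>c / \<delta>\<rceil>"
  let ?al = "alive pc m A Y c"
  have \<epsilon>: "0 < \<epsilon>" "\<epsilon> < 1" using \<theta> \<delta> by (auto simp: \<epsilon>_def)
  have s: "\<nu> - 1 \<le> s" "s + 1 \<le> \<nu> + wlen W" using \<nu> by (auto simp: s_def n0_def)
  have Bs: "B \<in> sets (H (wlen W + n0))"
    using subalgebra_history_mono[OF s(1)] B by (auto simp: subalgebra_def s_def)
  have BP [measurable]: "B \<in> sets P" using subalgebra_history B by (auto simp: subalgebra_def)
  have al [measurable]: "Measurable.pred P (?al t)" for t
    using measurable_from_subalg[OF subalgebra_history alive_measurable[OF order_refl]] .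
  define D where "D n = (\<integral>\<^sup>+\<omega>. indicator B \<omega> * of_bool (?al (s + n) \<omega>) \<partial>P)" for n
  have D: "D n \<le> ennreal (if n < N then 1 else C * \<epsilon> ^ (n - N)) * emeasure P B" for n
  proof (cases "n < N")
    case True
    have "D n \<le> (\<integral>\<^sup>+\<omega>. indicator B \<omega> \<partial>P)" unfolding D_def by (intro nn_integral_mono) auto
    then show ?thesis using True by simp
  next
    case False
    have "c / \<delta> \<le> real N" unfolding N_def by linarith
    then have "c \<le> real N * \<delta>" using \<delta> by (simp add: field_simps)
    then have "\<theta> * (c - real n * \<delta>) \<le> real (n - N) * (- (\<theta> * \<delta>))"
      using False mult_left_mono[of c "real N * \<delta>" \<theta>] \<theta> by (simp add: of_nat_diff algebra_simps)
    then have "C * exp (\<theta> * (c - real n * \<delta>)) \<le> C * \<epsilon> ^ (n - N)"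
      unfolding \<epsilon>_def exp_of_nat_mult[symmetric] by (simp add: C_def)
    moreover have "D n \<le> ennreal (C * exp (\<theta> * (c - real n * \<delta>))) * emeasure P B"
      unfolding D_def s_def C_def
      using s(1) by (intro alive_tail[OF _ R \<theta> _ drift h Bs]) (auto simp: c c_def s_def intro: post)
    ultimately show ?thesis
      using False order_trans[OF _ mult_right_mono[OF ennreal_leI]] by auto
  qed
  have "real (min l N) + C * (1 - \<epsilon> ^ (l - N)) / (1 - \<epsilon>) \<le> c / \<delta> + 1 + C / (1 - \<epsilon>)" for l
  proof -
    have "real N \<le> c / \<delta> + 1" using c \<delta> unfolding N_def c_def by (simp add: divide_nonneg_pos)
    moreover have "C * (1 - \<epsilon> ^ (l - N)) / (1 - \<epsilon>) \<le> C / (1 - \<epsilon>)"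
      using \<epsilon> by (intro divide_right_mono) (auto simp: C_def)
    ultimately show ?thesis by linarith
  qed
  then have geo: "(\<Sum>n<l. if n < N then 1 else C * \<epsilon> ^ (n - N)) \<le> c / \<delta> + 1 + C / (1 - \<epsilon>)" for l
    using \<epsilon> by (subst sum_truncated_geometric) auto
  have sumD: "(\<Sum>n. D n) \<le> ennreal (c / \<delta> + 1 + C / (1 - \<epsilon>)) * emeasure P B"
  proof (rule suminf_le_const)
    fix l
    have "(\<Sum>n<l. D n) \<le> (\<Sum>n<l. ennreal (if n < N then 1 else C * \<epsilon> ^ (n - N)) * emeasure P B)"
      by (intro sum_mono D)
    also have "\<dots> = ennreal (\<Sum>n<l. if n < N then 1 else C * \<epsilon> ^ (n - N)) * emeasure P B"
      using \<epsilon> by (simp add: sum_distrib_right[symmetric] C_def sum_ennreal del: if_distrib)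
    also have "\<dots> \<le> ennreal (c / \<delta> + 1 + C / (1 - \<epsilon>)) * emeasure P B"
      by (intro mult_right_mono ennreal_leI geo) simp
    finally show "(\<Sum>n<l. D n) \<le> ennreal (c / \<delta> + 1 + C / (1 - \<epsilon>)) * emeasure P B" .
  qed simp
  have "(\<integral>\<^sup>+\<omega>. indicator B \<omega> * (ennreal_of_enat (cusum_time M pc m A Y \<gamma> \<omega>) + 1 - of_nat \<nu>) \<partial>P)
      \<le> (\<integral>\<^sup>+\<omega>. of_nat (wlen W) * indicator B \<omega> + (\<Sum>n. indicator B \<omega> * of_bool (?al (s + n) \<omega>)) \<partial>P)"
  proof (rule nn_integral_mono)
    fix \<omega>
    let ?S = "(\<Sum>n. of_bool (?al (s + n) \<omega>)) :: ennreal"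
    have "ennreal_of_enat (cusum_time M pc m A Y \<gamma> \<omega>) + 1 \<le> of_nat s + ?S + 1"
      unfolding c_def by (intro add_right_mono cusum_time_le_suminf)
    also have "\<dots> = of_nat (s + 1) + ?S" by (simp add: ac_simps)
    also have "\<dots> \<le> of_nat (\<nu> + wlen W) + ?S" using s(2) by (intro add_right_mono of_nat_mono)
    also have "\<dots> = of_nat \<nu> + (of_nat (wlen W) + ?S)" by (simp add: add.assoc)
    finally have "ennreal_of_enat (cusum_time M pc m A Y \<gamma> \<omega>) + 1 - of_nat \<nu> \<le> of_nat (wlen W) + ?S"
      by (simp add: ennreal_minus_le_iff)
    then show "indicator B \<omega> * (ennreal_of_enat (cusum_time M pc m A Y \<gamma> \<omega>) + 1 - of_nat \<nu>)
      \<le> of_nat (wlen W) * indicator B \<omega> + (\<Sum>n. indicator B \<omega> * of_bool (?al (s + n) \<omega>))"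
      by (cases "\<omega> \<in> B") auto
  qed
  also have "\<dots> = of_nat (wlen W) * emeasure P B + (\<Sum>n. D n)"
  proof -
    have [measurable]: "(\<lambda>\<omega>. indicator B \<omega> * of_bool (?al (s + n) \<omega>) :: ennreal) \<in> borel_measurable P" for n
      unfolding of_bool_def by measurable
    show ?thesis
      unfolding D_def by (subst nn_integral_add, measurable)
        (subst nn_integral_suminf, measurable, simp add: nn_integral_cmult)
  qed
  also have "\<dots> \<le> of_nat (wlen W) * emeasure P B + ennreal (c / \<delta> + 1 + C / (1 - \<epsilon>)) * emeasure P B"
    by (rule add_left_mono[OF sumD])
  also have "\<dots> = ennreal (c / \<delta> + (real (wlen W) + 1 + C / (1 - \<epsilon>))) * emeasure P B"
  proof -
    have "0 \<le> c / \<delta> + 1 + C / (1 - \<epsilon>)" using c \<delta> \<epsilon> by (simp add: c_def C_def)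
    then have "ennreal (c / \<delta> + (real (wlen W) + 1 + C / (1 - \<epsilon>)))
        = of_nat (wlen W) + ennreal (c / \<delta> + 1 + C / (1 - \<epsilon>))"
      by (simp add: ennreal_of_nat_eq_real_of_nat ennreal_plus[symmetric] algebra_simps del: ennreal_plus)
    then show ?thesis by (simp add: distrib_right)
  qed
  finally show "(\<integral>\<^sup>+\<omega>. indicator B \<omega> * (ennreal_of_enat (cusum_time M pc m A Y \<gamma> \<omega>) + 1 - of_nat \<nu>) \<partial>P)
    \<le> ennreal (ln (real M * \<gamma>) / \<delta> + (real (wlen W) + 1 + exp (2 * \<theta> * b) / (1 - exp (- (\<theta> * \<delta>))))) * emeasure P B"
    unfolding c_def C_def \<epsilon>_def .
qed

end

section \<open>Asymptotics in the false alarm level\<close>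

text \<open>
  The relative excess \<open>g\<close> of \<open>V\<close> over \<open>ln \<gamma> / I\<close> has upper limit at most \<open>I / \<delta> - 1\<close> for each
  \<open>\<delta>\<close>, hence tends to 0, although the constants \<open>K\<close> may blow up as \<open>\<delta>\<close> approaches \<open>I\<close>.
\<close>

lemma asymptotic_from_affine_bounds:
  fixes V :: "real \<Rightarrow> ennreal" and I M :: real
  assumes I: "0 < I" and M: "1 \<le> M"
    and bound: "\<And>\<delta>. 0 < \<delta> \<Longrightarrow> \<delta> < I \<Longrightarrow> \<exists>K. \<forall>\<gamma>\<ge>1. V \<gamma> \<le> ennreal (ln (M * \<gamma>) / \<delta> + K)"
  shows "\<exists>g :: real \<Rightarrow> real. (g \<longlongrightarrow> 0) at_top \<and>
    (\<forall>\<^sub>F \<gamma> in at_top. V \<gamma> \<le> ennreal (ln \<gamma>) / ennreal I * ennreal (1 + g \<gamma>))"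
proof (intro exI conjI)
  define g where "g \<gamma> = max 0 (I * enn2real (V \<gamma>) / ln \<gamma> - 1)" for \<gamma>
  show "(g \<longlongrightarrow> 0) at_top"
  proof (rule tendstoI)
    fix e :: real assume e: "0 < e"
    \<comment> \<open>half of \<open>e\<close> is spent on \<open>I / \<delta>\<close>, the other half on the constants, which \<open>ln \<gamma>\<close> outgrows\<close>
    define \<delta> where "\<delta> = I / (1 + e / 2)"
    have \<delta>: "0 < \<delta>" "\<delta> < I" "I / \<delta> = 1 + e / 2" using I e by (auto simp: \<delta>_def field_simps)
    obtain K where K: "\<And>\<gamma>. 1 \<le> \<gamma> \<Longrightarrow> V \<gamma> \<le> ennreal (ln (M * \<gamma>) / \<delta> + K)" using bound[OF \<delta>(1,2)] by blast
    define K' where "K' = (1 + e / 2) * ln M + I * \<bar>K\<bar>"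
    have "((\<lambda>\<gamma>. K' / ln \<gamma>) \<longlongrightarrow> 0) at_top"
      by (intro tendsto_divide_0[OF tendsto_const] filterlim_at_top_imp_at_infinity ln_at_top)
    then have "\<forall>\<^sub>F \<gamma> in at_top. K' / ln \<gamma> < e / 2" using e by (intro order_tendstoD) auto
    moreover have "\<forall>\<^sub>F \<gamma> in at_top. (1 :: real) < \<gamma>" by (rule eventually_gt_at_top)
    ultimately show "\<forall>\<^sub>F \<gamma> in at_top. dist (g \<gamma>) 0 < e"
    proof eventually_elim
      case (elim \<gamma>)
      have ln: "0 < ln \<gamma>" "0 \<le> ln M" using elim M by auto
      have eq: "ln (M * \<gamma>) = ln M + ln \<gamma>" using elim M by (simp add: ln_mult)
      have nonneg: "0 \<le> (ln M + ln \<gamma>) / \<delta> + \<bar>K\<bar>" using ln \<delta> by simp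
      have "V \<gamma> \<le> ennreal ((ln M + ln \<gamma>) / \<delta> + \<bar>K\<bar>)"
        by (rule order_trans[OF K]) (use elim in \<open>auto simp: eq intro!: ennreal_leI\<close>)
      then have "enn2real (V \<gamma>) \<le> (ln M + ln \<gamma>) / \<delta> + \<bar>K\<bar>" using nonneg by (simp add: enn2real_leI)
      then have "I * enn2real (V \<gamma>) \<le> I * ((ln M + ln \<gamma>) / \<delta> + \<bar>K\<bar>)" using I by simp
      also have "\<dots> = (1 + e / 2) * (ln M + ln \<gamma>) + I * \<bar>K\<bar>"
        unfolding \<delta>(3)[symmetric] by (simp add: distrib_left add_divide_distrib)
      also have "\<dots> = K' + (1 + e / 2) * ln \<gamma>" by (simp add: K'_def algebra_simps)
      finally have "I * enn2real (V \<gamma>) / ln \<gamma> \<le> (K' + (1 + e / 2) * ln \<gamma>) / ln \<gamma>"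
        using ln by (intro divide_right_mono) auto
      also have "\<dots> = K' / ln \<gamma> + (1 + e / 2)" using ln by (simp add: add_divide_distrib)
      finally have "I * enn2real (V \<gamma>) / ln \<gamma> - 1 < e" using elim(1) by linarith
      then show ?case using e by (simp add: g_def dist_real_def)
    qed
  qed
  obtain K where K: "\<And>\<gamma>. 1 \<le> \<gamma> \<Longrightarrow> V \<gamma> \<le> ennreal (ln (M * \<gamma>) / (I / 2) + K)" using bound[of "I / 2"] I by auto
  have "\<forall>\<^sub>F \<gamma> in at_top. (1 :: real) < \<gamma>" by (rule eventually_gt_at_top)
  then show "\<forall>\<^sub>F \<gamma> in at_top. V \<gamma> \<le> ennreal (ln \<gamma>) / ennreal I * ennreal (1 + g \<gamma>)"
  proof eventually_elim
    case (elim \<gamma>)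
    have ln: "0 < ln \<gamma>" using elim by simp
    have "V \<gamma> < \<infinity>" using K[of \<gamma>] elim by (auto intro: le_less_trans)
    then have "V \<gamma> = ennreal (enn2real (V \<gamma>))" by simp
    also have "\<dots> \<le> ennreal (ln \<gamma> / I * (1 + g \<gamma>))"
    proof (rule ennreal_leI)
      have "enn2real (V \<gamma>) = ln \<gamma> / I * (I * enn2real (V \<gamma>) / ln \<gamma>)" using I ln by simp
      also have "\<dots> \<le> ln \<gamma> / I * (1 + g \<gamma>)" using I ln by (intro mult_left_mono) (auto simp: g_def)
      finally show "enn2real (V \<gamma>) \<le> ln \<gamma> / I * (1 + g \<gamma>)" .
    qed
    also have "\<dots> = ennreal (ln \<gamma> / I) * ennreal (1 + g \<gamma>)"
      using I ln by (intro ennreal_mult) (auto simp: g_def)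
    also have "ennreal (ln \<gamma> / I) = ennreal (ln \<gamma>) / ennreal I"
      using I ln by (intro divide_ennreal[symmetric]) auto
    finally show ?case .
  qed
qed

theorem proposition1:
  fixes M m W :: nat
    and p :: "nat \<Rightarrow> real ^ 'n::finite \<Rightarrow> real"
    and OS :: "'y measure"
    and ref :: "'a::finite \<Rightarrow> 'y measure"
    and obs :: "'a \<Rightarrow> real ^ 'n \<Rightarrow> 'y"
    and pc :: "nat \<Rightarrow> 'a \<Rightarrow> 'y \<Rightarrow> real"
    and q :: "'a list pmf"
    and T :: "'a list \<Rightarrow> 'a list pmf"
    and P :: "nat \<Rightarrow> nat \<Rightarrow> 'w measure"
    and P_inf :: "'w measure"
    and X :: "nat \<Rightarrow> 'w \<Rightarrow> real ^ 'n"
    and A :: "nat \<Rightarrow> 'w \<Rightarrow> 'a"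
    and Y :: "nat \<Rightarrow> 'w \<Rightarrow> 'y"
  defines "Y \<equiv> observation obs A X"
  assumes model: "sensing_model M p OS ref obs pc"
    and policy: "open_loop_policy W q T"
    and one_class: "\<exists>C. recurrence_class W T C \<and> {\<alpha> \<in> windows W. qbar W q T \<alpha> \<noteq> 0} \<subseteq> C"
    and change: "\<And>\<nu> k. 1 \<le> k \<Longrightarrow> k \<le> M \<Longrightarrow>
      sampled_signal (P \<nu> k) X (\<lambda>t. if t < \<nu> then p 0 else p k) A W q T"
    and no_change: "sampled_signal P_inf X (\<lambda>_. p 0) A W q T"
    and m: "1 \<le> m" "m \<le> M"
  shows "(\<forall>\<gamma>>0. ARL P_inf (cusum_time M pc m A Y \<gamma>) \<ge> ennreal (real M * \<gamma>)) \<and>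
    (info_rate ref pc m W q T < \<infinity> \<longrightarrow>
      (\<exists>g :: real \<Rightarrow> real. (g \<longlongrightarrow> 0) at_top \<and>
        (\<forall>\<^sub>F \<gamma> in at_top.
          WADD (\<lambda>\<nu>. P \<nu> m) OS A Y (cusum_time M pc m A Y \<gamma>)
            \<le> ennreal (ln \<gamma>) / info_rate ref pc m W q T * ennreal (1 + g \<gamma>))))"
proof (intro conjI allI impI)
  have cusum_test: "cusum_test Q X f A W q T OS obs M p ref pc m"
    if "sampled_signal Q X f A W q T" for Q f
    using that policy model m(2) sensing_model.obs_borel[OF model]
    by (simp add: cusum_test_def sensed_signal_def policy_def cusum_test_axioms_def sensed_signal_axioms_def)
  fix \<gamma> :: real assume "0 < \<gamma>"
  then show "ennreal (real M * \<gamma>) \<le> ARL P_inf (cusum_time M pc m A Y \<gamma>)"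
    unfolding Y_def using cusum_test.ARL_ge[OF cusum_test[OF no_change]] m by simp
next
  assume fin: "info_rate ref pc m W q T < \<infinity>"
  interpret policy W q T by unfold_locales (rule policy)
  define I where "I = enn2real (info_rate ref pc m W q T)"
  have I: "info_rate ref pc m W q T = ennreal I" "0 \<le> I" using fin by (auto simp: I_def)
  obtain C where "recurrence_class W T C" "{\<alpha> \<in> windows W. qbar W q T \<alpha> \<noteq> 0} \<subseteq> C" using one_class by blast
  from ergodic_on_reachable[OF this] obtain R where R: "R \<subseteq> windows W" "set_pmf q \<subseteq> R"
    "\<forall>\<alpha>\<in>R. set_pmf (T \<alpha>) \<subseteq> R"
    and Poisson: "\<forall>f e. 0 < e \<longrightarrow> (\<exists>h. \<forall>\<alpha>\<in>R.
       (\<Sum>\<beta>\<in>windows W. f \<beta> * qbar W q T \<beta>) - e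
         \<le> (\<Sum>\<beta>\<in>windows W. pmf (T \<alpha>) \<beta> * f \<beta>) + h \<alpha> - (\<Sum>\<beta>\<in>windows W. pmf (T \<alpha>) \<beta> * h \<beta>))"
    by (elim exE conjE)
  let ?V = "\<lambda>\<gamma>. WADD (\<lambda>\<nu>. P \<nu> m) OS A Y (cusum_time M pc m A Y \<gamma>)"
  show "\<exists>g :: real \<Rightarrow> real. (g \<longlongrightarrow> 0) at_top \<and>
        (\<forall>\<^sub>F \<gamma> in at_top. ?V \<gamma> \<le> ennreal (ln \<gamma>) / info_rate ref pc m W q T * ennreal (1 + g \<gamma>))"
  proof (cases "I = 0")
    case True
    \<comment> \<open>the bound is infinite as soon as \<open>ln \<gamma>\<close> is positive\<close>
    have "\<forall>\<^sub>F \<gamma> in at_top. (1 :: real) < \<gamma>" by (rule eventually_gt_at_top)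
    then have "\<forall>\<^sub>F \<gamma> in at_top. ?V \<gamma> \<le> ennreal (ln \<gamma>) / info_rate ref pc m W q T * ennreal (1 + 0)"
      by eventually_elim (simp add: I(1) True ennreal_divide_zero)
    then show ?thesis by (intro exI[of _ "\<lambda>_. 0"]) simp
  next
    case False
    then have "0 < I" using I(2) by simp
    then show ?thesis
      unfolding I(1)
    proof (rule asymptotic_from_affine_bounds[where M = "real M"])
      show M: "1 \<le> real M" using m by simp
      fix \<delta> assume \<delta>: "0 < \<delta>" "\<delta> < I"
      obtain \<theta> h where \<theta>: "0 < \<theta>" and drift: "\<forall>\<alpha>\<in>R.
          (\<integral>\<^sup>+\<beta>. affinity (ref (last \<beta>)) (pc 0 (last \<beta>)) (pc m (last \<beta>)) \<theta> * ennreal (exp (\<theta> * h \<beta>)) \<partial>measure_pmf (T \<alpha>))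
            \<le> ennreal (exp (- (\<theta> * \<delta>))) * ennreal (exp (\<theta> * h \<alpha>))"
        using tilting_constants[OF model m(2) R(1) R(3)[rule_format] Poisson[rule_format] fin \<delta>(2)[unfolded I_def]] by blast
      obtain b where b: "\<forall>\<alpha>\<in>windows W. \<bar>h \<alpha>\<bar> \<le> b" using abs_bound_exists by blast
      show "\<exists>K. \<forall>\<gamma>\<ge>1. ?V \<gamma> \<le> ennreal (ln (real M * \<gamma>) / \<delta> + K)"
        unfolding WADD_def
      proof (intro exI allI impI SUP_least)
        fix \<gamma> :: real and \<nu> :: nat assume \<gamma>: "1 \<le> \<gamma>" and \<nu>: "\<nu> \<in> {1..}"
        interpret cusum_test "P \<nu> m" X "\<lambda>t. if t < \<nu> then p 0 else p m" A W q T OS obs M p ref pc m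
          using change[of m \<nu>] policy model m sensing_model.obs_borel[OF model]
          by (simp add: cusum_test_def sensed_signal_def policy_def cusum_test_axioms_def sensed_signal_axioms_def)
        have "1 * 1 \<le> real M * \<gamma>" using M \<gamma> by (intro mult_mono) auto
        then have "0 \<le> ln (real M * \<gamma>)" by simp
        then show "esssup (P \<nu> m) (nn_cond_exp (P \<nu> m) (history (space (P \<nu> m)) OS A Y (\<nu> - 1))
              (\<lambda>\<omega>. ennreal_of_enat (cusum_time M pc m A Y \<gamma> \<omega>) + 1 - of_nat \<nu>))
            \<le> ennreal (ln (real M * \<gamma>) / \<delta> + (real (wlen W) + 1 + exp (2 * \<theta> * b) / (1 - exp (- (\<theta> * \<delta>)))))"
          unfolding Y_def using \<nu> R \<theta> \<delta>(1) drift b by (intro conditional_delay_le[where R = R]) auto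
      qed
    qed
  qed
qed

end
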